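(* Let $\Delta\ge 3$ be an integer and let $\boldsymbol\pi=(\pi_0,\ldots,\pi_\Delta)$ be given by $$\pi_j = \binom{\Delta}{j}(\Delta-2)^{-j}\Big((\Delta-2)+(6-5\Delta)j+2(\Delta-1)j^2\Big),\qquad j\in\{0,\ldots,\Delta\}.$$ Let $\mathbf{c}=(c_0,\ldots,c_\Delta)\in\mathbb{R}^{\Delta+1}$ be a convex vector. Then $\mathbf{c}$ is a direction of uniqueness if $\boldsymbol\pi\cdot\mathbf{c}<0$, and a direction of non-uniqueness if $\boldsymbol\pi\cdot\mathbf{c}>0$.
   Context: Convexity: a vector $(x_0,\ldots,x_n)$ is convex if $x_{i+1}-x_i\ge x_i-x_{i-1}$ for all $i\in\{1,\ldots,n-1\}$. $\mathbf{1}$ is the all-ones vector in $\mathbb{R}^{\Delta+1}$, and $\lambda_\Delta = (\Delta-1)^{\Delta-1}(\Delta-2)^{-\Delta}$. Directions. $\mathbf{c}$ is a direction of uniqueness if there exists $\epsilon_{\mathbf{c}}>0$ such that for all $h\in(0,\epsilon_{\mathbf{c}})$, $(\lambda_\Delta,\mathbf{1}+\mathbf{c}h)$ belongs to the uniqueness regime; it is a direction of non-uniqueness if there exists $\epsilon_{\mathbf{c}}>0$ such that for all $h\in(0,\epsilon_{\mathbf{c}})$, $(\lambda_\Delta,\mathbf{1}+\mathbf{c}h)$ does not belong to the uniqueness regime. (Here $\epsilon_{\mathbf c}$ is small enough that $\mathbf{1}+\mathbf{c}h$ is strictly positive.) Model. $T_\infty$ is the infinite $\Delta$-regular tree, rooted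 at a node $0$, with graph distance $d(\cdot,\cdot)$; $T_\infty$ also denotes its node set. For $S \subseteq T_\infty$, $\Omega_S = \{0,1\}^S$ and $\Omega=\Omega_{T_\infty}$; for $\omega\in\Omega_S$ write $\omega_{\{i\}}$ for the spin at $i$, $\omega_{S'}$ for the restriction to $S'\subseteq S$, and $|\omega| = \sum_{i\in S}\omega_{\{i\}}$. $\tilde\Omega_S \subseteq \Omega_S$ is the set of $\omega$ with no two adjacent nodes of $S$ both having spin $1$. For disjoint $S_1,S_2$, $\omega^1\cdot\omega^2$ denotes the combined configuration. $\partial S$ is the set of nodes not in $S$ at distance at most $2$ from $S$. For a node $i$, $N(i)$ is the set consisting of $i$ and its $\Delta$ neighbors. For $\lambda>0$ and strictly positive $\boldsymbol\theta=(\theta_0,\ldots,\theta_\Delta)$, define for each node $i$ and $\omega\in\Omega_{N(i)}$ the potential $\Phi_{N(i)}(\omega) = -\log\lambda$ if $\omega_{\{i\}}=1$ and $|\omega_{N(i)}|=1$; $\Phi_{N(i)}(\omega)=-\log\theta_k$ if $\omega_{\{i\}}=0$ and $|\omega_{N(i)}|=k$; $\Phi_{N(i)}(\omega)=\infty$ otherwise. All other potentials are zero. This family of potentials is denoted $(\lambda,\boldsymbol\theta)$. For finite $\Lambda\subseteq T_\infty$ and $\omega\in\Omega_{\Lambda\cup\partial\Lambda}$, the Hamiltonian is $\mathcal{H}_\Lambda(\omega) = \sum_{i:\,N(i)\cap\Lambda\ne\emptyset}\Phi_{N(i)}(\omega_{N(i)})$. For finite $S\subseteq\Lambda$, $\omega\in\Omega_S$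 and $\eta\in\tilde\Omega_{\partial\Lambda}$, $$\mathbb{P}_{\lambda,\boldsymbol\theta,\Lambda}(S=\omega\mid\eta) = \frac{\sum_{\nu\in\Omega_\Lambda:\,\nu_S=\omega}\exp(-\mathcal{H}_\Lambda(\nu\cdot\eta))}{\sum_{\nu\in\Omega_\Lambda}\exp(-\mathcal{H}_\Lambda(\nu\cdot\eta))},\qquad \exp(-\infty)=0.$$ Uniqueness regime. An infinite-volume Gibbs measure consistent with $(\lambda,\boldsymbol\theta)$ is a probability measure $\mu$ on $\Omega$ (product $\sigma$-algebra), concentrated on configurations with no two adjacent nodes both having spin $1$, such that for all finite $S\subseteq\Lambda\subseteq T_\infty$ and $\omega\in\Omega_S$, $\mu(S=\omega) = \sum_{\eta\in\tilde\Omega_{\partial\Lambda}}\mathbb{P}_{\lambda,\boldsymbol\theta,\Lambda}(S=\omega\mid\eta)\,\mu(\partial\Lambda=\eta)$, where $\{S=\omega\}$ is the event that the nodes of $S$ receive the spins $\omega$. $(\lambda,\boldsymbol\theta)$ belongs to the uniqueness regime if there is exactly one such measure. *)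

theory Defs
  imports "HOL-Probability.Probability"
begin

(* The infinite D-regular tree rooted at []: a node is the word of child indices leading to it,
   most recent step first, so the children of w are the words a # w.  The root has D children
   and every other node has D - 1, hence D neighbours each. *)
inductive_set tree :: "nat \<Rightarrow> nat list set" for D :: nat where
  root: "[] \<in> tree D"
| child: "w \<in> tree D \<Longrightarrow> a < (if w = [] then D else D - 1) \<Longrightarrow> a # w \<in> tree D"

definition tree_adj :: "nat \<Rightarrow> nat list \<Rightarrow> nat list \<Rightarrow> bool" where
  "tree_adj D v w \<longleftrightarrow> v \<in> tree D \<and> w \<in> tree D \<and> (\<exists>a. w = a # v \<or> v = a # w)"

definition tree_dist :: "nat \<Rightarrow> nat list \<Rightarrow> nat list \<Rightarrow> nat" where
  "tree_dist D v w = (LEAST n. (tree_adj D ^^ n) v w)"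

definition nbhd :: "nat \<Rightarrow> nat list \<Rightarrow> nat list set" where
  "nbhd D i = insert i {j. tree_adj D i j}"

lemma card_neighbours:
  assumes "D \<ge> 1" "v \<in> tree D"
  shows "card {w. tree_adj D v w} = D"
proof (cases v)
  case Nil
  have "{w. tree_adj D v w} = (\<lambda>a. [a]) ` {..<D}"
    using assms by (auto simp: Nil tree_adj_def intro: tree.intros elim: tree.cases)
  then show ?thesis
    by (simp add: card_image inj_on_def)
next
  case (Cons b u)
  have u: "u \<in> tree D"
    using assms(2) Cons by (auto elim: tree.cases)
  have "{w. tree_adj D v w} = insert u ((\<lambda>a. a # v) ` {..<D - 1})"
    using assms u by (auto simp: Cons tree_adj_def intro: tree.intros elim: tree.cases)
  moreover have "u \<notin> (\<lambda>a. a # v) ` {..<D - 1}"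
    by (auto simp: Cons)
  ultimately show ?thesis
    using assms(1) by (simp add: card_image inj_on_def)
qed

definition boundary :: "nat \<Rightarrow> nat list set \<Rightarrow> nat list set" where
  "boundary D S = {i \<in> tree D - S. \<exists>j\<in>S. tree_dist D i j \<le> 2}"

definition configs :: "nat list set \<Rightarrow> (nat list \<Rightarrow> nat) set" where
  "configs S = S \<rightarrow>\<^sub>E {0, 1}"

definition hardcore :: "nat \<Rightarrow> nat list set \<Rightarrow> (nat list \<Rightarrow> nat) set" where
  "hardcore D S = {\<omega> \<in> configs S. \<forall>i\<in>S. \<forall>j\<in>S. tree_adj D i j \<longrightarrow> \<not> (\<omega> i = 1 \<and> \<omega> j = 1)}"

(* The potential of nbhd D i, as a function of a configuration on nbhd D i.  In the second case
   the number of occupied sites is at most D, so only theta 0, ..., theta D are ever used. *)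
definition potential ::
    "nat \<Rightarrow> real \<Rightarrow> (nat \<Rightarrow> real) \<Rightarrow> nat list \<Rightarrow> (nat list \<Rightarrow> nat) \<Rightarrow> ereal" where
  "potential D lam \<theta> i \<omega> =
     (if \<omega> i = 1 \<and> (\<Sum>j\<in>nbhd D i. \<omega> j) = 1 then ereal (- ln lam)
      else if \<omega> i = 0 then ereal (- ln (\<theta> (\<Sum>j\<in>nbhd D i. \<omega> j)))
      else \<infinity>)"

definition hamiltonian ::
    "nat \<Rightarrow> real \<Rightarrow> (nat \<Rightarrow> real) \<Rightarrow> nat list set \<Rightarrow> (nat list \<Rightarrow> nat) \<Rightarrow> ereal" where
  "hamiltonian D lam \<theta> \<Lambda> \<omega> =
     (\<Sum>i\<in>{i \<in> tree D. nbhd D i \<inter> \<Lambda> \<noteq> {}}. potential D lam \<theta> i (restrict \<omega> (nbhd D i)))"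

(* exp (- E) with exp (- infinity) = 0; energies are never - infinity. *)
definition boltzmann :: "ereal \<Rightarrow> real" where
  "boltzmann E = (if E = \<infinity> then 0 else exp (- real_of_ereal E))"

definition finite_prob ::
    "nat \<Rightarrow> real \<Rightarrow> (nat \<Rightarrow> real) \<Rightarrow> nat list set \<Rightarrow> nat list set
      \<Rightarrow> (nat list \<Rightarrow> nat) \<Rightarrow> (nat list \<Rightarrow> nat) \<Rightarrow> real" where
  "finite_prob D lam \<theta> \<Lambda> S \<omega> \<eta> =
     (\<Sum>\<nu>\<in>{\<nu> \<in> configs \<Lambda>. restrict \<nu> S = \<omega>}.
        boltzmann (hamiltonian D lam \<theta> \<Lambda> (merge \<Lambda> (boundary D \<Lambda>) (\<nu>, \<eta>)))) /
     (\<Sum>\<nu>\<in>configs \<Lambda>.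
        boltzmann (hamiltonian D lam \<theta> \<Lambda> (merge \<Lambda> (boundary D \<Lambda>) (\<nu>, \<eta>))))"

definition gibbs_measure ::
    "nat \<Rightarrow> real \<Rightarrow> (nat \<Rightarrow> real) \<Rightarrow> (nat list \<Rightarrow> nat) measure \<Rightarrow> bool" where
  "gibbs_measure D lam \<theta> M \<longleftrightarrow>
     prob_space M \<and>
     sets M = sets (PiM (tree D) (\<lambda>_. count_space {0, 1})) \<and>
     (AE \<omega> in M. \<omega> \<in> hardcore D (tree D)) \<and>
     (\<forall>\<Lambda> S \<omega>. finite \<Lambda> \<and> \<Lambda> \<subseteq> tree D \<and> S \<subseteq> \<Lambda> \<and> \<omega> \<in> configs S \<longrightarrow>
        measure M {x \<in> space M. restrict x S = \<omega>} =
        (\<Sum>\<eta>\<in>hardcore D (boundary D \<Lambda>).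
           finite_prob D lam \<theta> \<Lambda> S \<omega> \<eta> *
           measure M {x \<in> space M. restrict x (boundary D \<Lambda>) = \<eta>}))"

definition uniqueness_regime :: "nat \<Rightarrow> real \<Rightarrow> (nat \<Rightarrow> real) \<Rightarrow> bool" where
  "uniqueness_regime D lam \<theta> \<longleftrightarrow> (\<exists>!M. gibbs_measure D lam \<theta> M)"

definition lambda_crit :: "nat \<Rightarrow> real" where
  "lambda_crit D = (real D - 1) ^ (D - 1) / (real D - 2) ^ D"

(* Vectors (x_0, ..., x_n) are functions on nat of which only the values at 0, ..., n matter. *)
definition convex_vector :: "nat \<Rightarrow> (nat \<Rightarrow> real) \<Rightarrow> bool" where
  "convex_vector n x \<longleftrightarrow> (\<forall>i\<in>{1..n - 1}. x (i + 1) - x i \<ge> x i - x (i - 1))"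

definition direction_of_uniqueness :: "nat \<Rightarrow> (nat \<Rightarrow> real) \<Rightarrow> bool" where
  "direction_of_uniqueness D c \<longleftrightarrow>
     (\<exists>\<epsilon>>0. \<forall>h\<in>{0<..<\<epsilon>}. (\<forall>k\<le>D. 1 + c k * h > 0) \<and>
        uniqueness_regime D (lambda_crit D) (\<lambda>k. 1 + c k * h))"

definition direction_of_nonuniqueness :: "nat \<Rightarrow> (nat \<Rightarrow> real) \<Rightarrow> bool" where
  "direction_of_nonuniqueness D c \<longleftrightarrow>
     (\<exists>\<epsilon>>0. \<forall>h\<in>{0<..<\<epsilon>}. (\<forall>k\<le>D. 1 + c k * h > 0) \<and>
        \<not> uniqueness_regime D (lambda_crit D) (\<lambda>k. 1 + c k * h))"

definition pi_vec :: "nat \<Rightarrow> nat \<Rightarrow> real" where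
  "pi_vec D j = real (D choose j) / (real D - 2) ^ j *
     ((real D - 2) + (6 - 5 * real D) * real j + 2 * (real D - 1) * (real j)\<^sup>2)"

end

(* Rooted at a vertex, the model is a two-message recursion: with x the odds that a child is occupied
   (parent empty) and y the weight ratio for an occupied versus an empty parent, one has
   x = lam * (prod of y over the D - 1 children) / E(x) and y = E'(x) / E(x), where E and E' are the
   offspring polynomials with coefficients theta_k and theta_(k+1).  Every solution of this recursion
   along the levels of the tree yields a Gibbs measure, so a two-cycle l < u yields two of them.
   Conversely, for small h the ratio E'/E is monotone in x (increasing if c is convex and not affine,
   decreasing if c is affine), so all messages are squeezed between the iterates of a mixed monotone
   two-point map; if the only solution of A(u) M(l) = lam = A(l) M(u) is l = u, the boundary condition
   is forgotten and the Gibbs measure is unique.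

   For h = 0 the function M has negative Schwarzian derivative relative to A, which persists for small h
   and implies that a two-cycle around the fixed point x forces A'/A <= M'/M at x; if A'/A < M'/M at x, a
   two-cycle exists by the intermediate value theorem.  At criticality A'/A = M'/M at x = 1/(D - 2), and
   the derivative in h of the difference is a negative multiple of the pairing of pi_vec with c. *)
theory Submission
  imports Defs "HOL-Computational_Algebra.Polynomial"
begin

section \<open>The tree and local weights\<close>

text \<open>At h = 0 the linear stability test is exactly degenerate. Stability gained only at first
  order in h has to exclude two-cycles throughout a fixed interval, uniformly for small h. The
  Schwarzian does this: on a logarithmic scale, with M as a function of A, a nonpositive Schwarzian
  makes the power -1/2 of the derivative convex, and the tangent of that convex function at the
  fixed point bounds both halves of a cycle.

  Boundary conditions give siblings different odds, so the recursion carries one variable per child;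
  monotonicity in each variable reduces the extreme cases to constant vectors. For affine c the
  extremal messages solve a pair of equations that differs from the two-cycle equations. The
  parameter \<open>e\<close> covers both systems: they have the same fixed points and, for affine c,
  the same first-order rate.

  The fixed point is never differentiated in h. A test point placed, to first order, between the
  fixed point and the zero of the stability quantity is compared with the fixed point by
  monotonicity.\<close>

definition children :: "nat \<Rightarrow> nat list \<Rightarrow> nat list set" where
  "children D v = (\<lambda>a. a # v) ` {..<(if v = [] then D else D - 1)}"

definition layer :: "nat \<Rightarrow> nat \<Rightarrow> nat list set" where
  "layer D n = {v \<in> tree D. length v = n}"

definition ball_tree :: "nat \<Rightarrow> nat \<Rightarrow> nat list set" where
  "ball_tree D n = {v \<in> tree D. length v \<le> n}"

lemma finite_children [simp]: "finite (children D v)"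
  by (simp add: children_def)

lemma card_children: "card (children D v) = (if v = [] then D else D - 1)"
  by (simp add: children_def card_image inj_on_def)

lemma Cons_mem_tree: "a # w \<in> tree D \<longleftrightarrow> w \<in> tree D \<and> a < (if w = [] then D else D - 1)"
proof
  assume "a # w \<in> tree D"
  then show "w \<in> tree D \<and> a < (if w = [] then D else D - 1)"
    by (cases rule: tree.cases) auto
qed (auto intro: tree.child)

lemma tl_mem_tree: "v \<in> tree D \<Longrightarrow> tl v \<in> tree D"
  by (cases v) (auto simp: Cons_mem_tree intro: tree.root)

lemma mem_children_iff: "v \<in> tree D \<Longrightarrow> c \<in> children D v \<longleftrightarrow> c \<in> tree D \<and> c \<noteq> [] \<and> tl c = v"
  by (cases c) (auto simp: children_def Cons_mem_tree)

lemma self_notin_children [simp]: "v \<notin> children D v"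
  by (auto simp: children_def)

lemma tl_notin_children [simp]: "tl v \<notin> children D v"
  by (cases v) (auto simp: children_def dest: arg_cong[where f = length])

lemma nbhd_eq:
  assumes "v \<in> tree D"
  shows "nbhd D v = (if v = [] then insert v (children D v) else insert v (insert (tl v) (children D v)))"
  using assms tl_mem_tree[OF assms]
  by (cases v) (auto simp: nbhd_def tree_adj_def mem_children_iff neq_Nil_conv Cons_mem_tree)

lemma nbhd_outside: "v \<notin> tree D \<Longrightarrow> nbhd D v = {v}"
  by (auto simp: nbhd_def tree_adj_def)

lemma finite_nbhd: "finite (nbhd D v)"
  by (cases "v \<in> tree D") (auto simp: nbhd_eq nbhd_outside)

lemma nbhd_sym: "j \<in> nbhd D i \<longleftrightarrow> i \<in> nbhd D j"
  by (auto simp: nbhd_def tree_adj_def)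

lemma nbhd_subset_tree: "i \<in> tree D \<Longrightarrow> nbhd D i \<subseteq> tree D"
  by (auto simp: nbhd_def tree_adj_def)

lemma layer_Suc: "layer D (Suc n) = (\<Union>v\<in>layer D n. children D v)"
proof (intro set_eqI iffI)
  fix v assume "v \<in> layer D (Suc n)"
  then have "tl v \<in> layer D n" "v \<in> children D (tl v)"
    using tl_mem_tree[of v D] by (auto simp: layer_def mem_children_iff)
  then show "v \<in> (\<Union>v\<in>layer D n. children D v)" by blast
next
  fix v assume "v \<in> (\<Union>v\<in>layer D n. children D v)"
  then show "v \<in> layer D (Suc n)"
    by (cases v) (auto simp: layer_def mem_children_iff)
qed

lemma layer_0: "layer D 0 = {[]}"
  by (auto simp: layer_def tree.root)

lemma finite_layer [simp]: "finite (layer D n)"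
  by (induction n) (auto simp: layer_0 layer_Suc)

lemma ball_tree_Suc: "ball_tree D (Suc n) = ball_tree D n \<union> layer D (Suc n)"
  by (auto simp: ball_tree_def layer_def le_Suc_eq)

lemma finite_ball_tree [simp]: "finite (ball_tree D n)"
proof (induction n)
  case 0
  show ?case using finite_layer[of D 0] by (simp add: ball_tree_def layer_def)
qed (simp add: ball_tree_Suc)

lemma ball_tree_subset: "ball_tree D n \<subseteq> tree D"
  by (auto simp: ball_tree_def)

lemma ball_tree_mono: "m \<le> n \<Longrightarrow> ball_tree D m \<subseteq> ball_tree D n"
  by (auto simp: ball_tree_def)

lemma finite_subset_ball_tree:
  assumes "finite J" "J \<subseteq> tree D"
  obtains n where "J \<subseteq> ball_tree D n"
proof
  show "J \<subseteq> ball_tree D (\<Sum>v\<in>J. length v)"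
    using assms by (auto simp: ball_tree_def intro: member_le_sum)
qed

lemma finite_configs [simp]: "finite S \<Longrightarrow> finite (configs S)"
  by (auto simp: configs_def intro: finite_PiE)

lemma configs_range: "\<omega> \<in> configs S \<Longrightarrow> v \<in> S \<Longrightarrow> \<omega> v \<in> {0, 1}"
  by (auto simp: configs_def)

lemma configs_restrict: "\<omega> \<in> configs S \<Longrightarrow> S' \<subseteq> S \<Longrightarrow> restrict \<omega> S' \<in> configs S'"
  unfolding configs_def by (auto simp: PiE_def Pi_def extensional_def)

lemma merge_configs: "\<nu> \<in> configs S \<Longrightarrow> \<eta> \<in> configs S' \<Longrightarrow> merge S S' (\<nu>, \<eta>) \<in> configs (S \<union> S')"
  unfolding configs_def by (auto simp: PiE_def Pi_def extensional_def merge_def)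

lemma relpowp_tree_adj_length:
  "(tree_adj D ^^ n) v w \<Longrightarrow> length v \<le> length w + n"
proof (induction n arbitrary: w)
  case (Suc n)
  then obtain u where "(tree_adj D ^^ n) v u" "tree_adj D u w" by auto
  moreover have "length u \<le> Suc (length w)" using \<open>tree_adj D u w\<close> by (auto simp: tree_adj_def)
  ultimately show ?case using Suc.IH[of u] by auto
qed auto

lemma tree_adj_sym: "tree_adj D v w \<Longrightarrow> tree_adj D w v"
  by (auto simp: tree_adj_def)

lemma tree_connected_root: "v \<in> tree D \<Longrightarrow> (tree_adj D)\<^sup>*\<^sup>* v []"
proof (induction rule: tree.induct)
  case (child w a)
  then have "tree_adj D (a # w) w" by (simp add: tree_adj_def Cons_mem_tree)
  then show ?case using child.IH by (rule converse_rtranclp_into_rtranclp)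
qed simp

lemma tree_connected:
  assumes "v \<in> tree D" "w \<in> tree D"
  shows "(tree_adj D)\<^sup>*\<^sup>* v w"
proof -
  have "symp (tree_adj D)" by (rule sympI) (rule tree_adj_sym)
  then have "(tree_adj D)\<^sup>*\<^sup>* [] w"
    by (rule sympD[OF symp_rtranclp]) (rule tree_connected_root[OF assms(2)])
  with tree_connected_root[OF assms(1)] show ?thesis by (rule rtranclp_trans)
qed

text \<open>Each step changes the depth by at most one. \<open>tree_dist\<close> is a
  \<open>LEAST\<close>, so connectedness has to supply some walk before its value is known to be
  attained.\<close>

lemma tree_dist_length:
  assumes "v \<in> tree D" "w \<in> tree D"
  shows "length v \<le> length w + tree_dist D v w"
proof -
  obtain n where "(tree_adj D ^^ n) v w"
    using rtranclp_imp_relpowp[OF tree_connected[OF assms]] by blast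
  then have "(tree_adj D ^^ tree_dist D v w) v w"
    unfolding tree_dist_def by (rule LeastI)
  then show ?thesis by (rule relpowp_tree_adj_length)
qed

lemma boundary_subset_ball:
  assumes "\<Lambda> \<subseteq> ball_tree D n"
  shows "boundary D \<Lambda> \<subseteq> ball_tree D (n + 2)"
proof
  fix i assume i: "i \<in> boundary D \<Lambda>"
  then obtain j where j: "i \<in> tree D" "j \<in> \<Lambda>" "tree_dist D i j \<le> 2"
    by (auto simp: boundary_def)
  moreover have "j \<in> tree D" "length j \<le> n" using j assms by (auto simp: ball_tree_def)
  ultimately show "i \<in> ball_tree D (n + 2)"
    using tree_dist_length[of i D j] by (auto simp: ball_tree_def)
qed

lemma finite_boundary:
  assumes "finite \<Lambda>" "\<Lambda> \<subseteq> tree D"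
  shows "finite (boundary D \<Lambda>)"
proof -
  obtain n where "\<Lambda> \<subseteq> ball_tree D n" using finite_subset_ball_tree assms .
  from boundary_subset_ball[OF this] show ?thesis by (rule finite_subset) simp
qed

text \<open>Two points of one neighbourhood are joined through its centre in at most two steps,
  which is the radius in \<open>boundary\<close>. Hence the Hamiltonian of \<Lambda> reads spins on
  \<Lambda> and its boundary only.\<close>

lemma nbhd_meets_subset:
  assumes "nbhd D i \<inter> \<Lambda> \<noteq> {}" "\<Lambda> \<subseteq> tree D"
  shows "nbhd D i \<subseteq> \<Lambda> \<union> boundary D \<Lambda>"
proof
  fix k assume k: "k \<in> nbhd D i"
  from assms obtain j where j: "j \<in> nbhd D i" "j \<in> \<Lambda>" by auto
  have i: "i \<in> tree D" using j assms(2) by (auto simp: nbhd_def tree_adj_def)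
  have kt: "k \<in> tree D" using k i nbhd_subset_tree by auto
  have 1: "k = i \<or> tree_adj D k i" using k tree_adj_sym[of D i k] by (auto simp: nbhd_def)
  have 2: "i = j \<or> tree_adj D i j" using j by (auto simp: nbhd_def)
  have "\<exists>n\<le>2. (tree_adj D ^^ n) k j"
  proof -
    have a: "\<exists>n\<le>1. (tree_adj D ^^ n) k i"
      using 1 relpowp_1[of "tree_adj D"] by (metis One_nat_def le_refl relpowp_0_I zero_le)
    then obtain n where n: "n \<le> 1" "(tree_adj D ^^ n) k i" by auto
    show ?thesis using 2
    proof
      assume "i = j" then show ?thesis using n by (auto intro: exI[of _ n])
    next
      assume "tree_adj D i j"
      then have "(tree_adj D ^^ Suc n) k j" using n by auto
      then show ?thesis using n by (intro exI[of _ "Suc n"]) auto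
    qed
  qed
  then obtain n where n: "n \<le> 2" "(tree_adj D ^^ n) k j" by auto
  then have "tree_dist D k j \<le> n" unfolding tree_dist_def by (intro Least_le)
  then show "k \<in> \<Lambda> \<union> boundary D \<Lambda>"
    using n j kt by (auto simp: boundary_def intro!: bexI[of _ j])
qed

lemma boundary_disjoint: "\<Lambda> \<inter> boundary D \<Lambda> = {}"
  by (auto simp: boundary_def)

section \<open>Boltzmann factors as products of local weights\<close>

definition vertex_weight :: "real \<Rightarrow> (nat \<Rightarrow> real) \<Rightarrow> nat \<Rightarrow> nat \<Rightarrow> nat \<Rightarrow> real" where
  "vertex_weight lam \<theta> p s k = (if s = 0 then \<theta> (p + k) else if p + k = 0 then lam else 0)"

text \<open>The neighbourhood sum is split into parent and children because the recursion sums over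
  the children while the parent stays fixed. The root receives a phantom empty parent, so one weight
  serves all vertices.\<close>

definition site_weight :: "nat \<Rightarrow> real \<Rightarrow> (nat \<Rightarrow> real) \<Rightarrow> (nat list \<Rightarrow> nat) \<Rightarrow> nat list \<Rightarrow> real" where
  "site_weight D lam \<theta> \<omega> v =
     vertex_weight lam \<theta> (if v = [] then 0 else \<omega> (tl v)) (\<omega> v) (\<Sum>c\<in>children D v. \<omega> c)"

lemma boltzmann_add:
  "a \<noteq> -\<infinity> \<Longrightarrow> b \<noteq> -\<infinity> \<Longrightarrow> boltzmann (a + b) = boltzmann a * boltzmann b"
  by (cases a; cases b) (auto simp: boltzmann_def exp_add[symmetric])

lemma boltzmann_sum:
  assumes "finite I" "\<And>i. i \<in> I \<Longrightarrow> f i \<noteq> -\<infinity>"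
  shows "boltzmann (\<Sum>i\<in>I. f i) = (\<Prod>i\<in>I. boltzmann (f i))"
proof -
  have "boltzmann (\<Sum>i\<in>I. f i) = (\<Prod>i\<in>I. boltzmann (f i)) \<and> (\<Sum>i\<in>I. f i) \<noteq> -\<infinity>"
    using assms
  proof (induction I rule: finite_induct)
    case (insert x F)
    then show ?case using boltzmann_add[of "f x" "sum f F"] by auto
  qed (simp add: boltzmann_def)
  then show ?thesis by simp
qed

lemma finite_meeting:
  assumes "finite \<Lambda>"
  shows "finite {i \<in> tree D. nbhd D i \<inter> \<Lambda> \<noteq> {}}"
proof (rule finite_subset)
  show "{i \<in> tree D. nbhd D i \<inter> \<Lambda> \<noteq> {}} \<subseteq> (\<Union>j\<in>\<Lambda>. nbhd D j)"
    using nbhd_sym by auto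
qed (use assms finite_nbhd in auto)

lemma boltzmann_potential:
  assumes "D \<ge> 1" "lam > 0" "\<And>k. k \<le> D \<Longrightarrow> \<theta> k > 0" "v \<in> tree D"
    and \<omega>: "\<And>j. j \<in> nbhd D v \<Longrightarrow> \<omega> j \<in> {0, 1}"
  shows "boltzmann (potential D lam \<theta> v (restrict \<omega> (nbhd D v))) = site_weight D lam \<theta> \<omega> v"
proof -
  let ?k = "\<Sum>c\<in>children D v. \<omega> c" and ?p = "if v = [] then 0 else \<omega> (tl v)"
  have vtl: "v \<noteq> [] \<Longrightarrow> v \<noteq> tl v" by (cases v) (auto dest: arg_cong[where f = length])
  have sum_eq: "(\<Sum>j\<in>nbhd D v. restrict \<omega> (nbhd D v) j) = \<omega> v + ?p + ?k"
    using assms(4) vtl by (auto simp: nbhd_eq)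
  have v: "\<omega> v \<in> {0, 1}" "v \<in> nbhd D v" using \<omega>[of v] by (auto simp: nbhd_def)
  \<comment> \<open>Positivity of \<theta>, required to cancel \<open>exp\<close> against
    \<open>ln\<close>, is known only up to \<open>D\<close>. The root has \<open>D\<close> children
    and no parent; any other vertex has \<open>D - 1\<close> children and one parent.\<close>
  have le: "?p + ?k \<le> D"
  proof -
    have "?k \<le> (\<Sum>c\<in>children D v. 1)"
    proof (rule sum_mono)
      fix c assume "c \<in> children D v"
      then have "c \<in> nbhd D v" using assms(4) by (auto simp: nbhd_eq)
      then show "\<omega> c \<le> 1" using \<omega> by fastforce
    qed
    moreover have "?p \<le> (if v = [] then 0 else 1)"
      using \<omega>[of "tl v"] assms(4) by (auto simp: nbhd_eq)
    ultimately show ?thesis using assms(1) by (auto simp: card_children split: if_splits)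
  qed
  show ?thesis
    unfolding potential_def sum_eq site_weight_def vertex_weight_def
    using v le assms(2) assms(3)[of "?p + ?k"] by (auto simp: boltzmann_def)
qed

lemma boltzmann_hamiltonian:
  assumes "D \<ge> 1" "lam > 0" "\<And>k. k \<le> D \<Longrightarrow> \<theta> k > 0" "finite \<Lambda>" "\<Lambda> \<subseteq> tree D"
    and \<omega>: "\<And>j. j \<in> \<Lambda> \<union> boundary D \<Lambda> \<Longrightarrow> \<omega> j \<in> {0, 1}"
  shows "boltzmann (hamiltonian D lam \<theta> \<Lambda> \<omega>) =
    (\<Prod>i\<in>{i \<in> tree D. nbhd D i \<inter> \<Lambda> \<noteq> {}}. site_weight D lam \<theta> \<omega> i)"
proof -
  have "potential D lam \<theta> i \<nu> \<noteq> -\<infinity>" for i \<nu> by (simp add: potential_def)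
  then have "boltzmann (hamiltonian D lam \<theta> \<Lambda> \<omega>) =
      (\<Prod>i\<in>{i \<in> tree D. nbhd D i \<inter> \<Lambda> \<noteq> {}}. boltzmann (potential D lam \<theta> i (restrict \<omega> (nbhd D i))))"
    unfolding hamiltonian_def by (intro boltzmann_sum finite_meeting assms)
  also have "\<dots> = (\<Prod>i\<in>{i \<in> tree D. nbhd D i \<inter> \<Lambda> \<noteq> {}}. site_weight D lam \<theta> \<omega> i)"
    using nbhd_meets_subset[OF _ assms(5)] \<omega>
    by (intro prod.cong refl boltzmann_potential assms) blast+
  finally show ?thesis .
qed

section \<open>Messages\<close>

text \<open>Distributivity over disjoint blocks. Disjointness enters through \<open>own\<close>,
  which names the block of a point; the same map glues a family of block configurations into
  one.\<close>

lemma sum_configs_UN_prod: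
  fixes g :: "nat list \<Rightarrow> (nat list \<Rightarrow> nat) \<Rightarrow> 'b::comm_semiring_1"
  assumes fin: "finite I" "\<And>i. i \<in> I \<Longrightarrow> finite (C i)"
    and own: "\<And>i x. i \<in> I \<Longrightarrow> x \<in> C i \<Longrightarrow> own x = i"
  shows "(\<Sum>f\<in>configs (\<Union>i\<in>I. C i). \<Prod>i\<in>I. g i (restrict f (C i))) =
    (\<Prod>i\<in>I. \<Sum>f\<in>configs (C i). g i f)"
proof -
  have "(\<Prod>i\<in>I. \<Sum>f\<in>configs (C i). g i f) = (\<Sum>h\<in>PiE I (\<lambda>i. configs (C i)). \<Prod>i\<in>I. g i (h i))"
    by (rule prod_sum_PiE) (use fin in auto)
  also have "\<dots> = (\<Sum>f\<in>configs (\<Union>i\<in>I. C i). \<Prod>i\<in>I. g i (restrict f (C i)))"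
  proof (rule sum.reindex_bij_witness[symmetric,
      where i = "\<lambda>h. \<lambda>x\<in>(\<Union>i\<in>I. C i). h (own x) x" and j = "\<lambda>f. \<lambda>i\<in>I. restrict f (C i)"])
    fix f assume f: "f \<in> configs (\<Union>i\<in>I. C i)"
    show "(\<lambda>x\<in>(\<Union>i\<in>I. C i). (\<lambda>i\<in>I. restrict f (C i)) (own x) x) = f"
    proof
      fix x show "(\<lambda>x\<in>(\<Union>i\<in>I. C i). (\<lambda>i\<in>I. restrict f (C i)) (own x) x) x = f x"
        using f own[of _ x] by (cases "x \<in> (\<Union>i\<in>I. C i)") (auto simp: configs_def)
    qed
    show "(\<lambda>i\<in>I. restrict f (C i)) \<in> PiE I (\<lambda>i. configs (C i))"
      using configs_restrict[OF f] by auto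
    show "(\<Prod>i\<in>I. g i ((\<lambda>i\<in>I. restrict f (C i)) i)) = (\<Prod>i\<in>I. g i (restrict f (C i)))"
      by simp
  next
    fix h assume h: "h \<in> PiE I (\<lambda>i. configs (C i))"
    have hi: "h i \<in> configs (C i)" if "i \<in> I" for i using h that by auto
    show "(\<lambda>i\<in>I. restrict (\<lambda>x\<in>(\<Union>i\<in>I. C i). h (own x) x) (C i)) = h"
    proof
      fix i
      show "(\<lambda>i\<in>I. restrict (\<lambda>x\<in>(\<Union>i\<in>I. C i). h (own x) x) (C i)) i = h i"
      proof (cases "i \<in> I")
        case True
        have "restrict (\<lambda>x\<in>(\<Union>i\<in>I. C i). h (own x) x) (C i) x = h i x" for x
          using True own[OF True, of x] hi[OF True] by (cases "x \<in> C i") (auto simp: configs_def)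
        then show ?thesis using True by auto
      qed (use h in auto)
    qed
    show "(\<lambda>x\<in>(\<Union>i\<in>I. C i). h (own x) x) \<in> configs (\<Union>i\<in>I. C i)"
      unfolding configs_def
    proof (rule restrict_PiE_iff[THEN iffD2], rule ballI)
      fix x assume "x \<in> (\<Union>i\<in>I. C i)"
      then obtain i where i: "i \<in> I" "x \<in> C i" by auto
      then show "h (own x) x \<in> {0, 1}"
        using configs_range[OF hi[OF i(1)] i(2)] own[OF i] by simp
    qed
  qed
  finally show ?thesis by simp
qed

text \<open>The site weights in layer \<open>m\<close> read layer \<open>m + 1\<close>, which lies
  outside the ball. A message on the edge to the parent stands for that factor and for everything
  below it.\<close>

definition tree_weight ::
    "nat \<Rightarrow> real \<Rightarrow> (nat \<Rightarrow> real) \<Rightarrow> nat \<Rightarrow> (nat list \<Rightarrow> nat \<Rightarrow> nat \<Rightarrow> real) \<Rightarrow> (nat list \<Rightarrow> nat) \<Rightarrow> real" where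
  "tree_weight D lam \<theta> m msg \<omega> =
     (\<Prod>v\<in>{v \<in> tree D. length v < m}. site_weight D lam \<theta> \<omega> v) *
     (\<Prod>v\<in>layer D m. msg v (\<omega> (tl v)) (\<omega> v))"

text \<open>The sum-product update of belief propagation.\<close>

definition pass_up ::
    "nat \<Rightarrow> real \<Rightarrow> (nat \<Rightarrow> real) \<Rightarrow> (nat list \<Rightarrow> nat \<Rightarrow> nat \<Rightarrow> real) \<Rightarrow> nat list \<Rightarrow> nat \<Rightarrow> nat \<Rightarrow> real" where
  "pass_up D lam \<theta> msg v p s =
     (\<Sum>f\<in>configs (children D v). vertex_weight lam \<theta> p s (\<Sum>c\<in>children D v. f c) *
        (\<Prod>c\<in>children D v. msg c s (f c)))"

lemma site_weight_cong:
  assumes "v \<in> tree D" "\<And>j. j \<in> nbhd D v \<Longrightarrow> \<omega> j = \<omega>' j"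
  shows "site_weight D lam \<theta> \<omega> v = site_weight D lam \<theta> \<omega>' v"
proof -
  have "(\<Sum>c\<in>children D v. \<omega> c) = (\<Sum>c\<in>children D v. \<omega>' c)"
    using assms by (intro sum.cong refl assms(2)) (auto simp: nbhd_eq[OF assms(1)])
  then show ?thesis using assms by (auto simp: site_weight_def nbhd_eq)
qed

lemma finite_tree_less [simp]: "finite {v \<in> tree D. length v < m}"
  by (rule finite_subset[OF _ finite_ball_tree[of D m]]) (auto simp: ball_tree_def)

lemma nbhd_length:
  assumes "v \<in> tree D" "j \<in> nbhd D v"
  shows "j \<in> tree D" "length j \<le> Suc (length v)"
  using assms nbhd_subset_tree[OF assms(1)] by (auto simp: nbhd_def tree_adj_def)

text \<open>With the inner ball frozen at \<omega>, the outer layer splits into the disjoint child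
  sets of the vertices of layer \<open>m\<close>, so the sum factorises. \<open>m \<ge> 1\<close>
  keeps the root out of layer \<open>m\<close>, since a message refers to a parent.\<close>

lemma sum_tree_weight_Suc:
  assumes m: "m \<ge> 1" and \<omega>: "\<omega> \<in> configs (ball_tree D m)"
  shows "(\<Sum>\<nu>\<in>{\<nu> \<in> configs (ball_tree D (Suc m)). restrict \<nu> (ball_tree D m) = \<omega>}.
      tree_weight D lam \<theta> (Suc m) msg \<nu>) = tree_weight D lam \<theta> m (pass_up D lam \<theta> msg) \<omega>"
proof -
  define ext where "ext f = (\<lambda>v\<in>ball_tree D (Suc m). if length v = Suc m then f v else \<omega> v)" for f :: "nat list \<Rightarrow> nat"
  define g where "g v f = vertex_weight lam \<theta> (\<omega> (tl v)) (\<omega> v) (\<Sum>c\<in>children D v. f c) *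
        (\<Prod>c\<in>children D v. msg c (\<omega> v) (f c))" for v f
  let ?A = "\<Prod>v\<in>{v \<in> tree D. length v < m}. site_weight D lam \<theta> \<omega> v"
  have ext_ball: "ext f v = \<omega> v" if "v \<in> tree D" "length v \<le> m" for f v
    using that by (auto simp: ext_def ball_tree_def)
  have ext_layer: "ext f v = f v" if "v \<in> layer D (Suc m)" for f v
    using that by (auto simp: ext_def ball_tree_def layer_def)
  have child_layer: "c \<in> layer D (Suc m)" "c \<in> tree D" "tl c = v"
    if "v \<in> layer D m" "c \<in> children D v" for v c
    using that layer_Suc[of D m] by (auto simp: mem_children_iff layer_def)
  have "(\<Sum>\<nu>\<in>{\<nu> \<in> configs (ball_tree D (Suc m)). restrict \<nu> (ball_tree D m) = \<omega>}.
      tree_weight D lam \<theta> (Suc m) msg \<nu>) = (\<Sum>f\<in>configs (layer D (Suc m)). tree_weight D lam \<theta> (Suc m) msg (ext f))"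
  proof (rule sum.reindex_bij_witness[where i = ext and j = "\<lambda>\<nu>. restrict \<nu> (layer D (Suc m))"])
    fix \<nu> assume \<nu>: "\<nu> \<in> {\<nu> \<in> configs (ball_tree D (Suc m)). restrict \<nu> (ball_tree D m) = \<omega>}"
    show eq: "ext (restrict \<nu> (layer D (Suc m))) = \<nu>"
    proof
      fix v
      consider "v \<in> layer D (Suc m)" | "v \<in> ball_tree D m" | "v \<notin> ball_tree D (Suc m)"
        by (auto simp: ball_tree_Suc)
      then show "ext (restrict \<nu> (layer D (Suc m))) v = \<nu> v"
      proof cases
        case 2
        then have "restrict \<nu> (ball_tree D m) v = \<nu> v" by simp
        then show ?thesis using 2 \<nu> by (auto simp: ext_ball ball_tree_def)
      next
        case 3
        then show ?thesis using \<nu> by (auto simp: ext_def configs_def)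
      qed (simp add: ext_layer)
    qed
    show "restrict \<nu> (layer D (Suc m)) \<in> configs (layer D (Suc m))"
      using \<nu> by (auto intro!: configs_restrict[where S = "ball_tree D (Suc m)"] simp: ball_tree_Suc)
    show "tree_weight D lam \<theta> (Suc m) msg (ext (restrict \<nu> (layer D (Suc m)))) = tree_weight D lam \<theta> (Suc m) msg \<nu>"
      by (simp only: eq)
  next
    fix f assume f: "f \<in> configs (layer D (Suc m))"
    show "restrict (ext f) (layer D (Suc m)) = f"
      using f by (auto simp: ext_layer configs_def fun_eq_iff restrict_def)
    have "ext f \<in> configs (ball_tree D (Suc m))"
      unfolding configs_def ext_def
    proof (rule restrict_PiE_iff[THEN iffD2], rule ballI)
      fix v assume v: "v \<in> ball_tree D (Suc m)"
      show "(if length v = Suc m then f v else \<omega> v) \<in> {0, 1}"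
      proof (cases "length v = Suc m")
        case True
        then have "v \<in> layer D (Suc m)" using v by (auto simp: layer_def ball_tree_def)
        from configs_range[OF f this] True show ?thesis by simp
      next
        case False
        then have "v \<in> ball_tree D m" using v by (auto simp: ball_tree_def)
        from configs_range[OF \<omega> this] False show ?thesis by simp
      qed
    qed
    moreover have "restrict (ext f) (ball_tree D m) = \<omega>"
    proof
      fix v show "restrict (ext f) (ball_tree D m) v = \<omega> v"
        using \<omega> ext_ball[of v f] by (cases "v \<in> ball_tree D m") (auto simp: configs_def ball_tree_def)
    qed
    ultimately show "ext f \<in> {\<nu> \<in> configs (ball_tree D (Suc m)). restrict \<nu> (ball_tree D m) = \<omega>}"
      by simp
  qed
  also have "\<dots> = (\<Sum>f\<in>configs (layer D (Suc m)). ?A * (\<Prod>v\<in>layer D m. g v (restrict f (children D v))))"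
  proof (rule sum.cong[OF refl])
    fix f assume "f \<in> configs (layer D (Suc m))"
    have split: "{v \<in> tree D. length v < Suc m} = {v \<in> tree D. length v < m} \<union> layer D m"
      by (auto simp: layer_def)
    have disj: "{v \<in> tree D. length v < m} \<inter> layer D m = {}" by (auto simp: layer_def)
    have 1: "(\<Prod>v\<in>{v \<in> tree D. length v < m}. site_weight D lam \<theta> (ext f) v) = ?A"
    proof (rule prod.cong[OF refl])
      fix v assume v: "v \<in> {v \<in> tree D. length v < m}"
      show "site_weight D lam \<theta> (ext f) v = site_weight D lam \<theta> \<omega> v"
      proof (rule site_weight_cong)
        fix j assume "j \<in> nbhd D v"
        with v nbhd_length[of v D j] show "ext f j = \<omega> j" by (intro ext_ball) auto
      qed (use v in auto)
    qed
    have 2: "site_weight D lam \<theta> (ext f) v =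
        vertex_weight lam \<theta> (\<omega> (tl v)) (\<omega> v) (\<Sum>c\<in>children D v. restrict f (children D v) c)" if v: "v \<in> layer D m" for v
    proof -
      have "v \<noteq> []" "v \<in> tree D" "length v \<le> m" "length (tl v) \<le> m" "tl v \<in> tree D"
        using v m tl_mem_tree by (auto simp: layer_def)
      then show ?thesis
        using child_layer(1)[OF v] by (simp add: site_weight_def ext_ball ext_layer)
    qed
    have 3: "(\<Prod>v\<in>layer D (Suc m). msg v (ext f (tl v)) (ext f v)) =
        (\<Prod>v\<in>layer D m. \<Prod>c\<in>children D v. msg c (\<omega> v) (restrict f (children D v) c))"
    proof -
      have "(\<Prod>v\<in>layer D (Suc m). msg v (ext f (tl v)) (ext f v)) =
          (\<Prod>v\<in>layer D m. \<Prod>c\<in>children D v. msg c (ext f (tl c)) (ext f c))"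
        unfolding layer_Suc
        by (rule prod.UNION_disjoint) (use child_layer(3) in auto)
      also have "\<dots> = (\<Prod>v\<in>layer D m. \<Prod>c\<in>children D v. msg c (\<omega> v) (restrict f (children D v) c))"
      proof (intro prod.cong refl)
        fix v c assume v: "v \<in> layer D m" and c: "c \<in> children D v"
        have "ext f v = \<omega> v" using v by (intro ext_ball) (auto simp: layer_def)
        then show "msg c (ext f (tl c)) (ext f c) = msg c (\<omega> v) (restrict f (children D v) c)"
          using child_layer[OF v c] c by (simp add: ext_layer)
      qed
      finally show ?thesis .
    qed
    have "tree_weight D lam \<theta> (Suc m) msg (ext f) =
        (\<Prod>v\<in>{v \<in> tree D. length v < m}. site_weight D lam \<theta> (ext f) v) *
        (\<Prod>v\<in>layer D m. site_weight D lam \<theta> (ext f) v) *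
        (\<Prod>v\<in>layer D (Suc m). msg v (ext f (tl v)) (ext f v))"
      unfolding tree_weight_def split
      using disj by (subst prod.union_disjoint) simp_all
    also have "\<dots> = ?A * (\<Prod>v\<in>layer D m. g v (restrict f (children D v)))"
      unfolding 1 3 g_def prod.distrib mult.assoc by (simp add: 2 cong: prod.cong)
    finally show "tree_weight D lam \<theta> (Suc m) msg (ext f) = ?A * (\<Prod>v\<in>layer D m. g v (restrict f (children D v)))" .
  qed
  also have "\<dots> = ?A * (\<Prod>v\<in>layer D m. \<Sum>f\<in>configs (children D v). g v f)"
    unfolding sum_distrib_left[symmetric] layer_Suc
    by (subst sum_configs_UN_prod[where own = tl]) (use child_layer(3) in auto)
  also have "\<dots> = tree_weight D lam \<theta> m (pass_up D lam \<theta> msg) \<omega>"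
    by (simp add: tree_weight_def pass_up_def g_def)
  finally show ?thesis .
qed

lemma sum_tree_weight:
  assumes m: "m \<ge> 1" and \<omega>: "\<omega> \<in> configs (ball_tree D m)"
  shows "(\<Sum>\<nu>\<in>{\<nu> \<in> configs (ball_tree D (m + k)). restrict \<nu> (ball_tree D m) = \<omega>}.
      tree_weight D lam \<theta> (m + k) msg \<nu>) = tree_weight D lam \<theta> m ((pass_up D lam \<theta> ^^ k) msg) \<omega>"
proof (induction k arbitrary: msg)
  case 0
  have "{\<nu> \<in> configs (ball_tree D m). restrict \<nu> (ball_tree D m) = \<omega>} = {\<omega>}"
    using \<omega> by (auto simp: configs_def PiE_restrict)
  then show ?case by (simp del: restrict_apply)
next
  case (Suc k)
  let ?S = "{\<nu> \<in> configs (ball_tree D (m + Suc k)). restrict \<nu> (ball_tree D m) = \<omega>}"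
  let ?T = "{\<nu> \<in> configs (ball_tree D (m + k)). restrict \<nu> (ball_tree D m) = \<omega>}"
  have sub: "ball_tree D m \<subseteq> ball_tree D (m + k)" "ball_tree D (m + k) \<subseteq> ball_tree D (m + Suc k)"
    by (auto simp: ball_tree_def)
  have rr: "restrict (restrict \<nu> (ball_tree D (m + k))) (ball_tree D m) = restrict \<nu> (ball_tree D m)" for \<nu> :: "nat list \<Rightarrow> nat"
    using sub by (simp add: Int_absorb1 Int_absorb2)
  have "(\<Sum>\<nu>\<in>?S. tree_weight D lam \<theta> (m + Suc k) msg \<nu>) =
      (\<Sum>\<nu>'\<in>?T. \<Sum>\<nu>\<in>{\<nu> \<in> ?S. restrict \<nu> (ball_tree D (m + k)) = \<nu>'}. tree_weight D lam \<theta> (m + Suc k) msg \<nu>)"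
    by (rule sum.group[symmetric])
      (use sub configs_restrict in \<open>auto simp: rr simp del: restrict_restrict intro!: finite_Collect_conjI\<close>)
  also have "\<dots> = (\<Sum>\<nu>'\<in>?T. tree_weight D lam \<theta> (m + k) (pass_up D lam \<theta> msg) \<nu>')"
  proof (rule sum.cong[OF refl])
    fix \<nu>' assume \<nu>': "\<nu>' \<in> ?T"
    have "{\<nu> \<in> ?S. restrict \<nu> (ball_tree D (m + k)) = \<nu>'} =
        {\<nu> \<in> configs (ball_tree D (Suc (m + k))). restrict \<nu> (ball_tree D (m + k)) = \<nu>'}"
      using \<nu>' rr by auto
    then show "(\<Sum>\<nu>\<in>{\<nu> \<in> ?S. restrict \<nu> (ball_tree D (m + k)) = \<nu>'}. tree_weight D lam \<theta> (m + Suc k) msg \<nu>) =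
        tree_weight D lam \<theta> (m + k) (pass_up D lam \<theta> msg) \<nu>'"
      using sum_tree_weight_Suc[of "m + k" \<nu>' D lam \<theta> msg] \<nu>' m by simp
  qed
  also have "\<dots> = tree_weight D lam \<theta> m ((pass_up D lam \<theta> ^^ k) (pass_up D lam \<theta> msg)) \<omega>"
    by (rule Suc.IH)
  finally show ?case by (simp add: funpow_swap1 del: restrict_apply)
qed

text \<open>Exclusion kills the entry for two occupied ends, so a message has three free entries.
  Splitting off the scale \<open>z\<close>, which cancels in every probability, leaves two
  parameters.\<close>

definition edge_msg :: "real \<Rightarrow> real \<Rightarrow> real \<Rightarrow> nat \<Rightarrow> nat \<Rightarrow> real" where
  "edge_msg z x y p s = z * (if p = 0 then (if s = 0 then 1 else x) else (if s = 0 then y else 0))"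

text \<open>Multi-affine version of the offspring polynomial, with one variable per child: a
  boundary condition may give siblings different odds.\<close>

definition site_poly :: "(nat \<Rightarrow> real) \<Rightarrow> nat list set \<Rightarrow> (nat list \<Rightarrow> real) \<Rightarrow> real" where
  "site_poly \<theta> C x = (\<Sum>f\<in>configs C. \<theta> (\<Sum>c\<in>C. f c) * (\<Prod>c\<in>C. if f c = 0 then 1 else x c))"

lemma site_poly_empty [simp]: "site_poly \<theta> {} x = \<theta> 0"
  by (simp add: site_poly_def configs_def)

text \<open>Split according to the spin at \<open>a\<close>: an occupied \<open>a\<close> shifts the
  index of \<theta> by one. The polynomial is thus affine in every single variable.\<close>

lemma site_poly_insert:
  assumes "finite C" "a \<notin> C"
  shows "site_poly \<theta> (insert a C) x = site_poly \<theta> C x + x a * site_poly (\<lambda>k. \<theta> (Suc k)) C x"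
proof -
  let ?F = "\<lambda>f. \<theta> (\<Sum>c\<in>insert a C. f c) * (\<Prod>c\<in>insert a C. if f c = 0 then 1 else x c)"
  have F: "?F (f(a := s)) = (if s = 0 then 1 else x a) *
      (\<theta> (s + (\<Sum>c\<in>C. f c)) * (\<Prod>c\<in>C. if f c = 0 then 1 else x c))" for f s
  proof -
    have "(\<Sum>c\<in>C. (f(a := s)) c) = (\<Sum>c\<in>C. f c)"
      by (rule sum.cong) (use assms(2) in auto)
    moreover have "(\<Prod>c\<in>C. if (f(a := s)) c = 0 then 1 else x c) = (\<Prod>c\<in>C. if f c = 0 then 1 else x c)"
      by (rule prod.cong) (use assms(2) in auto)
    ultimately show ?thesis using assms by (simp del: fun_upd_apply add: fun_upd_same)
  qed
  have inj: "inj_on (\<lambda>(s, f). f(a := s)) ({0, 1} \<times> configs C)"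
    unfolding configs_def using assms(2) by (rule inj_combinator)
  have "configs (insert a C) = (\<lambda>(s, f). f(a := s)) ` ({0, 1} \<times> configs C)"
    unfolding configs_def by (rule PiE_insert_eq)
  then have "site_poly \<theta> (insert a C) x = (\<Sum>(s, f)\<in>{0, 1} \<times> configs C. ?F (f(a := s)))"
    unfolding site_poly_def using sum.reindex[OF inj, of ?F] by (simp only: o_def case_prod_unfold)
  also have "\<dots> = (\<Sum>s\<in>{0, 1}. \<Sum>f\<in>configs C. ?F (f(a := s)))"
    using assms by (simp add: sum.cartesian_product)
  also have "\<dots> = (\<Sum>s\<in>{0, 1}. \<Sum>f\<in>configs C. (if s = 0 then 1 else x a) *
      (\<theta> (s + (\<Sum>c\<in>C. f c)) * (\<Prod>c\<in>C. if f c = 0 then 1 else x c)))"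
    by (simp only: F)
  finally show ?thesis by (simp add: site_poly_def sum_distrib_left)
qed

text \<open>Induction on \<open>C\<close>; the insertion rule becomes Pascal's rule for the
  coefficients.\<close>

lemma site_poly_const:
  assumes "finite C"
  shows "site_poly \<theta> C (\<lambda>_. x) = (\<Sum>k\<le>card C. real (card C choose k) * \<theta> k * x ^ k)"
  using assms
proof (induction C arbitrary: \<theta> rule: finite_induct)
  case (insert a C)
  let ?n = "card C"
  have "(\<Sum>k\<le>Suc ?n. real (Suc ?n choose k) * \<theta> k * x ^ k) =
      \<theta> 0 + (\<Sum>k\<le>?n. real (Suc ?n choose Suc k) * \<theta> (Suc k) * x ^ Suc k)"
    by (subst sum.atMost_Suc_shift) simp
  also have "\<dots> = \<theta> 0 + (\<Sum>k\<le>?n. real (?n choose Suc k) * \<theta> (Suc k) * x ^ Suc k) +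
      (\<Sum>k\<le>?n. real (?n choose k) * \<theta> (Suc k) * x ^ Suc k)"
    by (simp add: algebra_simps sum.distrib)
  also have "\<theta> 0 + (\<Sum>k\<le>?n. real (?n choose Suc k) * \<theta> (Suc k) * x ^ Suc k) =
      (\<Sum>k\<le>Suc ?n. real (?n choose k) * \<theta> k * x ^ k)"
    by (subst sum.atMost_Suc_shift) simp
  also have "\<dots> = (\<Sum>k\<le>?n. real (?n choose k) * \<theta> k * x ^ k)"
    by simp
  also have "(\<Sum>k\<le>?n. real (?n choose k) * \<theta> (Suc k) * x ^ Suc k) =
      x * (\<Sum>k\<le>?n. real (?n choose k) * \<theta> (Suc k) * x ^ k)"
    by (simp add: sum_distrib_left algebra_simps)
  finally show ?case using insert by (simp add: site_poly_insert)
qed simp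

lemma site_poly_pos:
  assumes "finite C" "\<And>k. k \<le> card C \<Longrightarrow> \<theta> k > 0" "\<And>c. c \<in> C \<Longrightarrow> x c \<ge> 0"
  shows "site_poly \<theta> C x > 0"
  using assms
proof (induction C arbitrary: \<theta> rule: finite_induct)
  case (insert a C)
  have "site_poly \<theta> C x > 0" "site_poly (\<lambda>k. \<theta> (Suc k)) C x > 0"
    using insert by (auto intro!: insert.IH)
  moreover have "x a \<ge> 0" using insert by auto
  ultimately show ?case using insert.hyps by (simp add: site_poly_insert add_pos_nonneg)
qed simp

text \<open>The two-parameter form reproduces itself. An empty vertex lets its children choose
  freely, giving \<open>site_poly\<close> with index shifted by the parent's spin. An occupied
  vertex with an empty parent admits only empty children, giving \<open>lam\<close> times the
  product of the \<open>y c\<close>.\<close>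

lemma pass_up_edge_msg:
  assumes msg: "\<And>c p s. c \<in> children D v \<Longrightarrow> p \<le> 1 \<Longrightarrow> s \<le> 1 \<Longrightarrow> msg c p s = edge_msg (z c) (x c) (y c) p s"
    and E: "site_poly \<theta> (children D v) x > 0"
    and ps: "p \<le> 1" "s \<le> 1"
  shows "pass_up D lam \<theta> msg v p s =
    edge_msg ((\<Prod>c\<in>children D v. z c) * site_poly \<theta> (children D v) x)
      (lam * (\<Prod>c\<in>children D v. y c) / site_poly \<theta> (children D v) x)
      (site_poly (\<lambda>k. \<theta> (Suc k)) (children D v) x / site_poly \<theta> (children D v) x) p s"
proof -
  let ?C = "children D v"
  have f1: "f c \<le> 1" if "f \<in> configs ?C" "c \<in> ?C" for f c
    using configs_range[OF that] by auto
  show ?thesis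
  proof (cases "s = 0")
    case True
    have "pass_up D lam \<theta> msg v p s =
        (\<Sum>f\<in>configs ?C. \<theta> (p + (\<Sum>c\<in>?C. f c)) * ((\<Prod>c\<in>?C. z c) * (\<Prod>c\<in>?C. if f c = 0 then 1 else x c)))"
      unfolding pass_up_def prod.distrib[symmetric]
      using True f1 msg[of _ 0] by (auto intro!: sum.cong prod.cong simp: vertex_weight_def edge_msg_def)
    also have "\<dots> = (\<Prod>c\<in>?C. z c) * site_poly (\<lambda>k. \<theta> (p + k)) ?C x"
      by (simp add: site_poly_def sum_distrib_left mult_ac)
    finally show ?thesis
      using E True ps by (cases "p = 0") (auto simp: edge_msg_def le_Suc_eq)
  next
    case False
    then have s: "s = 1" using ps by simp
    have *: "(\<Sum>c\<in>?C. f c) = 0 \<longleftrightarrow> f = (\<lambda>c\<in>?C. 0)" if "f \<in> configs ?C" for f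
      using that by (auto simp: configs_def fun_eq_iff)
    have z0: "(\<lambda>c\<in>?C. 0) \<in> configs ?C" by (auto simp: configs_def)
    have "pass_up D lam \<theta> msg v p s =
        (\<Sum>f\<in>configs ?C. if f = (\<lambda>c\<in>?C. 0) then (if p = 0 then lam else 0) * (\<Prod>c\<in>?C. msg c s 0) else 0)"
      unfolding pass_up_def
      by (rule sum.cong) (use s * in \<open>auto simp: vertex_weight_def intro!: prod.cong\<close>)
    also have "\<dots> = (if p = 0 then lam else 0) * (\<Prod>c\<in>?C. msg c s 0)"
      using z0 by simp
    also have "(\<Prod>c\<in>?C. msg c s 0) = (\<Prod>c\<in>?C. z c) * (\<Prod>c\<in>?C. y c)"
      unfolding prod.distrib[symmetric] using s msg by (auto intro!: prod.cong simp: edge_msg_def)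
    finally show ?thesis using E s by (auto simp: edge_msg_def)
  qed
qed

section \<open>Extension of consistent marginals\<close>

lemma pmf_map_finite:
  assumes "set_pmf p \<subseteq> S" "finite S"
  shows "pmf (map_pmf f p) y = (\<Sum>x\<in>{x \<in> S. f x = y}. pmf p x)"
proof -
  have "pmf (map_pmf f p) y = measure (measure_pmf p) (f -` {y})"
    by (simp add: pmf_map)
  also have "\<dots> = measure (measure_pmf p) (f -` {y} \<inter> set_pmf p)"
    by (simp add: measure_Int_set_pmf)
  also have "f -` {y} \<inter> set_pmf p = {x \<in> S. f x = y} \<inter> set_pmf p"
    using assms(1) by auto
  also have "measure (measure_pmf p) \<dots> = measure (measure_pmf p) {x \<in> S. f x = y}"
    by (simp add: measure_Int_set_pmf)
  also have "\<dots> = (\<Sum>x\<in>{x \<in> S. f x = y}. pmf p x)"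
    using assms(2) by (simp add: measure_measure_pmf_finite)
  finally show ?thesis .
qed

lemma pmf_of_finite_weights:
  assumes "finite S" "\<And>x. x \<in> S \<Longrightarrow> Q x \<ge> 0" "(\<Sum>x\<in>S. Q x) = 1"
  obtains p where "set_pmf p \<subseteq> S" "\<And>x. x \<in> S \<Longrightarrow> pmf p x = Q x"
proof -
  define f where "f x = (if x \<in> S then Q x else 0)" for x
  have f0: "f x \<ge> 0" for x using assms(2) by (auto simp: f_def)
  have "(\<integral>\<^sup>+x. ennreal (f x) \<partial>count_space UNIV) = (\<Sum>x\<in>S. ennreal (f x))"
    using assms(1) by (intro nn_integral_count_space') (auto simp: f_def)
  also have "\<dots> = ennreal (\<Sum>x\<in>S. f x)" using f0 by (simp add: sum_ennreal)
  also have "\<dots> = 1" using assms(3) by (simp add: f_def)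
  finally have 1: "(\<integral>\<^sup>+x. ennreal (f x) \<partial>count_space UNIV) = 1" .
  have pmf: "pmf (embed_pmf f) x = f x" for x
    using f0 1 by (rule pmf_embed_pmf)
  have "set_pmf (embed_pmf f) \<subseteq> S"
    by (auto simp: set_pmf_iff pmf f_def split: if_splits)
  moreover have "pmf (embed_pmf f) x = Q x" if "x \<in> S" for x
    using that by (simp add: pmf f_def)
  ultimately show ?thesis using that by blast
qed

text \<open>Kolmogorov extension. The extension theorem is applied to real-valued coordinates, so
  spins are embedded into the reals by \<open>enc\<close> and the resulting measure is pushed back
  by \<open>dec\<close>.\<close>

lemma tree_measure_of_pmfs:
  fixes q :: "nat \<Rightarrow> (nat list \<Rightarrow> nat) pmf"
  assumes supp: "\<And>n. n \<ge> 1 \<Longrightarrow> set_pmf (q n) \<subseteq> configs (ball_tree D n)"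
    and cons: "\<And>n. n \<ge> 1 \<Longrightarrow> map_pmf (\<lambda>\<omega>. restrict \<omega> (ball_tree D n)) (q (Suc n)) = q n"
  obtains M where "prob_space M" "sets M = sets (PiM (tree D) (\<lambda>_. count_space {0, 1}))"
    "\<And>n \<omega>. n \<ge> 1 \<Longrightarrow> \<omega> \<in> configs (ball_tree D n) \<Longrightarrow>
       measure M {x \<in> space M. restrict x (ball_tree D n) = \<omega>} = pmf (q n) \<omega>"
proof -
  have cons_le: "map_pmf (\<lambda>\<omega>. restrict \<omega> (ball_tree D n)) (q m) = q n" if "1 \<le> n" "n \<le> m" for n m
    using that(2)
  proof (induction m rule: dec_induct)
    case base
    have "restrict \<omega> (ball_tree D n) = \<omega>" if "\<omega> \<in> set_pmf (q n)" for \<omega>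
      using supp[OF \<open>1 \<le> n\<close>] that by (auto simp: configs_def PiE_restrict)
    then have "map_pmf (\<lambda>\<omega>. restrict \<omega> (ball_tree D n)) (q n) = map_pmf (\<lambda>\<omega>. \<omega>) (q n)"
      by (intro map_pmf_cong) auto
    then show ?case by (simp del: restrict_apply)
  next
    case (step m)
    have "ball_tree D n \<inter> ball_tree D m = ball_tree D n" using step by (auto simp: ball_tree_def)
    then have "(\<lambda>\<omega>::nat list \<Rightarrow> nat. restrict \<omega> (ball_tree D n)) = (\<lambda>\<omega>. restrict \<omega> (ball_tree D n)) \<circ> (\<lambda>\<omega>. restrict \<omega> (ball_tree D m))"
      by (auto simp: fun_eq_iff)
    then have "map_pmf (\<lambda>\<omega>. restrict \<omega> (ball_tree D n)) (q (Suc m)) =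
        map_pmf (\<lambda>\<omega>. restrict \<omega> (ball_tree D n)) (map_pmf (\<lambda>\<omega>. restrict \<omega> (ball_tree D m)) (q (Suc m)))"
      by (simp only: pmf.map_comp)
    also have "\<dots> = q n" using step.IH step.hyps that(1) cons[of m] by (simp del: restrict_apply)
    finally show ?case .
  qed
  define enc where "enc J \<omega> = (\<lambda>v\<in>J. real (\<omega> v))" for J :: "nat list set" and \<omega> :: "nat list \<Rightarrow> nat"
  \<comment> \<open>The radius of some ball containing \<open>J\<close>. \<open>Suc\<close> keeps it
    at least 1, where the hypotheses on \<open>q\<close> begin.\<close>
  define lev where "lev J = Suc (\<Sum>v\<in>J. length v)" for J :: "nat list set"
  define P where "P J = distr (measure_pmf (q (lev J))) (PiM J (\<lambda>_. borel :: real measure)) (enc J)" for J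
  have lev_ball: "J \<subseteq> ball_tree D (lev J)" if "finite J" "J \<subseteq> tree D" for J
  proof
    fix v assume v: "v \<in> J"
    have "length v \<le> (\<Sum>v\<in>J. length v)" using v that(1) by (intro member_le_sum) auto
    then show "v \<in> ball_tree D (lev J)" using v that(2) by (auto simp: lev_def ball_tree_def)
  qed
  have enc_meas: "enc J \<in> measurable (count_space UNIV) (PiM J (\<lambda>_. borel))" for J
    by (auto simp: space_PiM enc_def)
  have enc_meas': "enc J \<in> measurable (measure_pmf p) (PiM J (\<lambda>_. borel))" for J p
    using enc_meas by simp
  have distr_mono: "distr (measure_pmf (q n)) (PiM J (\<lambda>_. borel)) (enc J) = distr (measure_pmf (q m)) (PiM J (\<lambda>_. borel)) (enc J)"
    if "1 \<le> n" "n \<le> m" "J \<subseteq> ball_tree D n" for n m J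
  proof -
    have "measure_pmf (q n) = distr (measure_pmf (q m)) (count_space UNIV) (\<lambda>\<omega>. restrict \<omega> (ball_tree D n))"
      using cons_le[OF that(1,2)] map_pmf_rep_eq by metis
    then have "distr (measure_pmf (q n)) (PiM J (\<lambda>_. borel)) (enc J) =
        distr (distr (measure_pmf (q m)) (count_space UNIV) (\<lambda>\<omega>. restrict \<omega> (ball_tree D n))) (PiM J (\<lambda>_. borel)) (enc J)"
      by simp
    also have "\<dots> = distr (measure_pmf (q m)) (PiM J (\<lambda>_. borel)) (enc J \<circ> (\<lambda>\<omega>. restrict \<omega> (ball_tree D n)))"
      by (rule distr_distr[OF enc_meas]) simp
    also have "enc J \<circ> (\<lambda>\<omega>. restrict \<omega> (ball_tree D n)) = enc J"
      using that(3) by (auto simp: enc_def fun_eq_iff)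
    finally show ?thesis .
  qed
  have P_eq: "P J = distr (measure_pmf (q n)) (PiM J (\<lambda>_. borel)) (enc J)"
    if "1 \<le> n" "J \<subseteq> ball_tree D n" "finite J" for n J
  proof -
    have l: "J \<subseteq> ball_tree D (lev J)" "1 \<le> lev J"
      using that lev_ball[of J] ball_tree_subset[of D n] by (auto simp: lev_def)
    show ?thesis
      using distr_mono[of n "max n (lev J)" J] distr_mono[of "lev J" "max n (lev J)" J] that l
      by (simp add: P_def)
  qed
  have family: "projective_family (tree D) P (\<lambda>_. borel)"
  proof (rule projective_family.intro)
    fix J H assume JH: "J \<subseteq> H" "finite H" "H \<subseteq> tree D"
    then have fJ: "finite J" by (auto intro: finite_subset)
    let ?n = "lev H"
    have n: "1 \<le> ?n" "H \<subseteq> ball_tree D ?n" using lev_ball JH by (auto simp: lev_def)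
    have "distr (P H) (PiM J (\<lambda>_. borel)) (\<lambda>f. restrict f J) =
        distr (measure_pmf (q ?n)) (PiM J (\<lambda>_. borel)) ((\<lambda>f. restrict f J) \<circ> enc H)"
      unfolding P_eq[OF n \<open>finite H\<close>]
      by (rule distr_distr) (use JH enc_meas' in \<open>auto intro: measurable_restrict_subset\<close>)
    also have "(\<lambda>f. restrict f J) \<circ> enc H = enc J"
      using JH by (auto simp: enc_def fun_eq_iff)
    also have "distr (measure_pmf (q ?n)) (PiM J (\<lambda>_. borel)) (enc J) = P J"
      using P_eq[of ?n J] n JH fJ by auto
    finally show "P J = distr (P H) (PiM J (\<lambda>_. borel)) (\<lambda>f. restrict f J)" ..
  next
    fix J assume "finite J" "J \<subseteq> tree D"
    show "prob_space (P J)"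
      unfolding P_def by (intro measure_pmf.prob_space_distr enc_meas')
  qed
  interpret polish_projective "tree D" P
    by (rule polish_projective.intro) (rule family)
  \<comment> \<open>Every real other than 1 decodes to 0, so \<open>dec\<close> is total and
    measurable; the finite marginals are carried by the values 0 and 1.\<close>
  define dec where "dec r = (if r = 1 then 1 else 0 :: nat)" for r :: real
  define F where "F y = (\<lambda>v\<in>tree D. dec (y v))" for y :: "nat list \<Rightarrow> real"
  let ?K = "PiM (tree D) (\<lambda>_. count_space {0, 1 :: nat})"
  have dec_meas: "dec \<in> measurable borel (count_space {0, 1})"
    unfolding dec_def by measurable
  have F_meas: "F \<in> measurable lim ?K"
    unfolding F_def
  proof (rule measurable_restrict)
    fix v assume "v \<in> tree D"
    then have "(\<lambda>y. dec (y v)) \<in> measurable (PiM (tree D) (\<lambda>_. borel)) (count_space {0, 1})"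
      by (intro measurable_compose[OF _ dec_meas] measurable_component_singleton)
    then show "(\<lambda>y. dec (y v)) \<in> measurable lim (count_space {0, 1})"
      using measurable_cong_sets[OF sets_lim refl] by blast
  qed
  define M where "M = distr lim ?K F"
  have "prob_space M" unfolding M_def by (rule P.prob_space_distr[OF F_meas])
  moreover have "sets M = sets ?K" by (simp add: M_def)
  moreover have "measure M {x \<in> space M. restrict x (ball_tree D n) = \<omega>} = pmf (q n) \<omega>"
    if n: "n \<ge> 1" and \<omega>: "\<omega> \<in> configs (ball_tree D n)" for n \<omega>
  proof -
    let ?J = "ball_tree D n"
    have J: "?J \<subseteq> tree D" "finite ?J" by (auto simp: ball_tree_subset)
    define Y where "Y = {y \<in> space (PiM ?J (\<lambda>_. borel :: real measure)). \<forall>v\<in>?J. dec (y v) = \<omega> v}"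
    have Y: "Y \<in> sets (PiM ?J (\<lambda>_. borel))"
      unfolding Y_def
    proof (rule sets.sets_Collect_finite_All'[OF _ J(2)])
      fix v assume v: "v \<in> ?J"
      have "(\<lambda>y. dec (y v)) \<in> measurable (PiM ?J (\<lambda>_. borel)) (count_space {0, 1})"
        using v by (intro measurable_compose[OF _ dec_meas] measurable_component_singleton)
      then show "{y \<in> space (PiM ?J (\<lambda>_. borel)). dec (y v) = \<omega> v} \<in> sets (PiM ?J (\<lambda>_. borel))"
        by (rule measurable_sets_Collect[where P = "\<lambda>r. r = \<omega> v"]) auto
    qed (use n in \<open>auto simp: ball_tree_def intro: tree.root\<close>)
    have res: "{x \<in> space M. restrict x ?J = \<omega>} \<in> sets ?K"
    proof -
      have "{x \<in> space ?K. \<forall>v\<in>?J. x v = \<omega> v} \<in> sets ?K"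
      proof (rule sets.sets_Collect_finite_All'[OF _ J(2)])
        fix v assume v: "v \<in> ?J"
        have "(\<lambda>x. x v) \<in> measurable ?K (count_space {0, 1})"
          using v J by (auto intro: measurable_component_singleton)
        then show "{x \<in> space ?K. x v = \<omega> v} \<in> sets ?K"
          by (rule measurable_sets_Collect[where P = "\<lambda>r. r = \<omega> v"]) auto
      qed (use n in \<open>auto simp: ball_tree_def intro: tree.root\<close>)
      moreover have "{x \<in> space M. restrict x ?J = \<omega>} = {x \<in> space ?K. \<forall>v\<in>?J. x v = \<omega> v}"
        using \<omega> by (auto simp: M_def configs_def fun_eq_iff restrict_def PiE_def extensional_def)
      ultimately show ?thesis by simp
    qed
    have "measure M {x \<in> space M. restrict x ?J = \<omega>} =
        measure lim (F -` {x \<in> space M. restrict x ?J = \<omega>} \<inter> space lim)"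
      unfolding M_def using res by (intro measure_distr F_meas) (simp add: M_def)
    also have "F -` {x \<in> space M. restrict x ?J = \<omega>} \<inter> space lim = prod_emb (tree D) (\<lambda>_. borel) ?J Y"
    proof -
      have "restrict (F y) ?J = \<omega> \<longleftrightarrow> (\<forall>v\<in>?J. dec (y v) = \<omega> v)" for y
        using \<omega> J by (auto simp: F_def configs_def fun_eq_iff restrict_def PiE_def extensional_def)
      moreover have "F y \<in> space M" if "y \<in> space lim" for y
        using that measurable_space[OF F_meas] by (simp add: M_def)
      ultimately show ?thesis
        by (auto simp: prod_emb_def Y_def space_PiM)
    qed
    also have "measure lim (prod_emb (tree D) (\<lambda>_. borel) ?J Y) = measure (P ?J) Y"
      by (rule measure_lim_emb[OF J Y])
    also have "\<dots> = measure (q n) (enc ?J -` Y \<inter> space (q n))"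
      unfolding P_eq[OF n order_refl J(2)] by (rule measure_distr[OF enc_meas' Y])
    \<comment> \<open>\<open>enc\<close> looks at the ball only and is injective just on functions
      that are configurations of the ball; hence the intersection with the support.\<close>
    also have "enc ?J -` Y \<inter> space (q n) \<inter> set_pmf (q n) = {\<omega>} \<inter> set_pmf (q n)"
    proof -
      have "enc ?J \<omega>' \<in> Y \<longleftrightarrow> \<omega>' = \<omega>" if "\<omega>' \<in> set_pmf (q n)" for \<omega>'
      proof -
        have \<omega>': "\<omega>' \<in> configs ?J" using supp[OF n] that by auto
        have "dec (enc ?J \<omega>' v) = \<omega>' v" if "v \<in> ?J" for v
          using configs_range[OF \<omega>' that] that by (auto simp: dec_def enc_def)
        moreover have "enc ?J \<omega>' \<in> space (PiM ?J (\<lambda>_. borel))"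
          by (simp add: enc_def space_PiM)
        ultimately have "enc ?J \<omega>' \<in> Y \<longleftrightarrow> (\<forall>v\<in>?J. \<omega>' v = \<omega> v)" by (auto simp: Y_def)
        also have "\<dots> \<longleftrightarrow> \<omega>' = \<omega>"
          using \<omega> \<omega>' unfolding configs_def by (auto intro: PiE_ext)
        finally show ?thesis .
      qed
      then show ?thesis by auto
    qed
    then have "measure (q n) (enc ?J -` Y \<inter> space (q n)) = measure (q n) {\<omega>}"
      by (metis measure_Int_set_pmf)
    finally show ?thesis by (simp only: pmf.rep_eq)
  qed
  ultimately show ?thesis using that by blast
qed

lemma tree_measure_exists:
  fixes Q :: "nat \<Rightarrow> (nat list \<Rightarrow> nat) \<Rightarrow> real"
  assumes nonneg: "\<And>n \<omega>. n \<ge> 1 \<Longrightarrow> \<omega> \<in> configs (ball_tree D n) \<Longrightarrow> Q n \<omega> \<ge> 0"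
    and total: "\<And>n. n \<ge> 1 \<Longrightarrow> (\<Sum>\<omega>\<in>configs (ball_tree D n). Q n \<omega>) = 1"
    and cons: "\<And>n \<omega>. n \<ge> 1 \<Longrightarrow> \<omega> \<in> configs (ball_tree D n) \<Longrightarrow>
      (\<Sum>\<nu>\<in>{\<nu> \<in> configs (ball_tree D (Suc n)). restrict \<nu> (ball_tree D n) = \<omega>}. Q (Suc n) \<nu>) = Q n \<omega>"
  obtains M where "prob_space M" "sets M = sets (PiM (tree D) (\<lambda>_. count_space {0, 1}))"
    "\<And>n \<omega>. n \<ge> 1 \<Longrightarrow> \<omega> \<in> configs (ball_tree D n) \<Longrightarrow>
       measure M {x \<in> space M. restrict x (ball_tree D n) = \<omega>} = Q n \<omega>"
proof -
  have "\<exists>p. set_pmf p \<subseteq> configs (ball_tree D n) \<and> (\<forall>\<omega>\<in>configs (ball_tree D n). pmf p \<omega> = Q n \<omega>)" if "n \<ge> 1" for n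
    by (rule pmf_of_finite_weights[of "configs (ball_tree D n)" "Q n"]) (use nonneg total that in auto)
  then obtain q where q: "\<And>n. n \<ge> 1 \<Longrightarrow> set_pmf (q n) \<subseteq> configs (ball_tree D n)"
      "\<And>n \<omega>. n \<ge> 1 \<Longrightarrow> \<omega> \<in> configs (ball_tree D n) \<Longrightarrow> pmf (q n) \<omega> = Q n \<omega>"
    by metis
  have qcons: "map_pmf (\<lambda>\<omega>. restrict \<omega> (ball_tree D n)) (q (Suc n)) = q n" if n: "n \<ge> 1" for n
  proof (rule pmf_eqI)
    fix \<omega>
    have "pmf (map_pmf (\<lambda>\<omega>. restrict \<omega> (ball_tree D n)) (q (Suc n))) \<omega> =
        (\<Sum>\<nu>\<in>{\<nu> \<in> configs (ball_tree D (Suc n)). restrict \<nu> (ball_tree D n) = \<omega>}. pmf (q (Suc n)) \<nu>)"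
      by (rule pmf_map_finite) (use q(1) in auto)
    also have "\<dots> = (\<Sum>\<nu>\<in>{\<nu> \<in> configs (ball_tree D (Suc n)). restrict \<nu> (ball_tree D n) = \<omega>}. Q (Suc n) \<nu>)"
      by (rule sum.cong) (use q(2) in auto)
    also have "\<dots> = pmf (q n) \<omega>"
    proof (cases "\<omega> \<in> configs (ball_tree D n)")
      case True
      then show ?thesis using cons n q(2) by simp
    next
      case False
      then have "{\<nu> \<in> configs (ball_tree D (Suc n)). restrict \<nu> (ball_tree D n) = \<omega>} = {}"
        using configs_restrict[of _ "ball_tree D (Suc n)" "ball_tree D n"] ball_tree_mono[of n "Suc n" D] by auto
      moreover have "pmf (q n) \<omega> = 0" using q(1)[OF n] False by (auto simp: set_pmf_iff)
      ultimately show ?thesis by (simp only: sum.empty)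
    qed
    finally show "pmf (map_pmf (\<lambda>\<omega>. restrict \<omega> (ball_tree D n)) (q (Suc n))) \<omega> = pmf (q n) \<omega>" .
  qed
  show ?thesis
  proof (rule tree_measure_of_pmfs[of q D])
    fix M assume M: "prob_space M" "sets M = sets (PiM (tree D) (\<lambda>_. count_space {0, 1}))"
      "\<And>n \<omega>. n \<ge> 1 \<Longrightarrow> \<omega> \<in> configs (ball_tree D n) \<Longrightarrow>
         measure M {x \<in> space M. restrict x (ball_tree D n) = \<omega>} = pmf (q n) \<omega>"
    show thesis
    proof (rule that[OF M(1,2)])
      fix n \<omega> assume "1 \<le> n" "\<omega> \<in> configs (ball_tree D n)"
      from M(3)[OF this] q(2)[OF this]
      show "measure M {x \<in> space M. restrict x (ball_tree D n) = \<omega>} = Q n \<omega>" by simp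
    qed
  qed (rule q(1), assumption, rule qcons)
qed

section \<open>From weights to Gibbs measures\<close>

abbreviation spin_space :: "nat \<Rightarrow> (nat list \<Rightarrow> nat) measure" where
  "spin_space D \<equiv> PiM (tree D) (\<lambda>_. count_space {0, 1})"

lemma space_spin: "sets M = sets (spin_space D) \<Longrightarrow> space M = configs (tree D)"
  using sets_eq_imp_space_eq[of M "spin_space D"] by (simp add: space_PiM configs_def)

lemma cylinder_measurable:
  assumes M: "sets M = sets (spin_space D)" and J: "finite J" "J \<subseteq> tree D"
  shows "{x \<in> space M. R (restrict x J)} \<in> sets M"
proof -
  have single: "{x \<in> space M. restrict x J = f} \<in> sets M" if f: "f \<in> configs J" for f
  proof -
    have "{x \<in> space M. \<forall>v\<in>J. x v = f v} \<in> sets M"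
    proof (rule sets.sets_Collect_finite_All[OF _ J(1)])
      fix v assume v: "v \<in> J"
      have "(\<lambda>x. x v) \<in> measurable (spin_space D) (count_space {0, 1})"
        using v J by (intro measurable_component_singleton) auto
      then have "(\<lambda>x. x v) \<in> measurable M (count_space {0, 1})"
        using measurable_cong_sets[OF M refl] by blast
      then show "{x \<in> space M. x v = f v} \<in> sets M"
        by (rule measurable_sets_Collect[where P = "\<lambda>r. r = f v"]) auto
    qed
    moreover have "{x \<in> space M. \<forall>v\<in>J. x v = f v} = {x \<in> space M. restrict x J = f}"
      using f unfolding configs_def
      by (intro Collect_cong conj_cong refl) (auto simp: fun_eq_iff restrict_def PiE_def extensional_def)
    ultimately show ?thesis by simp
  qed
  have "{x \<in> space M. R (restrict x J)} = (\<Union>f\<in>{f \<in> configs J. R f}. {x \<in> space M. restrict x J = f})"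
    using configs_restrict[OF _ J(2)] space_spin[OF M] by auto
  also have "\<dots> \<in> sets M"
    using J(1) single by (intro sets.finite_UN) auto
  finally show ?thesis .
qed

lemma measure_cylinder_sum:
  assumes "prob_space M" and M: "sets M = sets (spin_space D)" and J: "finite J" "J \<subseteq> tree D"
  shows "measure M {x \<in> space M. R (restrict x J)} =
    (\<Sum>f\<in>{f \<in> configs J. R f}. measure M {x \<in> space M. restrict x J = f})"
proof -
  interpret prob_space M by fact
  have "{x \<in> space M. R (restrict x J)} = (\<Union>f\<in>{f \<in> configs J. R f}. {x \<in> space M. restrict x J = f})"
    using configs_restrict[OF _ J(2)] space_spin[OF M] by auto
  then show ?thesis
    by (simp only:) (rule finite_measure_finite_Union,
      use J cylinder_measurable[OF M J] in \<open>auto simp: disjoint_family_on_def\<close>)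
qed

text \<open>Every finite set of sites lies in a ball, so the box events that generate the product
  space are finite unions of ball cylinders.\<close>

lemma tree_measure_eqI:
  assumes MN: "prob_space M" "prob_space N" "sets M = sets (spin_space D)" "sets N = sets (spin_space D)"
    and eq: "\<And>n \<omega>. n \<ge> 1 \<Longrightarrow> \<omega> \<in> configs (ball_tree D n) \<Longrightarrow>
      measure M {x \<in> space M. restrict x (ball_tree D n) = \<omega>} = measure N {x \<in> space N. restrict x (ball_tree D n) = \<omega>}"
  shows "M = N"
proof (rule measure_eqI_PiM_infinite[OF MN(3,4)])
  interpret M: prob_space M by fact
  interpret N: prob_space N by fact
  show "finite_measure M" by unfold_locales
  fix A :: "nat list \<Rightarrow> nat set" and J
  assume J: "finite J" "J \<subseteq> tree D" and A: "\<And>i. i \<in> J \<Longrightarrow> A i \<in> sets (count_space {0, 1})"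
  obtain n where n: "J \<subseteq> ball_tree D n" using finite_subset_ball_tree J .
  \<comment> \<open>\<open>Suc\<close>, because agreement is assumed only from radius 1 on.\<close>
  let ?B = "ball_tree D (Suc n)"
  have B: "finite ?B" "?B \<subseteq> tree D" "J \<subseteq> ?B"
    using n ball_tree_mono[of n "Suc n" D] by (auto simp: ball_tree_subset)
  let ?R = "\<lambda>f. \<forall>v\<in>J. f v \<in> A v"
  have emb: "prod_emb (tree D) (\<lambda>_. count_space {0, 1}) J (Pi\<^sub>E J A) = {x \<in> space K. ?R (restrict x ?B)}"
    if "sets K = sets (spin_space D)" for K :: "(nat list \<Rightarrow> nat) measure"
  proof -
    have "?R (restrict x ?B) \<longleftrightarrow> (\<forall>v\<in>J. x v \<in> A v)" for x using B(3) by auto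
    then show ?thesis
      unfolding space_spin[OF that] by (auto simp: prod_emb_def configs_def simp del: restrict_apply)
  qed
  have "(\<Sum>f\<in>{f \<in> configs ?B. ?R f}. measure M {x \<in> space M. restrict x ?B = f}) =
      (\<Sum>f\<in>{f \<in> configs ?B. ?R f}. measure N {x \<in> space N. restrict x ?B = f})"
    by (rule sum.cong[OF refl], rule eq) auto
  then have "measure M {x \<in> space M. ?R (restrict x ?B)} = measure N {x \<in> space N. ?R (restrict x ?B)}"
    using measure_cylinder_sum[OF MN(1,3) B(1,2), of ?R] measure_cylinder_sum[OF MN(2,4) B(1,2), of ?R]
    by (simp only:)
  then show "emeasure M (prod_emb (tree D) (\<lambda>_. count_space {0, 1}) J (Pi\<^sub>E J A)) =
      emeasure N (prod_emb (tree D) (\<lambda>_. count_space {0, 1}) J (Pi\<^sub>E J A))"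
    using emb[OF MN(3)] emb[OF MN(4)] by (simp only: M.emeasure_eq_measure N.emeasure_eq_measure)
qed

lemma site_weight_nonneg:
  assumes "D \<ge> 1" "lam > 0" "\<And>k. k \<le> D \<Longrightarrow> \<theta> k > 0" "v \<in> tree D" "\<And>j. j \<in> nbhd D v \<Longrightarrow> \<omega> j \<in> {0, 1}"
  shows "site_weight D lam \<theta> \<omega> v \<ge> 0"
proof -
  have "site_weight D lam \<theta> \<omega> v = boltzmann (potential D lam \<theta> v (restrict \<omega> (nbhd D v)))"
    by (rule boltzmann_potential[symmetric]) (use assms in auto)
  then show ?thesis by (simp add: boltzmann_def)
qed

lemma site_weight_adjacent:
  assumes "tree_adj D i j" "\<omega> i = 1" "\<omega> j = 1"
  shows "site_weight D lam \<theta> \<omega> i = 0"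
proof -
  have i: "i \<in> tree D" "j \<in> nbhd D i" "j \<noteq> i"
    using assms(1) by (auto simp: tree_adj_def nbhd_def)
  then consider "j \<in> children D i" | "i \<noteq> []" "j = tl i"
    by (auto simp: nbhd_eq split: if_splits)
  then have "(if i = [] then 0 else \<omega> (tl i)) + (\<Sum>c\<in>children D i. \<omega> c) \<noteq> 0"
  proof cases
    case 1
    then have "(\<Sum>c\<in>children D i. \<omega> c) \<noteq> 0" using assms(3) by (auto intro!: bexI[of _ j])
    then show ?thesis by simp
  qed (use assms(3) in auto)
  then show ?thesis using assms(2) by (auto simp: site_weight_def vertex_weight_def)
qed

text \<open>In a ball that reaches well beyond \<Lambda>, all factors that see \<Lambda> are genuine
  site weights. The messages sit in the remaining factor, which is constant in the spins of
  \<Lambda> and cancels from the conditional probability.\<close>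

lemma gibbs_measure_of_weights:
  fixes msg :: "nat \<Rightarrow> nat list \<Rightarrow> nat \<Rightarrow> nat \<Rightarrow> real"
  assumes D: "D \<ge> 1" and lam: "lam > 0" and \<theta>: "\<And>k. k \<le> D \<Longrightarrow> \<theta> k > 0"
    and PM: "prob_space M" and M: "sets M = sets (spin_space D)"
    and msg: "\<And>n v p s. msg n v p s \<ge> 0" and Z: "\<And>n. n \<ge> 1 \<Longrightarrow> Z n > 0"
    and marg: "\<And>n \<omega>. n \<ge> 1 \<Longrightarrow> \<omega> \<in> configs (ball_tree D n) \<Longrightarrow>
      measure M {x \<in> space M. restrict x (ball_tree D n) = \<omega>} = tree_weight D lam \<theta> n (msg n) \<omega> / Z n"
  shows "gibbs_measure D lam \<theta> M"
proof -
  interpret prob_space M by fact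
  have meas: "measure M {x \<in> space M. R (restrict x (ball_tree D n))} =
      (\<Sum>\<xi>\<in>{\<xi> \<in> configs (ball_tree D n). R \<xi>}. tree_weight D lam \<theta> n (msg n) \<xi>) / Z n" if "n \<ge> 1" for R n
    using measure_cylinder_sum[OF PM M finite_ball_tree ball_tree_subset, of R n] marg[OF that]
    by (simp add: sum_divide_distrib)
  have hc: "AE x in M. x \<in> hardcore D (tree D)"
  proof -
    have "AE x in M. \<not> (x i = 1 \<and> x j = 1)" if ij: "tree_adj D i j" for i j
    proof -
      define n where "n = length i + length j + 1"
      let ?B = "ball_tree D n"
      have iB: "i \<in> ?B" "j \<in> ?B" "i \<in> tree D" "length i < n" "n \<ge> 1" using ij by (auto simp: tree_adj_def ball_tree_def n_def)
      let ?R = "\<lambda>f. f i = 1 \<and> f j = 1"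
      have tw0: "tree_weight D lam \<theta> n (msg n) \<xi> = 0" if "?R \<xi>" for \<xi>
      proof -
        have "(\<Prod>v\<in>{v \<in> tree D. length v < n}. site_weight D lam \<theta> \<xi> v) = 0"
          using iB site_weight_adjacent[OF ij, of \<xi>] that by (intro prod_zero) auto
        then show ?thesis by (simp add: tree_weight_def)
      qed
      have "(\<Sum>\<xi>\<in>{\<xi> \<in> configs ?B. ?R \<xi>}. tree_weight D lam \<theta> n (msg n) \<xi>) = 0"
        by (rule sum.neutral) (use tw0 in auto)
      then have m0: "measure M {x \<in> space M. ?R (restrict x ?B)} = 0"
        using meas[OF iB(5), of ?R] by (simp only: div_0)
      have cm: "{x \<in> space M. ?R (restrict x ?B)} \<in> sets M"
        by (rule cylinder_measurable[OF M]) (auto simp: ball_tree_subset)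
      have "AE x in M. \<not> ?R (restrict x ?B)"
        using m0 cm AE_iff_measurable[OF cm, of "\<lambda>x. \<not> ?R (restrict x ?B)"] by (simp add: emeasure_eq_measure del: restrict_apply)
      then show ?thesis using iB by simp
    qed
    then have "AE x in M. \<forall>i\<in>tree D. \<forall>j\<in>tree D. tree_adj D i j \<longrightarrow> \<not> (x i = 1 \<and> x j = 1)"
      by (simp add: AE_ball_countable countable_subset[OF subset_UNIV])
    then show ?thesis
      using AE_space by eventually_elim (auto simp: hardcore_def space_spin[OF M])
  qed
  have dlr: "measure M {x \<in> space M. restrict x S = \<omega>} =
        (\<Sum>\<eta>\<in>hardcore D (boundary D \<Lambda>). finite_prob D lam \<theta> \<Lambda> S \<omega> \<eta> *
           measure M {x \<in> space M. restrict x (boundary D \<Lambda>) = \<eta>})"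
    if \<Lambda>: "finite \<Lambda>" "\<Lambda> \<subseteq> tree D" and S: "S \<subseteq> \<Lambda>" for \<Lambda> S \<omega>
  proof -
    let ?d = "boundary D \<Lambda>"
    obtain N where N: "\<Lambda> \<subseteq> ball_tree D N" using finite_subset_ball_tree \<Lambda> .
    \<comment> \<open>The boundary of \<Lambda> lies in the ball of radius \<open>N + 2\<close>,
      while a vertex of layer \<open>n\<close> and its parent have depth at least
      \<open>N + 2\<close>. So no message sees \<Lambda>.\<close>
    define n where "n = N + 3"
    let ?B = "ball_tree D n"
    have n1: "n \<ge> 1" by (simp add: n_def)
    have dB: "?d \<subseteq> ?B" using boundary_subset_ball[OF N] ball_tree_mono[of "N + 2" n D] by (auto simp: n_def)
    have \<Lambda>B: "\<Lambda> \<subseteq> ?B" using N ball_tree_mono[of N n D] by (auto simp: n_def)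
    define I where "I = {i \<in> tree D. nbhd D i \<inter> \<Lambda> \<noteq> {}}"
    have I_sub: "I \<subseteq> {v \<in> tree D. length v < n}"
    proof
      fix i assume "i \<in> I"
      then obtain j where j: "i \<in> tree D" "j \<in> nbhd D i" "j \<in> \<Lambda>" by (auto simp: I_def)
      then have "j \<in> tree D" "length j \<le> N" using N by (auto simp: ball_tree_def)
      then show "i \<in> {v \<in> tree D. length v < n}"
        using nbhd_length[of j D i] j nbhd_sym[of j D i] by (auto simp: n_def)
    qed
    \<comment> \<open>The part of the weight that does not depend on the spins in \<Lambda>.\<close>
    define rest where "rest \<xi> = (\<Prod>v\<in>{v \<in> tree D. length v < n} - I. site_weight D lam \<theta> \<xi> v) *
       (\<Prod>v\<in>layer D n. msg n v (\<xi> (tl v)) (\<xi> v))" for \<xi>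
    define G where "G \<nu> \<eta> = boltzmann (hamiltonian D lam \<theta> \<Lambda> (merge \<Lambda> ?d (\<nu>, \<eta>)))" for \<nu> \<eta>
    have G0: "G \<nu> \<eta> \<ge> 0" for \<nu> \<eta> by (simp add: G_def boltzmann_def)
    have tw: "tree_weight D lam \<theta> n (msg n) \<xi> = G (restrict \<xi> \<Lambda>) (restrict \<xi> ?d) * rest (restrict \<xi> (?B - \<Lambda>))"
      if \<xi>: "\<xi> \<in> configs ?B" for \<xi>
    proof -
      have mg: "merge \<Lambda> ?d (restrict \<xi> \<Lambda>, restrict \<xi> ?d) j = \<xi> j" if "j \<in> \<Lambda> \<union> ?d" for j
        using that by (auto simp: merge_def)
      have "G (restrict \<xi> \<Lambda>) (restrict \<xi> ?d) = (\<Prod>i\<in>I. site_weight D lam \<theta> (merge \<Lambda> ?d (restrict \<xi> \<Lambda>, restrict \<xi> ?d)) i)"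
        unfolding G_def I_def
      proof (rule boltzmann_hamiltonian[OF D lam \<theta> \<Lambda>])
        fix j assume j: "j \<in> \<Lambda> \<union> ?d"
        then have "j \<in> ?B" using \<Lambda>B dB by auto
        then show "merge \<Lambda> ?d (restrict \<xi> \<Lambda>, restrict \<xi> ?d) j \<in> {0, 1}"
          unfolding mg[OF j] by (rule configs_range[OF \<xi>])
      qed
      also have "\<dots> = (\<Prod>i\<in>I. site_weight D lam \<theta> \<xi> i)"
      proof (rule prod.cong[OF refl], rule site_weight_cong)
        fix i j assume "i \<in> I" "j \<in> nbhd D i"
        then show "merge \<Lambda> ?d (restrict \<xi> \<Lambda>, restrict \<xi> ?d) j = \<xi> j"
          using nbhd_meets_subset[OF _ \<Lambda>(2), of i] by (intro mg) (auto simp: I_def)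
      qed (auto simp: I_def)
      finally have 1: "G (restrict \<xi> \<Lambda>) (restrict \<xi> ?d) = (\<Prod>i\<in>I. site_weight D lam \<theta> \<xi> i)" .
      have 2: "rest (restrict \<xi> (?B - \<Lambda>)) = rest \<xi>"
      proof -
        have "site_weight D lam \<theta> (restrict \<xi> (?B - \<Lambda>)) v = site_weight D lam \<theta> \<xi> v"
          if v: "v \<in> {v \<in> tree D. length v < n} - I" for v
        proof (rule site_weight_cong)
          fix j assume j: "j \<in> nbhd D v"
          then have "j \<in> ?B" using v nbhd_length[of v D j] by (auto simp: ball_tree_def)
          moreover have "j \<notin> \<Lambda>" using v j by (auto simp: I_def)
          ultimately show "restrict \<xi> (?B - \<Lambda>) j = \<xi> j" by simp
        qed (use v in auto)
        moreover have "restrict \<xi> (?B - \<Lambda>) v = \<xi> v \<and> restrict \<xi> (?B - \<Lambda>) (tl v) = \<xi> (tl v)" if v: "v \<in> layer D n" for v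
        proof -
          have "v \<in> ?B" "tl v \<in> ?B" "v \<notin> \<Lambda>" "tl v \<notin> \<Lambda>"
            using v N tl_mem_tree[of v D] by (auto simp: layer_def ball_tree_def n_def)
          then show ?thesis by simp
        qed
        ultimately show ?thesis unfolding rest_def by (simp del: restrict_apply)
      qed
      have "tree_weight D lam \<theta> n (msg n) \<xi> = (\<Prod>i\<in>I. site_weight D lam \<theta> \<xi> i) * rest \<xi>"
        unfolding tree_weight_def rest_def
        by (subst prod.subset_diff[OF I_sub]) (auto simp: mult_ac)
      then show ?thesis unfolding 1 2 .
    qed
    define r where "r \<eta> = (\<Sum>\<zeta>\<in>{\<zeta> \<in> configs (?B - \<Lambda>). restrict \<zeta> ?d = \<eta>}. rest \<zeta>)" for \<eta>
    \<comment> \<open>Once the boundary spins are fixed to \<eta>, the spins in \<Lambda> and those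
      outside are summed independently. This is the spatial Markov property.\<close>
    have factor: "(\<Sum>\<xi>\<in>{\<xi> \<in> configs ?B. R (restrict \<xi> \<Lambda>) \<and> restrict \<xi> ?d = \<eta>}. tree_weight D lam \<theta> n (msg n) \<xi>) =
        (\<Sum>\<nu>\<in>{\<nu> \<in> configs \<Lambda>. R \<nu>}. G \<nu> \<eta>) * r \<eta>" for R \<eta>
    proof -
      have "(\<Sum>\<nu>\<in>{\<nu> \<in> configs \<Lambda>. R \<nu>}. G \<nu> \<eta>) * r \<eta> =
          (\<Sum>(\<nu>, \<zeta>)\<in>{\<nu> \<in> configs \<Lambda>. R \<nu>} \<times> {\<zeta> \<in> configs (?B - \<Lambda>). restrict \<zeta> ?d = \<eta>}. G \<nu> \<eta> * rest \<zeta>)"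
        by (simp only: r_def sum_product sum.cartesian_product)
      also have "\<dots> = (\<Sum>\<xi>\<in>{\<xi> \<in> configs ?B. R (restrict \<xi> \<Lambda>) \<and> restrict \<xi> ?d = \<eta>}. tree_weight D lam \<theta> n (msg n) \<xi>)"
      proof (rule sum.reindex_bij_witness[symmetric, where j = "\<lambda>\<xi>. (restrict \<xi> \<Lambda>, restrict \<xi> (?B - \<Lambda>))" and i = "merge \<Lambda> (?B - \<Lambda>)"])
        fix \<xi> assume \<xi>: "\<xi> \<in> {\<xi> \<in> configs ?B. R (restrict \<xi> \<Lambda>) \<and> restrict \<xi> ?d = \<eta>}"
        show "merge \<Lambda> (?B - \<Lambda>) (restrict \<xi> \<Lambda>, restrict \<xi> (?B - \<Lambda>)) = \<xi>"
          using \<xi> \<Lambda>B by (auto simp: merge_def fun_eq_iff configs_def PiE_def extensional_def)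
        have "restrict (restrict \<xi> (?B - \<Lambda>)) ?d = restrict \<xi> ?d"
          using dB boundary_disjoint[of \<Lambda> D] by (auto simp: fun_eq_iff)
        then show "(restrict \<xi> \<Lambda>, restrict \<xi> (?B - \<Lambda>)) \<in> {\<nu> \<in> configs \<Lambda>. R \<nu>} \<times> {\<zeta> \<in> configs (?B - \<Lambda>). restrict \<zeta> ?d = \<eta>}"
          using \<xi> configs_restrict[of \<xi> ?B] \<Lambda>B by (auto simp del: restrict_apply restrict_restrict)
        show "(case (restrict \<xi> \<Lambda>, restrict \<xi> (?B - \<Lambda>)) of (\<nu>, \<zeta>) \<Rightarrow> G \<nu> \<eta> * rest \<zeta>) = tree_weight D lam \<theta> n (msg n) \<xi>"
          using \<xi> tw[of \<xi>] by (simp del: restrict_apply)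
      next
        fix b assume b: "b \<in> {\<nu> \<in> configs \<Lambda>. R \<nu>} \<times> {\<zeta> \<in> configs (?B - \<Lambda>). restrict \<zeta> ?d = \<eta>}"
        obtain \<nu> \<zeta> where bb: "b = (\<nu>, \<zeta>)" "\<nu> \<in> configs \<Lambda>" "R \<nu>" "\<zeta> \<in> configs (?B - \<Lambda>)" "restrict \<zeta> ?d = \<eta>"
          using b by auto
        have r1: "restrict (merge \<Lambda> (?B - \<Lambda>) (\<nu>, \<zeta>)) \<Lambda> = \<nu>"
          using bb by (auto simp: merge_def fun_eq_iff configs_def PiE_def extensional_def)
        have r2: "restrict (merge \<Lambda> (?B - \<Lambda>) (\<nu>, \<zeta>)) (?B - \<Lambda>) = \<zeta>"
          using bb by (auto simp: merge_def fun_eq_iff configs_def PiE_def extensional_def)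
        show "(restrict (merge \<Lambda> (?B - \<Lambda>) b) \<Lambda>, restrict (merge \<Lambda> (?B - \<Lambda>) b) (?B - \<Lambda>)) = b"
          unfolding bb(1) r1 r2 ..
        have "restrict (merge \<Lambda> (?B - \<Lambda>) (\<nu>, \<zeta>)) ?d = restrict \<zeta> ?d"
          using dB boundary_disjoint[of \<Lambda> D] by (auto simp: fun_eq_iff merge_def)
        moreover have "merge \<Lambda> (?B - \<Lambda>) (\<nu>, \<zeta>) \<in> configs ?B"
          using merge_configs[OF bb(2,4)] \<Lambda>B by (simp add: Un_absorb1)
        ultimately show "merge \<Lambda> (?B - \<Lambda>) b \<in> {\<xi> \<in> configs ?B. R (restrict \<xi> \<Lambda>) \<and> restrict \<xi> ?d = \<eta>}"
          using bb r1 by (simp del: restrict_apply)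
      qed
      finally show ?thesis ..
    qed
    have mS: "{x \<in> space M. restrict x S = \<omega>} = {x \<in> space M. restrict (restrict (restrict x ?B) \<Lambda>) S = \<omega>}"
      using S \<Lambda>B by (simp add: Int_absorb1 Int_absorb2 subset_trans[of S \<Lambda>])
    have md: "{x \<in> space M. restrict x ?d = \<eta>} = {x \<in> space M. restrict (restrict x ?B) ?d = \<eta>}" for \<eta>
      using dB by (simp add: Int_absorb1)
    let ?num = "\<lambda>\<eta>. \<Sum>\<nu>\<in>{\<nu> \<in> configs \<Lambda>. restrict \<nu> S = \<omega>}. G \<nu> \<eta>"
    let ?den = "\<lambda>\<eta>. \<Sum>\<nu>\<in>configs \<Lambda>. G \<nu> \<eta>"
    have Md: "measure M {x \<in> space M. restrict x ?d = \<eta>} = ?den \<eta> * r \<eta> / Z n" for \<eta>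
      unfolding md meas[OF n1, of "\<lambda>\<xi>. restrict \<xi> ?d = \<eta>"] using factor[of "\<lambda>_. True" \<eta>] by (simp del: restrict_apply)
    \<comment> \<open>If the denominator vanishes, the quotient is 0 by convention; by nonnegativity
      the numerator vanishes too, and so does the boundary probability.\<close>
    have fpM: "finite_prob D lam \<theta> \<Lambda> S \<omega> \<eta> * measure M {x \<in> space M. restrict x ?d = \<eta>} = ?num \<eta> * r \<eta> / Z n" for \<eta>
    proof -
      have "?num \<eta> = 0" if "?den \<eta> = 0"
      proof -
        have "G \<nu> \<eta> = 0" if "\<nu> \<in> configs \<Lambda>" for \<nu>
          using \<open>?den \<eta> = 0\<close> that G0 \<Lambda>(1) by (subst (asm) sum_nonneg_eq_0_iff) auto
        then show ?thesis by (intro sum.neutral) auto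
      qed
      then show ?thesis unfolding Md finite_prob_def G_def[symmetric] by (cases "?den \<eta> = 0") auto
    qed
    have fd: "finite (configs ?d)" using finite_boundary[OF \<Lambda>] by simp
    have "measure M {x \<in> space M. restrict x S = \<omega>} =
        (\<Sum>\<xi>\<in>{\<xi> \<in> configs ?B. restrict (restrict \<xi> \<Lambda>) S = \<omega>}. tree_weight D lam \<theta> n (msg n) \<xi>) / Z n"
      unfolding mS by (rule meas[OF n1, of "\<lambda>\<xi>. restrict (restrict \<xi> \<Lambda>) S = \<omega>"])
    also have "(\<Sum>\<xi>\<in>{\<xi> \<in> configs ?B. restrict (restrict \<xi> \<Lambda>) S = \<omega>}. tree_weight D lam \<theta> n (msg n) \<xi>) =
        (\<Sum>\<eta>\<in>configs ?d. \<Sum>\<xi>\<in>{\<xi> \<in> {\<xi> \<in> configs ?B. restrict (restrict \<xi> \<Lambda>) S = \<omega>}. restrict \<xi> ?d = \<eta>}. tree_weight D lam \<theta> n (msg n) \<xi>)"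
      by (rule sum.group[symmetric]) (use fd configs_restrict[OF _ dB] in \<open>auto simp del: restrict_apply\<close>)
    also have "\<dots> = (\<Sum>\<eta>\<in>configs ?d. ?num \<eta> * r \<eta>)"
    proof (rule sum.cong[OF refl])
      fix \<eta>
      have "{\<xi> \<in> {\<xi> \<in> configs ?B. restrict (restrict \<xi> \<Lambda>) S = \<omega>}. restrict \<xi> ?d = \<eta>} =
          {\<xi> \<in> configs ?B. restrict (restrict \<xi> \<Lambda>) S = \<omega> \<and> restrict \<xi> ?d = \<eta>}" by blast
      then show "(\<Sum>\<xi>\<in>{\<xi> \<in> {\<xi> \<in> configs ?B. restrict (restrict \<xi> \<Lambda>) S = \<omega>}. restrict \<xi> ?d = \<eta>}. tree_weight D lam \<theta> n (msg n) \<xi>) = ?num \<eta> * r \<eta>"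
        using factor[of "\<lambda>\<nu>. restrict \<nu> S = \<omega>" \<eta>] by (simp only:)
    qed
    finally have "measure M {x \<in> space M. restrict x S = \<omega>} =
        (\<Sum>\<eta>\<in>configs ?d. finite_prob D lam \<theta> \<Lambda> S \<omega> \<eta> * measure M {x \<in> space M. restrict x ?d = \<eta>})"
      unfolding fpM by (simp only: sum_divide_distrib)
    \<comment> \<open>Boundary configurations violating exclusion are null events by
      \<open>hc\<close>, so the sum shrinks to the range demanded by
      \<open>gibbs_measure\<close>.\<close>
    also have "\<dots> = (\<Sum>\<eta>\<in>hardcore D ?d. finite_prob D lam \<theta> \<Lambda> S \<omega> \<eta> * measure M {x \<in> space M. restrict x ?d = \<eta>})"
    proof (rule sum.mono_neutral_right[OF fd])
      show "hardcore D ?d \<subseteq> configs ?d" by (auto simp: hardcore_def)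
      show "\<forall>\<eta>\<in>configs ?d - hardcore D ?d. finite_prob D lam \<theta> \<Lambda> S \<omega> \<eta> * measure M {x \<in> space M. restrict x ?d = \<eta>} = 0"
      proof
        fix \<eta> assume \<eta>: "\<eta> \<in> configs ?d - hardcore D ?d"
        have dt: "?d \<subseteq> tree D" by (auto simp: boundary_def)
        have "AE x in M. restrict x ?d \<noteq> \<eta>"
          using hc
        proof eventually_elim
          case (elim x)
          then have "restrict x ?d \<in> hardcore D ?d"
            using dt configs_restrict[OF _ dt, of x] by (auto simp: hardcore_def)
          then show ?case using \<eta> by auto
        qed
        then have "measure M {x \<in> space M. restrict x ?d = \<eta>} = 0"
          using cylinder_measurable[OF M finite_boundary[OF \<Lambda>] dt, of "\<lambda>f. f = \<eta>"]
          by (subst (asm) AE_iff_measurable[OF _ refl]) (auto simp: emeasure_eq_measure)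
        then show "finite_prob D lam \<theta> \<Lambda> S \<omega> \<eta> * measure M {x \<in> space M. restrict x ?d = \<eta>} = 0" by simp
      qed
    qed
    finally show ?thesis .
  qed
  show ?thesis
    unfolding gibbs_measure_def using PM M hc dlr by blast
qed

section \<open>Gibbs measures from messages constant on layers\<close>

lemma tree_weight_scale:
  assumes m: "m \<ge> 1" and \<omega>: "\<omega> \<in> configs (ball_tree D m)"
    and msg: "\<And>v p s. v \<in> layer D m \<Longrightarrow> p \<le> 1 \<Longrightarrow> s \<le> 1 \<Longrightarrow> msg v p s = z v * msg' v p s"
  shows "tree_weight D lam \<theta> m msg \<omega> = (\<Prod>v\<in>layer D m. z v) * tree_weight D lam \<theta> m msg' \<omega>"
proof -
  have "msg v (\<omega> (tl v)) (\<omega> v) = z v * msg' v (\<omega> (tl v)) (\<omega> v)" if v: "v \<in> layer D m" for v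
  proof (rule msg[OF v])
    have "v \<in> ball_tree D m" "tl v \<in> ball_tree D m"
      using v tl_mem_tree[of v D] by (auto simp: layer_def ball_tree_def)
    then show "\<omega> (tl v) \<le> 1" "\<omega> v \<le> 1" using configs_range[OF \<omega>] by force+
  qed
  then show ?thesis by (simp add: tree_weight_def prod.distrib)
qed

lemma edge_msg_scale: "edge_msg z x y p s = z * edge_msg 1 x y p s"
  by (simp add: edge_msg_def)

lemma tree_weight_nonneg:
  assumes "D \<ge> 1" "lam > 0" "\<And>k. k \<le> D \<Longrightarrow> \<theta> k > 0" "\<omega> \<in> configs (ball_tree D m)"
    and msg: "\<And>v p s. msg v p s \<ge> 0"
  shows "tree_weight D lam \<theta> m msg \<omega> \<ge> 0"
proof -
  have "site_weight D lam \<theta> \<omega> v \<ge> 0" if v: "v \<in> {v \<in> tree D. length v < m}" for v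
  proof (rule site_weight_nonneg[OF assms(1,2)])
    fix j assume "j \<in> nbhd D v"
    then have "j \<in> ball_tree D m" using v nbhd_length[of v D j] by (auto simp: ball_tree_def)
    then show "\<omega> j \<in> {0, 1}" by (rule configs_range[OF assms(4)])
  qed (use v assms(3) in auto)
  then show ?thesis unfolding tree_weight_def using msg by (intro mult_nonneg_nonneg prod_nonneg) auto
qed

lemma zero_config: "(\<lambda>v\<in>S. 0) \<in> configs S"
  by (auto simp: configs_def)

text \<open>The empty configuration serves as a witness that normalising constants are
  positive.\<close>

lemma tree_weight_zero_config:
  assumes "m \<ge> 1"
  shows "tree_weight D lam \<theta> m msg (\<lambda>v\<in>ball_tree D m. 0) =
    (\<Prod>v\<in>{v \<in> tree D. length v < m}. \<theta> 0) * (\<Prod>v\<in>layer D m. msg v 0 0)"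
proof -
  have 1: "site_weight D lam \<theta> (\<lambda>v\<in>ball_tree D m. 0) v = \<theta> 0" if v: "v \<in> {v \<in> tree D. length v < m}" for v
  proof -
    have "site_weight D lam \<theta> (\<lambda>v\<in>ball_tree D m. 0) v = site_weight D lam \<theta> (\<lambda>_. 0) v"
    proof (rule site_weight_cong)
      fix j assume "j \<in> nbhd D v"
      then show "(\<lambda>v\<in>ball_tree D m. 0) j = 0" using v nbhd_length[of v D j] by (auto simp: ball_tree_def)
    qed (use v in auto)
    then show ?thesis by (simp add: site_weight_def vertex_weight_def)
  qed
  have 2: "(\<lambda>v\<in>ball_tree D m. 0 :: nat) v = 0 \<and> (\<lambda>v\<in>ball_tree D m. 0 :: nat) (tl v) = 0" if "v \<in> layer D m" for v
    using that tl_mem_tree[of v D] by (auto simp: layer_def ball_tree_def)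
  have 3: "msg v ((\<lambda>v\<in>ball_tree D m. 0) (tl v)) ((\<lambda>v\<in>ball_tree D m. 0) v) = msg v 0 0" if "v \<in> layer D m" for v
    using 2[OF that] by (simp del: restrict_apply)
  show ?thesis unfolding tree_weight_def
    by (intro arg_cong2[of _ _ _ _ "(*)"] prod.cong refl) (rule 1 3, assumption)+
qed

definition offspring_poly :: "nat \<Rightarrow> (nat \<Rightarrow> real) \<Rightarrow> real \<Rightarrow> real" where
  "offspring_poly d \<theta> x = (\<Sum>k\<le>d. real (d choose k) * \<theta> k * x ^ k)"

lemma offspring_poly_pos:
  assumes "\<And>k. k \<le> d \<Longrightarrow> \<theta> k > 0" "x \<ge> 0"
  shows "offspring_poly d \<theta> x > 0"
proof -
  have "0 < real (d choose 0) * \<theta> 0 * x ^ 0" using assms(1)[of 0] by simp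
  then show ?thesis unfolding offspring_poly_def
    using assms(2) less_imp_le[OF assms(1)] by (intro sum_pos2[of _ 0] mult_nonneg_nonneg) auto
qed

lemma site_poly_children:
  assumes "v \<noteq> []"
  shows "site_poly \<theta> (children D v) (\<lambda>_. x) = offspring_poly (D - 1) \<theta> x"
  using assms by (simp add: site_poly_const card_children offspring_poly_def)

text \<open>Passing up the messages of layer \<open>n + 1\<close> returns those of layer
  \<open>n\<close> times a constant, so the normalised ball weights are consistent. Information
  flows towards the root: layer \<open>n\<close> is computed from layer \<open>n + 1\<close>, and a
  solution on all layers at once replaces a boundary condition at infinity. The marginals are
  returned as well, in order to tell measures apart.\<close>

lemma gibbs_of_recursion:
  fixes X Y :: "nat \<Rightarrow> real"
  assumes D: "D \<ge> 1" and lam: "lam > 0" and \<theta>: "\<And>k. k \<le> D \<Longrightarrow> \<theta> k > 0"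
    and XY: "\<And>n. X n > 0" "\<And>n. Y n > 0"
    and X: "\<And>n. X n = lam * Y (Suc n) ^ (D - 1) / offspring_poly (D - 1) \<theta> (X (Suc n))"
    and Y: "\<And>n. Y n = offspring_poly (D - 1) (\<lambda>k. \<theta> (Suc k)) (X (Suc n)) / offspring_poly (D - 1) \<theta> (X (Suc n))"
  obtains M Z where "gibbs_measure D lam \<theta> M" "\<And>n. n \<ge> 1 \<Longrightarrow> Z n > 0"
    "\<And>n \<omega>. n \<ge> 1 \<Longrightarrow> \<omega> \<in> configs (ball_tree D n) \<Longrightarrow> measure M {x \<in> space M. restrict x (ball_tree D n) = \<omega>} =
       tree_weight D lam \<theta> n (\<lambda>_. edge_msg 1 (X n) (Y n)) \<omega> / Z n"
proof -
  let ?w = "\<lambda>n \<omega>. tree_weight D lam \<theta> n (\<lambda>_. edge_msg 1 (X n) (Y n)) \<omega>"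
  define Z where "Z n = (\<Sum>\<omega>\<in>configs (ball_tree D n). ?w n \<omega>)" for n
  have msg0: "edge_msg 1 (X n) (Y n) p s \<ge> 0" for n p s
    using XY by (simp add: edge_msg_def less_imp_le)
  have w0: "?w n \<omega> \<ge> 0" if "\<omega> \<in> configs (ball_tree D n)" for n \<omega>
    by (rule tree_weight_nonneg[OF D lam]) (use \<theta> that msg0 in auto)
  have Z: "Z n > 0" if "n \<ge> 1" for n
  proof -
    have "?w n (\<lambda>v\<in>ball_tree D n. 0) > 0"
      unfolding tree_weight_zero_config[OF that] using \<theta>[of 0]
      by (auto simp: edge_msg_def intro!: mult_pos_pos prod_pos)
    then show ?thesis unfolding Z_def
      by (intro sum_pos2[of _ "\<lambda>v\<in>ball_tree D n. 0"]) (auto intro: w0 zero_config)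
  qed
  define E where "E n = offspring_poly (D - 1) \<theta> (X n)" for n
  have E: "E n > 0" for n unfolding E_def
    by (rule offspring_poly_pos) (use \<theta> less_imp_le[OF XY(1)[of n]] in auto)
  have step: "(\<Sum>\<nu>\<in>{\<nu> \<in> configs (ball_tree D (Suc n)). restrict \<nu> (ball_tree D n) = \<omega>}. ?w (Suc n) \<nu>) =
      (\<Prod>v\<in>layer D n. E (Suc n)) * ?w n \<omega>"
    if n: "n \<ge> 1" and \<omega>: "\<omega> \<in> configs (ball_tree D n)" for n \<omega>
  proof -
    have "(\<Sum>\<nu>\<in>{\<nu> \<in> configs (ball_tree D (Suc n)). restrict \<nu> (ball_tree D n) = \<omega>}. ?w (Suc n) \<nu>) =
        tree_weight D lam \<theta> n (pass_up D lam \<theta> (\<lambda>_. edge_msg 1 (X (Suc n)) (Y (Suc n)))) \<omega>"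
      by (rule sum_tree_weight_Suc[OF n \<omega>])
    also have "\<dots> = (\<Prod>v\<in>layer D n. E (Suc n)) * ?w n \<omega>"
    proof (rule tree_weight_scale[OF n \<omega>])
      fix v p s assume v: "v \<in> layer D n" and ps: "p \<le> (1::nat)" "s \<le> (1::nat)"
      have "v \<noteq> []" using v n by (auto simp: layer_def)
      note sp = site_poly_children[OF this]
      have "pass_up D lam \<theta> (\<lambda>_. edge_msg 1 (X (Suc n)) (Y (Suc n))) v p s =
        edge_msg ((\<Prod>c\<in>children D v. 1) * site_poly \<theta> (children D v) (\<lambda>_. X (Suc n)))
        (lam * (\<Prod>c\<in>children D v. Y (Suc n)) / site_poly \<theta> (children D v) (\<lambda>_. X (Suc n)))
        (site_poly (\<lambda>k. \<theta> (Suc k)) (children D v) (\<lambda>_. X (Suc n)) / site_poly \<theta> (children D v) (\<lambda>_. X (Suc n))) p s"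
        by (rule pass_up_edge_msg) (use E[of "Suc n"] ps sp in \<open>auto simp: E_def\<close>)
      also have "\<dots> = edge_msg (E (Suc n)) (X n) (Y n) p s"
        unfolding sp X[of n] Y[of n] E_def using \<open>v \<noteq> []\<close> by (simp add: card_children)
      finally show "pass_up D lam \<theta> (\<lambda>_. edge_msg 1 (X (Suc n)) (Y (Suc n))) v p s = E (Suc n) * edge_msg 1 (X n) (Y n) p s"
        by (subst (asm) edge_msg_scale)
    qed
    finally show ?thesis .
  qed
  have ZS: "Z (Suc n) = (\<Prod>v\<in>layer D n. E (Suc n)) * Z n" if n: "n \<ge> 1" for n
  proof -
    have "Z (Suc n) = (\<Sum>\<omega>\<in>configs (ball_tree D n). \<Sum>\<nu>\<in>{\<nu> \<in> configs (ball_tree D (Suc n)). restrict \<nu> (ball_tree D n) = \<omega>}. ?w (Suc n) \<nu>)"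
      unfolding Z_def
      by (rule sum.group[symmetric]) (use configs_restrict[OF _ ball_tree_mono[of n "Suc n" D]] in auto)
    also have "\<dots> = (\<Sum>\<omega>\<in>configs (ball_tree D n). (\<Prod>v\<in>layer D n. E (Suc n)) * ?w n \<omega>)"
      by (rule sum.cong[OF refl]) (rule step[OF n])
    finally show ?thesis by (simp add: Z_def sum_distrib_left)
  qed
  have "\<exists>M. prob_space M \<and> sets M = sets (spin_space D) \<and> (\<forall>n \<omega>. n \<ge> 1 \<longrightarrow> \<omega> \<in> configs (ball_tree D n) \<longrightarrow>
       measure M {x \<in> space M. restrict x (ball_tree D n) = \<omega>} = ?w n \<omega> / Z n)"
  proof (rule tree_measure_exists[of D "\<lambda>n \<omega>. ?w n \<omega> / Z n"])
    fix n :: nat and \<omega> assume n: "n \<ge> 1"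
    show "(\<Sum>\<omega>\<in>configs (ball_tree D n). ?w n \<omega> / Z n) = 1"
      using Z[OF n] by (simp add: Z_def flip: sum_divide_distrib)
    assume \<omega>: "\<omega> \<in> configs (ball_tree D n)"
    show "?w n \<omega> / Z n \<ge> 0" using w0[OF \<omega>] Z[OF n] by simp
    have P: "(\<Prod>v\<in>layer D n. E (Suc n)) > 0" using E by (intro prod_pos) auto
    show "(\<Sum>\<nu>\<in>{\<nu> \<in> configs (ball_tree D (Suc n)). restrict \<nu> (ball_tree D n) = \<omega>}. ?w (Suc n) \<nu> / Z (Suc n)) = ?w n \<omega> / Z n"
      unfolding sum_divide_distrib[symmetric] step[OF n \<omega>] ZS[OF n] using P E[of "Suc n"] by simp
  next
    fix M assume "prob_space M" "sets M = sets (spin_space D)"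
      "\<And>n \<omega>. 1 \<le> n \<Longrightarrow> \<omega> \<in> configs (ball_tree D n) \<Longrightarrow> measure M {x \<in> space M. restrict x (ball_tree D n) = \<omega>} = ?w n \<omega> / Z n"
    then show ?thesis by blast
  qed
  then obtain M where M: "prob_space M" "sets M = sets (spin_space D)" "\<And>n \<omega>. n \<ge> 1 \<Longrightarrow> \<omega> \<in> configs (ball_tree D n) \<Longrightarrow>
       measure M {x \<in> space M. restrict x (ball_tree D n) = \<omega>} = ?w n \<omega> / Z n"
    by blast
  have "gibbs_measure D lam \<theta> M"
    by (rule gibbs_measure_of_weights[OF D lam _ M(1,2), where msg = "\<lambda>n _. edge_msg 1 (X n) (Y n)" and Z = Z])
      (use \<theta> msg0 Z M(3) in auto)
  then show ?thesis using Z M(3) by (rule that)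
qed

text \<open>Let the odds alternate between \<open>l\<close> and \<open>u\<close> with the parity of
  the depth. \<open>l\<close> occurs on both sides of its own equation because the ratios of the
  children are computed from the grandchildren, which have the parity of the vertex itself.\<close>

lemma two_cycle_not_unique:
  assumes D: "D \<ge> 2" and lam: "lam > 0" and \<theta>: "\<And>k. k \<le> D \<Longrightarrow> \<theta> k > 0"
    and lu: "l > 0" "u > 0" "l \<noteq> u"
  defines "S \<equiv> offspring_poly (D - 1) \<theta>" and "T \<equiv> offspring_poly (D - 1) (\<lambda>k. \<theta> (Suc k))"
  assumes cyc: "l = lam * (T l / S l) ^ (D - 1) / S u" "u = lam * (T u / S u) ^ (D - 1) / S l"
  shows "\<not> uniqueness_regime D lam \<theta>"
proof -
  have S: "S x > 0" and T: "T x > 0" if "x > 0" for x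
    unfolding S_def T_def using that D by (intro offspring_poly_pos \<theta>; simp)+
  \<comment> \<open>The observable: the probability that exactly the node \<open>[0]\<close> of the
    unit ball is occupied, relative to the empty ball, recovers \<open>a\<close>. It is applied once
    to \<open>l, u\<close> and once to \<open>u, l\<close>.\<close>
  have ex: "\<exists>M. gibbs_measure D lam \<theta> M \<and>
      \<theta> 0 * measure M {x \<in> space M. restrict x (ball_tree D 1) = (\<lambda>v\<in>ball_tree D 1. if v = [0] then 1 else 0)} =
      \<theta> 1 * a * measure M {x \<in> space M. restrict x (ball_tree D 1) = (\<lambda>v\<in>ball_tree D 1. 0)} \<and>
      measure M {x \<in> space M. restrict x (ball_tree D 1) = (\<lambda>v\<in>ball_tree D 1. 0)} \<noteq> 0"
    if ab: "a > 0" "b > 0" "a = lam * (T a / S a) ^ (D - 1) / S b" "b = lam * (T b / S b) ^ (D - 1) / S a" for a b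
  proof -
    \<comment> \<open>The parity is chosen so that layer 1, where the observable lives, carries
      \<open>a\<close>.\<close>
    define X where "X n = (if odd n then a else b)" for n :: nat
    define Y where "Y n = T (X (Suc n)) / S (X (Suc n))" for n
    have X0: "X n > 0" for n using ab by (simp add: X_def)
    have Y0: "Y n > 0" for n using S T X0 by (simp add: Y_def)
    have Xrec: "X n = lam * Y (Suc n) ^ (D - 1) / S (X (Suc n))" for n
    proof (cases "odd n")
      case True
      then have "X n = a" "X (Suc n) = b" "Y (Suc n) = T a / S a" by (simp_all add: X_def Y_def)
      then show ?thesis using ab(3) by simp
    next
      case False
      then have "X n = b" "X (Suc n) = a" "Y (Suc n) = T b / S b" by (simp_all add: X_def Y_def)
      then show ?thesis using ab(4) by simp
    qed
    have D1: "D \<ge> 1" using D by simp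
    have Yrec: "Y n = offspring_poly (D - 1) (\<lambda>k. \<theta> (Suc k)) (X (Suc n)) / offspring_poly (D - 1) \<theta> (X (Suc n))" for n
      by (simp only: Y_def S_def T_def)
    obtain M Z where M: "gibbs_measure D lam \<theta> M" and Z: "\<And>n. n \<ge> 1 \<Longrightarrow> Z n > 0"
      and m: "\<And>n \<omega>. n \<ge> 1 \<Longrightarrow> \<omega> \<in> configs (ball_tree D n) \<Longrightarrow> measure M {x \<in> space M. restrict x (ball_tree D n) = \<omega>} =
       tree_weight D lam \<theta> n (\<lambda>_. edge_msg 1 (X n) (Y n)) \<omega> / Z n"
      by (rule gibbs_of_recursion[where D = D and lam = lam and \<theta> = \<theta> and X = X and Y = Y, OF D1 lam _ X0 Y0 Xrec[unfolded S_def] Yrec], rule \<theta>, assumption, blast)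
    let ?o = "\<lambda>v\<in>ball_tree D 1. if v = [0] then 1 else 0 :: nat"
    have root: "[] \<in> tree D" by (rule tree.root)
    have L1: "layer D 1 = children D []" using layer_Suc[of D 0] by (simp add: layer_0)
    have c0: "[0] \<in> children D []" using D by (auto simp: children_def)
    have o_child: "?o c = (if c = [0] then 1 else 0)" if "c \<in> children D []" for c
    proof -
      have "c \<in> layer D 1" using that L1 by simp
      then have "c \<in> ball_tree D 1" by (auto simp: layer_def ball_tree_def)
      then show ?thesis by simp
    qed
    have o_root: "?o [] = 0" using root by (simp add: ball_tree_def)
    have sw: "site_weight D lam \<theta> ?o [] = \<theta> 1"
    proof -
      have "(\<Sum>c\<in>children D []. ?o c) = (\<Sum>c\<in>children D []. if c = [0] then 1 else 0)"
        by (rule sum.cong) (use o_child in auto)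
      also have "\<dots> = 1" using c0 by simp
      finally have sum1: "(\<Sum>c\<in>children D []. ?o c) = 1" .
      show ?thesis unfolding site_weight_def sum1 o_root by (simp add: vertex_weight_def)
    qed
    have less1: "{v \<in> tree D. length v < 1} = {[]}" using root by auto
    have "(\<Prod>v\<in>layer D 1. edge_msg 1 (X 1) (Y 1) (?o (tl v)) (?o v)) = (\<Prod>v\<in>children D []. if v = [0] then a else 1)"
      unfolding L1
    proof (rule prod.cong[OF refl])
      fix c assume c: "c \<in> children D []"
      have "tl c = []" using c by (auto simp: children_def)
      then show "edge_msg 1 (X 1) (Y 1) (?o (tl c)) (?o c) = (if c = [0] then a else 1)"
        unfolding o_child[OF c] \<open>tl c = []\<close> o_root by (simp add: edge_msg_def X_def)
    qed
    also have "\<dots> = a" using c0 by simp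
    finally have w1: "tree_weight D lam \<theta> 1 (\<lambda>_. edge_msg 1 (X 1) (Y 1)) ?o = \<theta> 1 * a"
      unfolding tree_weight_def less1 using sw by simp
    have w0: "tree_weight D lam \<theta> 1 (\<lambda>_. edge_msg 1 (X 1) (Y 1)) (\<lambda>v\<in>ball_tree D 1. 0) = \<theta> 0"
      unfolding tree_weight_zero_config[OF order_refl] less1 by (simp add: edge_msg_def)
    have oc: "?o \<in> configs (ball_tree D 1)" by (auto simp: configs_def)
    show ?thesis
      using M m[OF order_refl oc] m[OF order_refl zero_config] w0 w1 Z[of 1] \<theta>[of 0]
      by (intro exI[of _ M]) (simp del: restrict_apply)
  qed
  obtain M where M: "gibbs_measure D lam \<theta> M"
      "\<theta> 0 * measure M {x \<in> space M. restrict x (ball_tree D 1) = (\<lambda>v\<in>ball_tree D 1. if v = [0] then 1 else 0)} =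
      \<theta> 1 * l * measure M {x \<in> space M. restrict x (ball_tree D 1) = (\<lambda>v\<in>ball_tree D 1. 0)}"
      "measure M {x \<in> space M. restrict x (ball_tree D 1) = (\<lambda>v\<in>ball_tree D 1. 0)} \<noteq> 0"
    using ex[OF lu(1,2) cyc] by blast
  obtain N where N: "gibbs_measure D lam \<theta> N"
      "\<theta> 0 * measure N {x \<in> space N. restrict x (ball_tree D 1) = (\<lambda>v\<in>ball_tree D 1. if v = [0] then 1 else 0)} =
      \<theta> 1 * u * measure N {x \<in> space N. restrict x (ball_tree D 1) = (\<lambda>v\<in>ball_tree D 1. 0)}"
    using ex[OF lu(2,1) cyc(2,1)] by blast
  have "M \<noteq> N"
  proof
    assume "M = N"
    then have "\<theta> 1 * l = \<theta> 1 * u" using M(2,3) N(2) by auto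
    then show False using \<theta>[of 1] D lu(3) by auto
  qed
  then show ?thesis using M(1) N(1) unfolding uniqueness_regime_def by blast
qed

section \<open>Propagation of boundary conditions\<close>

lemma site_poly_mono:
  assumes "finite C" "\<And>k. k \<le> card C \<Longrightarrow> 0 \<le> \<theta> k" "\<And>k. k \<le> card C \<Longrightarrow> \<theta> k \<le> \<theta>' k"
    "\<And>c. c \<in> C \<Longrightarrow> 0 \<le> x c" "\<And>c. c \<in> C \<Longrightarrow> x c \<le> x' c"
  shows "site_poly \<theta> C x \<le> site_poly \<theta>' C x'"
  unfolding site_poly_def
proof (rule sum_mono)
  fix f assume f: "f \<in> configs C"
  have "(\<Sum>c\<in>C. f c) \<le> (\<Sum>c\<in>C. 1)"
    using configs_range[OF f] by (intro sum_mono) force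
  then have k: "(\<Sum>c\<in>C. f c) \<le> card C" by simp
  show "\<theta> (\<Sum>c\<in>C. f c) * (\<Prod>c\<in>C. if f c = 0 then 1 else x c) \<le>
      \<theta>' (\<Sum>c\<in>C. f c) * (\<Prod>c\<in>C. if f c = 0 then 1 else x' c)"
  proof (rule mult_mono)
    show "\<theta> (\<Sum>c\<in>C. f c) \<le> \<theta>' (\<Sum>c\<in>C. f c)" using assms(3) k by auto
    show "(\<Prod>c\<in>C. if f c = 0 then 1 else x c) \<le> (\<Prod>c\<in>C. if f c = 0 then 1 else x' c)"
      using assms(4,5) by (intro prod_mono) auto
    show "0 \<le> \<theta>' (\<Sum>c\<in>C. f c)" using assms(2,3) k by (meson order_trans)
    show "0 \<le> (\<Prod>c\<in>C. if f c = 0 then 1 else x c)" using assms(4) by (intro prod_nonneg) auto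
  qed
qed

lemma site_poly_cmult: "site_poly (\<lambda>k. a * \<theta> k) C x = a * site_poly \<theta> C x"
  by (simp add: site_poly_def sum_distrib_left mult.assoc)

lemma site_poly_one:
  assumes "finite C"
  shows "site_poly (\<lambda>_. 1) C x = (\<Prod>c\<in>C. 1 + x c)"
  using assms by (induction C rule: finite_induct) (simp_all add: site_poly_insert algebra_simps)

lemma site_poly_cong: "(\<And>c. c \<in> C \<Longrightarrow> x c = x' c) \<Longrightarrow> site_poly \<theta> C x = site_poly \<theta> C x'"
  unfolding site_poly_def by (intro sum.cong arg_cong2[of _ _ _ _ "(*)"] prod.cong refl) auto

section \<open>A priori bounds on messages\<close>

locale bounded_model =
  fixes D :: nat and lam :: real and \<theta> :: "nat \<Rightarrow> real"
  assumes D2: "D \<ge> 2" and lam: "lam > 0"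
    and \<theta>_bounds: "\<And>k. k \<le> D \<Longrightarrow> 1 / 2 \<le> \<theta> k \<and> \<theta> k \<le> 2"
begin

abbreviation "d \<equiv> D - 1"

text \<open>Neighbouring values of \<theta> differ by a factor of at most 4, so ratios lie between
  1/4 and 4, and \<open>site_poly\<close> lies between 1/2 and \<open>2 * (1 + x_max) ^ d\<close>.
  Inserting these extremes into \<open>x_next\<close> gives both constants. They depend on
  \<open>lam\<close> and \<open>D\<close> only, hence are common to all admissible \<theta>.\<close>

definition "x_max = 2 * lam * 4 ^ d"
definition "x_min = lam / (4 ^ d * (2 * (1 + x_max) ^ d))"

abbreviation "S \<equiv> offspring_poly d \<theta>"
abbreviation "T \<equiv> offspring_poly d (\<lambda>k. \<theta> (Suc k))"

definition "y_ratio C x = site_poly (\<lambda>k. \<theta> (Suc k)) C x / site_poly \<theta> C x"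
definition "x_next C x y = lam * (\<Prod>c\<in>C. y c) / site_poly \<theta> C x"

lemma \<theta>_pos: "k \<le> D \<Longrightarrow> \<theta> k > 0"
  using \<theta>_bounds[of k] by simp

lemma x_max_pos: "x_max > 0" using lam by (simp add: x_max_def)
lemma x_min_pos: "x_min > 0" using lam x_max_pos by (simp add: x_min_def)

lemma x_min_le_max: "x_min \<le> x_max"
proof -
  have "1 \<le> (4::real) ^ d * (2 * (1 + x_max) ^ d)"
  proof -
    have "1 \<le> (1 + x_max) ^ d" using x_max_pos by (intro one_le_power) simp
    then have "1 \<le> 2 * (1 + x_max) ^ d" by linarith
    moreover have "1 \<le> (4::real) ^ d" by (rule one_le_power) simp
    ultimately show ?thesis using mult_mono[of 1 "(4::real) ^ d" 1 "2 * (1 + x_max) ^ d"] by simp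
  qed
  then have "x_min \<le> lam" unfolding x_min_def using lam by (simp add: field_simps)
  also have "lam \<le> lam * (2 * 4 ^ d)"
  proof -
    have "1 \<le> (4::real) ^ d" by (rule one_le_power) simp
    then have "1 \<le> 2 * (4::real) ^ d" by linarith
    then show ?thesis using mult_left_mono[of 1 "2 * 4 ^ d" lam] lam by simp
  qed
  finally show ?thesis by (simp add: x_max_def mult_ac)
qed

text \<open>All coefficients are positive, so the bounds on \<theta> transfer coefficient by
  coefficient, against the constant polynomial coefficients 1/2 and against the shifted sequence
  times 4.\<close>

lemma E_bounds:
  assumes C: "finite C" "card C = d" and x: "\<And>c. c \<in> C \<Longrightarrow> 0 \<le> x c"
  shows "site_poly \<theta> C x \<ge> 1 / 2" and "site_poly (\<lambda>k. \<theta> (Suc k)) C x > 0"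
    and "1 / 4 \<le> y_ratio C x" and "y_ratio C x \<le> 4"
proof -
  have \<theta>d: "1 / 2 \<le> \<theta> k \<and> \<theta> k \<le> 2" "1 / 2 \<le> \<theta> (Suc k) \<and> \<theta> (Suc k) \<le> 2" if "k \<le> d" for k
    using \<theta>_bounds[of k] \<theta>_bounds[of "Suc k"] that D2 by auto
  have one: "(1::real) \<le> (\<Prod>c\<in>C. 1 + x c)" using x by (intro prod_ge_1) auto
  have "site_poly (\<lambda>_. 1 / 2 * 1) C x \<le> site_poly \<theta> C x"
    using \<theta>d C x by (intro site_poly_mono) auto
  then show half: "site_poly \<theta> C x \<ge> 1 / 2"
    unfolding site_poly_cmult site_poly_one[OF C(1)] using one by simp
  show Tpos: "site_poly (\<lambda>k. \<theta> (Suc k)) C x > 0"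
    using C \<theta>d(2) x by (intro site_poly_pos) (auto intro: less_le_trans[of 0 "1/2"])
  have "site_poly (\<lambda>k. \<theta> (Suc k)) C x \<le> site_poly (\<lambda>k. 4 * \<theta> k) C x"
    by (rule site_poly_mono) (use \<theta>d C x in \<open>force+\<close>)
  then have "site_poly (\<lambda>k. \<theta> (Suc k)) C x \<le> 4 * site_poly \<theta> C x" by (simp add: site_poly_cmult)
  then show "y_ratio C x \<le> 4" using half by (simp add: y_ratio_def divide_simps)
  have "site_poly \<theta> C x \<le> site_poly (\<lambda>k. 4 * \<theta> (Suc k)) C x"
    by (rule site_poly_mono) (use \<theta>d C x in \<open>force+\<close>)
  then have "site_poly \<theta> C x \<le> 4 * site_poly (\<lambda>k. \<theta> (Suc k)) C x" by (simp add: site_poly_cmult)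
  then show "1 / 4 \<le> y_ratio C x" using half by (simp add: y_ratio_def divide_simps)
qed

lemma x_next_bounds:
  assumes C: "finite C" "card C = d" and x: "\<And>c. c \<in> C \<Longrightarrow> x c \<in> {0..x_max}"
    and y: "\<And>c. c \<in> C \<Longrightarrow> y c \<in> {1 / 4..4}"
  shows "x_next C x y \<in> {x_min..x_max}"
proof -
  have x0: "\<And>c. c \<in> C \<Longrightarrow> 0 \<le> x c" using x by auto
  have y4: "(\<Prod>c\<in>C. y c) \<le> 4 ^ d"
    using prod_mono[of C y "\<lambda>_. 4"] y C by (auto simp: order_trans[of 0 "1/4"])
  have y14: "(1 / 4) ^ d \<le> (\<Prod>c\<in>C. y c)"
    using prod_mono[of C "\<lambda>_. 1 / 4" y] y C by auto
  have E: "site_poly \<theta> C x \<ge> 1 / 2" by (rule E_bounds(1)[OF C x0])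
  have "site_poly \<theta> C x \<le> site_poly (\<lambda>_. 2 * 1) C (\<lambda>_. x_max)"
    using C x \<theta>_bounds \<theta>_pos by (intro site_poly_mono) (auto simp: less_imp_le)
  also have "\<dots> = 2 * (1 + x_max) ^ d"
    unfolding site_poly_cmult site_poly_one[OF C(1)] using C by simp
  finally have E2: "site_poly \<theta> C x \<le> 2 * (1 + x_max) ^ d" .
  have "x_next C x y \<le> lam * 4 ^ d / (1 / 2)"
    unfolding x_next_def using lam y4 E by (intro frac_le mult_left_mono) auto
  moreover have "lam * (1 / 4) ^ d / (2 * (1 + x_max) ^ d) \<le> x_next C x y"
    unfolding x_next_def using lam y14 E E2 order_trans[OF _ y14]
    by (intro frac_le mult_left_mono) (auto intro!: mult_nonneg_nonneg)
  ultimately show ?thesis by (simp add: x_max_def x_min_def power_one_over field_simps)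
qed

text \<open>\<open>k\<close> counts the levels already passed: the value at \<open>v\<close> is
  computed from data \<open>x\<close>, \<open>y\<close> placed \<open>k\<close> levels below
  \<open>v\<close>.\<close>

primrec messages :: "(nat list \<Rightarrow> real) \<Rightarrow> (nat list \<Rightarrow> real) \<Rightarrow> nat \<Rightarrow> nat list \<Rightarrow> real \<times> real" where
  "messages x y 0 v = (x v, y v)"
| "messages x y (Suc k) v =
     (x_next (children D v) (\<lambda>c. fst (messages x y k c)) (\<lambda>c. snd (messages x y k c)),
      y_ratio (children D v) (\<lambda>c. fst (messages x y k c)))"

abbreviation "mx x y k v \<equiv> fst (messages x y k v)"
abbreviation "my x y k v \<equiv> snd (messages x y k v)"

lemma card_children': "v \<noteq> [] \<Longrightarrow> card (children D v) = d"
  by (simp add: card_children)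

lemma children_not_Nil: "c \<in> children D v \<Longrightarrow> c \<noteq> []"
  by (auto simp: children_def)

text \<open>The initial odds may be 0, when the boundary condition forbids occupation. The lower
  bound \<open>x_min\<close> is therefore available only after one level.\<close>

lemma messages_bounds0:
  assumes xy: "\<And>v. x v \<in> {0..x_max}" "\<And>v. y v \<in> {1 / 4..4}" and v: "v \<noteq> []"
  shows "mx x y k v \<in> {0..x_max} \<and> my x y k v \<in> {1 / 4..4}"
  using v
proof (induction k arbitrary: v)
  case 0
  show ?case using xy by simp
next
  case (Suc k)
  have IH: "mx x y k c \<in> {0..x_max}" "my x y k c \<in> {1 / 4..4}" if "c \<in> children D v" for c
    using Suc.IH[OF children_not_Nil[OF that]] by auto
  have "x_next (children D v) (mx x y k) (my x y k) \<in> {x_min..x_max}"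
    by (rule x_next_bounds) (use IH Suc.prems card_children' in auto)
  moreover have "y_ratio (children D v) (mx x y k) \<in> {1 / 4..4}"
    using E_bounds(3,4)[of "children D v" "mx x y k"] IH Suc.prems card_children' by auto
  ultimately show ?case using x_min_pos by simp
qed

lemma messages_bounds:
  assumes xy: "\<And>v. x v \<in> {0..x_max}" "\<And>v. y v \<in> {1 / 4..4}" and v: "v \<noteq> []" and k: "k \<ge> 1"
  shows "mx x y k v \<in> {x_min..x_max}"
proof (cases k)
  case (Suc k')
  have IH: "mx x y k' c \<in> {0..x_max}" "my x y k' c \<in> {1 / 4..4}" if "c \<in> children D v" for c
    using messages_bounds0[OF xy children_not_Nil[OF that]] by auto
  have "x_next (children D v) (mx x y k') (my x y k') \<in> {x_min..x_max}"
    by (rule x_next_bounds) (use IH v card_children' in auto)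
  then show ?thesis by (simp add: Suc)
qed (use k in simp)

lemma pass_up_messages:
  assumes xy: "\<And>v. x v \<in> {0..x_max}" "\<And>v. y v \<in> {1 / 4..4}"
    and msg: "\<And>v p s. v \<in> layer D n \<Longrightarrow> p \<le> 1 \<Longrightarrow> s \<le> 1 \<Longrightarrow> msg v p s = edge_msg (z v) (x v) (y v) p s"
    and z: "\<And>v. v \<in> layer D n \<Longrightarrow> z v > 0"
    and m: "m \<ge> 1" "n = m + k"
  shows "\<exists>z'. (\<forall>v\<in>layer D m. z' v > 0 \<and> (\<forall>p\<le>1. \<forall>s\<le>1.
     (pass_up D lam \<theta> ^^ k) msg v p s = edge_msg (z' v) (mx x y k v) (my x y k v) p s))"
  using m
proof (induction k arbitrary: m)
  case 0
  then show ?case using msg z by (intro exI[of _ z]) auto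
next
  case (Suc k)
  obtain z' where z': "\<And>v. v \<in> layer D (Suc m) \<Longrightarrow> z' v > 0"
    "\<And>v p s. v \<in> layer D (Suc m) \<Longrightarrow> p \<le> 1 \<Longrightarrow> s \<le> 1 \<Longrightarrow>
       (pass_up D lam \<theta> ^^ k) msg v p s = edge_msg (z' v) (mx x y k v) (my x y k v) p s"
    using Suc.IH[of "Suc m"] Suc.prems by auto
  have child: "c \<in> layer D (Suc m)" if "v \<in> layer D m" "c \<in> children D v" for v c
    using that by (auto simp: layer_Suc)
  define w where "w v = (\<Prod>c\<in>children D v. z' c) * site_poly \<theta> (children D v) (mx x y k)" for v
  have "w v > 0 \<and> (\<forall>p\<le>1. \<forall>s\<le>1. (pass_up D lam \<theta> ^^ Suc k) msg v p s = edge_msg (w v) (mx x y (Suc k) v) (my x y (Suc k) v) p s)"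
    if v: "v \<in> layer D m" for v
  proof -
    have nn: "v \<noteq> []" using v Suc.prems by (auto simp: layer_def)
    have "mx x y k c \<ge> 0" if "c \<in> children D v" for c
      using messages_bounds0[OF xy children_not_Nil[OF that]] by auto
    then have E: "site_poly \<theta> (children D v) (mx x y k) > 0"
      using E_bounds(1)[of "children D v" "mx x y k"] card_children'[OF nn] by auto
    have "w v > 0" unfolding w_def using E z'(1) child[OF v] by (intro mult_pos_pos prod_pos) auto
    moreover have "(pass_up D lam \<theta> ^^ Suc k) msg v p s = edge_msg (w v) (mx x y (Suc k) v) (my x y (Suc k) v) p s"
      if "p \<le> 1" "s \<le> 1" for p s
      using pass_up_edge_msg[of D v "(pass_up D lam \<theta> ^^ k) msg" z' "mx x y k" "my x y k" \<theta> p s lam] E z'(2) child[OF v] that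
      by (simp add: w_def x_next_def y_ratio_def)
    ultimately show ?thesis by blast
  qed
  then show ?case by blast
qed

section \<open>Boundary conditions as messages\<close>

definition "edge_weight m x y \<omega> = tree_weight D lam \<theta> m (\<lambda>v. edge_msg 1 (x v) (y v)) \<omega>"

text \<open>Outside a ball the boundary consists of the next two layers. The local weights that see
  it are those of the outermost vertices and of their children, and exactly these are collected
  here.\<close>

definition "boundary_msg \<eta> v p s =
  vertex_weight lam \<theta> p s (\<Sum>c\<in>children D v. \<eta> c) *
  (\<Prod>c\<in>children D v. vertex_weight lam \<theta> s (\<eta> c) (\<Sum>e\<in>children D c. \<eta> e))"

lemma boltzmann_ball:
  assumes n: "n \<ge> 1" and \<nu>: "\<nu> \<in> configs (ball_tree D n)" and \<eta>: "\<eta> \<in> configs (boundary D (ball_tree D n))"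
  shows "boltzmann (hamiltonian D lam \<theta> (ball_tree D n) (merge (ball_tree D n) (boundary D (ball_tree D n)) (\<nu>, \<eta>))) =
    tree_weight D lam \<theta> n (boundary_msg \<eta>) \<nu>"
proof -
  let ?B = "ball_tree D n" and ?d = "boundary D (ball_tree D n)"
  define \<xi> where "\<xi> = merge ?B ?d (\<nu>, \<eta>)"
  have \<xi>\<nu>: "\<xi> v = \<nu> v" if "v \<in> ?B" for v using that by (simp add: \<xi>_def merge_def)
  have \<xi>\<eta>: "\<xi> v = \<eta> v" if "v \<in> ?d" for v using that boundary_disjoint[of ?B D] by (auto simp: \<xi>_def merge_def)
  have \<xi>: "\<xi> \<in> configs (?B \<union> ?d)" unfolding \<xi>_def by (rule merge_configs[OF \<nu> \<eta>])
  have I: "{i \<in> tree D. nbhd D i \<inter> ?B \<noteq> {}} = {v \<in> tree D. length v < n} \<union> layer D n \<union> layer D (Suc n)"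
  proof (intro set_eqI iffI)
    fix i assume "i \<in> {i \<in> tree D. nbhd D i \<inter> ?B \<noteq> {}}"
    then obtain j where j: "i \<in> tree D" "j \<in> nbhd D i" "j \<in> ?B" by auto
    then show "i \<in> {v \<in> tree D. length v < n} \<union> layer D n \<union> layer D (Suc n)"
      using nbhd_length[of j D i] nbhd_sym[of j D i] by (auto simp: ball_tree_def layer_def)
  next
    fix i assume i: "i \<in> {v \<in> tree D. length v < n} \<union> layer D n \<union> layer D (Suc n)"
    then have it: "i \<in> tree D" by (auto simp: layer_def)
    show "i \<in> {i \<in> tree D. nbhd D i \<inter> ?B \<noteq> {}}"
    proof (cases "length i \<le> n")
      case True
      then have "i \<in> nbhd D i \<inter> ?B" using it by (auto simp: nbhd_def ball_tree_def)
      then show ?thesis using it by auto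
    next
      case False
      then have "tl i \<in> nbhd D i \<inter> ?B"
        using it i tl_mem_tree[OF it] by (auto simp: nbhd_eq ball_tree_def layer_def)
      then show ?thesis using it by auto
    qed
  qed
  have near: "nbhd D i \<subseteq> ?B \<union> ?d" if "i \<in> layer D (Suc n)" for i
    using nbhd_meets_subset[of D i ?B] that I ball_tree_subset by blast
  have outer: "c \<in> ?d" "\<And>e. e \<in> children D c \<Longrightarrow> e \<in> ?d" if c: "c \<in> layer D (Suc n)" for c
  proof -
    have ct: "c \<in> tree D" "length c = Suc n" "c \<noteq> []" using c by (auto simp: layer_def)
    then show "c \<in> ?d" using near[OF c] by (auto simp: nbhd_eq ball_tree_def)
    fix e assume e: "e \<in> children D c"
    then have "e \<in> nbhd D c" using ct by (auto simp: nbhd_eq)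
    moreover have "e \<notin> ?B" using e ct by (auto simp: children_def ball_tree_def)
    ultimately show "e \<in> ?d" using near[OF c] by auto
  qed
  have child: "c \<in> layer D (Suc n)" "tl c = v" if "v \<in> layer D n" "c \<in> children D v" for v c
  proof -
    show "c \<in> layer D (Suc n)" unfolding layer_Suc using that by blast
    show "tl c = v" using that(2) by (auto simp: children_def)
  qed
  have "boltzmann (hamiltonian D lam \<theta> ?B \<xi>) = (\<Prod>i\<in>{i \<in> tree D. nbhd D i \<inter> ?B \<noteq> {}}. site_weight D lam \<theta> \<xi> i)"
  proof (rule boltzmann_hamiltonian)
    show "\<And>k. k \<le> D \<Longrightarrow> 0 < \<theta> k" by (rule \<theta>_pos)
    show "\<And>j. j \<in> ?B \<union> ?d \<Longrightarrow> \<xi> j \<in> {0, 1}" by (rule configs_range[OF \<xi>])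
  qed (use D2 lam ball_tree_subset in auto)
  also have "\<dots> = (\<Prod>v\<in>{v \<in> tree D. length v < n}. site_weight D lam \<theta> \<xi> v) *
      (\<Prod>v\<in>layer D n. site_weight D lam \<theta> \<xi> v) * (\<Prod>v\<in>layer D (Suc n). site_weight D lam \<theta> \<xi> v)"
  proof -
    have "{v \<in> tree D. length v < n} \<inter> layer D n = {}" "({v \<in> tree D. length v < n} \<union> layer D n) \<inter> layer D (Suc n) = {}"
      by (auto simp: layer_def)
    then show ?thesis unfolding I by (simp add: prod.union_disjoint)
  qed
  also have "(\<Prod>v\<in>{v \<in> tree D. length v < n}. site_weight D lam \<theta> \<xi> v) = (\<Prod>v\<in>{v \<in> tree D. length v < n}. site_weight D lam \<theta> \<nu> v)"
  proof (rule prod.cong[OF refl], rule site_weight_cong)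
    fix v j assume "v \<in> {v \<in> tree D. length v < n}" "j \<in> nbhd D v"
    then show "\<xi> j = \<nu> j" using nbhd_length[of v D j] by (intro \<xi>\<nu>) (auto simp: ball_tree_def)
  qed auto
  also have "(\<Prod>v\<in>layer D n. site_weight D lam \<theta> \<xi> v) =
      (\<Prod>v\<in>layer D n. vertex_weight lam \<theta> (\<nu> (tl v)) (\<nu> v) (\<Sum>c\<in>children D v. \<eta> c))"
  proof (rule prod.cong[OF refl])
    fix v assume v: "v \<in> layer D n"
    have "v \<noteq> []" "v \<in> ?B" "tl v \<in> ?B" using v n tl_mem_tree[of v D] by (auto simp: layer_def ball_tree_def)
    moreover have "(\<Sum>c\<in>children D v. \<xi> c) = (\<Sum>c\<in>children D v. \<eta> c)"
      by (rule sum.cong[OF refl], rule \<xi>\<eta>, rule outer(1), rule child(1)[OF v])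
    ultimately show "site_weight D lam \<theta> \<xi> v = vertex_weight lam \<theta> (\<nu> (tl v)) (\<nu> v) (\<Sum>c\<in>children D v. \<eta> c)"
      by (simp add: site_weight_def \<xi>\<nu>)
  qed
  also have "(\<Prod>v\<in>layer D (Suc n). site_weight D lam \<theta> \<xi> v) =
      (\<Prod>v\<in>layer D n. \<Prod>c\<in>children D v. site_weight D lam \<theta> \<xi> c)"
    unfolding layer_Suc by (rule prod.UNION_disjoint) (auto simp: children_def)
  also have "\<dots> = (\<Prod>v\<in>layer D n. \<Prod>c\<in>children D v. vertex_weight lam \<theta> (\<nu> v) (\<eta> c) (\<Sum>e\<in>children D c. \<eta> e))"
  proof (intro prod.cong refl)
    fix v c assume v: "v \<in> layer D n" and c: "c \<in> children D v"
    have "v \<in> ?B" using v by (auto simp: layer_def ball_tree_def)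
    moreover have "(\<Sum>e\<in>children D c. \<xi> e) = (\<Sum>e\<in>children D c. \<eta> e)"
      by (rule sum.cong[OF refl], rule \<xi>\<eta>, rule outer(2)[OF child(1)[OF v c]])
    ultimately show "site_weight D lam \<theta> \<xi> c = vertex_weight lam \<theta> (\<nu> v) (\<eta> c) (\<Sum>e\<in>children D c. \<eta> e)"
      using children_not_Nil[OF c] child[OF v c] outer(1)[OF child(1)[OF v c]]
      by (simp add: site_weight_def \<xi>\<nu> \<xi>\<eta>)
  qed
  finally show ?thesis
    by (simp add: \<xi>_def tree_weight_def boundary_msg_def prod.distrib mult.assoc)
qed

text \<open>An occupied child of \<open>v\<close> forces odds 0. Otherwise the odds are
  \<open>lam\<close> times a product of quotients of neighbouring values of \<theta>, one per child,
  divided by \<open>\<theta> 0\<close>.\<close>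

lemma boundary_msg_edge:
  assumes n: "n \<ge> 1" and \<eta>: "\<eta> \<in> hardcore D (boundary D (ball_tree D n))" and v: "v \<in> layer D n"
  shows "\<exists>z x y. z > 0 \<and> x \<in> {0..x_max} \<and> y \<in> {1 / 4..4} \<and>
    (\<forall>p\<le>1. \<forall>s\<le>1. boundary_msg \<eta> v p s = edge_msg z x y p s)"
proof -
  let ?B = "ball_tree D n" and ?d = "boundary D (ball_tree D n)" and ?C = "children D v"
  have nn: "v \<noteq> []" "v \<in> tree D" using v n by (auto simp: layer_def)
  have \<eta>c: "\<eta> \<in> configs ?d" using \<eta> by (auto simp: hardcore_def)
  have outer: "c \<in> ?d" "\<And>e. e \<in> children D c \<Longrightarrow> e \<in> ?d \<and> tree_adj D c e" if c: "c \<in> ?C" for c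
  proof -
    have cl: "c \<in> layer D (Suc n)" using v c by (auto simp: layer_Suc)
    have ct: "c \<in> tree D" "length c = Suc n" "c \<noteq> []" using cl by (auto simp: layer_def)
    have "tl c \<in> nbhd D c \<inter> ?B" using ct tl_mem_tree[of c D] by (auto simp: nbhd_eq ball_tree_def)
    then have near: "nbhd D c \<subseteq> ?B \<union> ?d" by (intro nbhd_meets_subset) (auto simp: ball_tree_def)
    show "c \<in> ?d" using near ct by (auto simp: nbhd_eq ball_tree_def)
    fix e assume e: "e \<in> children D c"
    have "e \<in> nbhd D c" "e \<notin> ?B" using e ct by (auto simp: nbhd_eq children_def ball_tree_def)
    moreover have "tree_adj D c e" using e ct mem_children_iff[OF ct(1), of e]
      by (auto simp: tree_adj_def children_def)
    ultimately show "e \<in> ?d \<and> tree_adj D c e" using near by auto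
  qed
  define k where "k = (\<Sum>c\<in>?C. \<eta> c)"
  define kc where "kc c = (\<Sum>e\<in>children D c. \<eta> e)" for c
  have \<eta>01: "\<eta> c \<in> {0, 1}" if "c \<in> ?C" for c using configs_range[OF \<eta>c outer(1)[OF that]] .
  have k_le: "k \<le> d"
  proof -
    have "k \<le> (\<Sum>c\<in>?C. 1)" unfolding k_def using \<eta>01 by (intro sum_mono) force
    then show ?thesis using card_children'[OF nn(1)] by simp
  qed
  have kc_le: "kc c \<le> d" if c: "c \<in> ?C" for c
  proof -
    have "kc c \<le> (\<Sum>e\<in>children D c. 1)" unfolding kc_def
      using configs_range[OF \<eta>c] outer(2)[OF c] by (intro sum_mono) force
    then show ?thesis using card_children'[OF children_not_Nil[OF c]] by simp
  qed
  \<comment> \<open>Exclusion inside \<eta> enters here: an occupied child with an occupied child of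
    its own would have weight 0 and make the scale \<open>z\<close> vanish.\<close>
  have kc0: "kc c = 0" if c: "c \<in> ?C" "\<eta> c = 1" for c
  proof -
    have "\<eta> e = 0" if e: "e \<in> children D c" for e
      using \<eta> outer[OF c(1)] e c(2) configs_range[OF \<eta>c, of e] by (auto simp: hardcore_def)
    then show ?thesis by (simp add: kc_def)
  qed
  have \<theta>k: "1 / 2 \<le> \<theta> j \<and> \<theta> j \<le> 2" "1 / 2 \<le> \<theta> (Suc j) \<and> \<theta> (Suc j) \<le> 2" if "j \<le> d" for j
    using \<theta>_bounds[of j] \<theta>_bounds[of "Suc j"] that D2 by auto
  define w where "w c = (if \<eta> c = 1 then lam else \<theta> (kc c))" for c
  have w_pos: "w c > 0" if "c \<in> ?C" for c
    using lam \<theta>k(1)[OF kc_le[OF that]] by (auto simp: w_def)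
  define P where "P = (\<Prod>c\<in>?C. w c)"
  have P: "P > 0" unfolding P_def using w_pos by (intro prod_pos) auto
  have s0: "boundary_msg \<eta> v p 0 = \<theta> (p + k) * P" for p
  proof -
    have "(\<Prod>c\<in>?C. vertex_weight lam \<theta> 0 (\<eta> c) (kc c)) = P"
      unfolding P_def by (rule prod.cong[OF refl]) (use \<eta>01 kc0 in \<open>force simp: vertex_weight_def w_def\<close>)
    then show ?thesis by (simp add: boundary_msg_def k_def kc_def vertex_weight_def)
  qed
  define Q where "Q = (\<Prod>c\<in>?C. \<theta> (Suc (kc c)))"
  have s1: "boundary_msg \<eta> v p 1 = (if p = 0 \<and> k = 0 then lam * Q else 0)" for p
  proof (cases "p = 0 \<and> k = 0")
    case True
    then have "\<eta> c = 0" if "c \<in> ?C" for c using that by (auto simp: k_def)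
    then have "(\<Prod>c\<in>?C. vertex_weight lam \<theta> 1 (\<eta> c) (kc c)) = Q"
      unfolding Q_def by (intro prod.cong refl) (auto simp: vertex_weight_def)
    then show ?thesis using True by (simp add: boundary_msg_def k_def kc_def vertex_weight_def)
  qed (auto simp: boundary_msg_def k_def vertex_weight_def)
  define z where "z = \<theta> k * P"
  define x where "x = (if k = 0 then lam * Q else 0) / z"
  define y where "y = \<theta> (Suc k) / \<theta> k"
  have \<theta>k0: "\<theta> k > 0" using \<theta>k(1)[OF k_le] by simp
  have z: "z > 0" using \<theta>k0 P by (simp add: z_def)
  have "Q \<ge> 0" unfolding Q_def using \<theta>k(2)[OF kc_le] by (intro prod_nonneg) (auto intro: order_trans[of 0 "1/2"])
  then have x0: "x \<ge> 0" using z lam by (simp add: x_def)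
  have "x \<le> x_max"
  proof (cases "k = 0")
    case True
    then have e0: "\<eta> c = 0" if "c \<in> ?C" for c using that by (auto simp: k_def)
    \<comment> \<open>An empty child exchanges its factor in \<open>P\<close> for the next value of
      \<theta>, at most 4 times as large. Together with \<open>1 \<le> 2 * \<theta> 0\<close> this
      reproduces the constant \<open>x_max\<close>.\<close>
    have "Q \<le> (\<Prod>c\<in>?C. 4 * w c)"
      unfolding Q_def
    proof (rule prod_mono)
      fix c assume c: "c \<in> ?C"
      show "0 \<le> \<theta> (Suc (kc c)) \<and> \<theta> (Suc (kc c)) \<le> 4 * w c"
        using \<theta>k[OF kc_le[OF c]] e0[OF c] by (auto simp: w_def)
    qed
    also have "\<dots> = 4 ^ d * P" using card_children'[OF nn(1)] by (simp add: P_def prod.distrib)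
    finally have "lam * Q \<le> lam * (4 ^ d * P)" using lam by simp
    also have "\<dots> \<le> lam * (4 ^ d * P) * (2 * \<theta> 0)"
      using mult_left_mono[of 1 "2 * \<theta> 0" "lam * (4 ^ d * P)"] \<theta>_bounds[of 0] lam P by simp
    finally have "lam * Q \<le> x_max * z" using True by (simp add: x_max_def z_def mult_ac)
    then show ?thesis using z True by (simp add: x_def divide_le_eq)
  qed (use x_max_pos in \<open>simp add: x_def\<close>)
  moreover have "y \<in> {1 / 4..4}"
    using \<theta>k[OF k_le] by (auto simp: y_def field_simps)
  moreover have "boundary_msg \<eta> v p s = edge_msg z x y p s" if "p \<le> 1" "s \<le> 1" for p s
  proof (cases "s = 0")
    case True
    then show ?thesis using that s0[of p] \<theta>k0 z by (cases "p = 0") (auto simp: edge_msg_def z_def y_def le_Suc_eq)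
  next
    case False
    then have "s = 1" using that by simp
    then show ?thesis using s1[of p] z by (auto simp: edge_msg_def x_def)
  qed
  ultimately show ?thesis using z x0 by (intro exI[of _ z] exI[of _ x] exI[of _ y]) auto
qed

end

section \<open>Convergence of finite-volume probabilities\<close>

context bounded_model
begin

text \<open>The scales of the messages do not depend on the inner configuration, so their product
  leaves the sum and cancels in the quotient. Only odds and ratios remain to be controlled.\<close>

lemma finite_prob_messages:
  assumes m: "m \<ge> 1" "m \<le> n" and \<eta>: "\<eta> \<in> hardcore D (boundary D (ball_tree D n))"
  shows "\<exists>x y. (\<forall>v. x v \<in> {0..x_max}) \<and> (\<forall>v. y v \<in> {1 / 4..4}) \<and>
    (\<forall>\<omega>\<in>configs (ball_tree D m). finite_prob D lam \<theta> (ball_tree D n) (ball_tree D m) \<omega> \<eta> =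
      edge_weight m (mx x y (n - m)) (my x y (n - m)) \<omega> /
      (\<Sum>\<omega>'\<in>configs (ball_tree D m). edge_weight m (mx x y (n - m)) (my x y (n - m)) \<omega>'))"
proof -
  have n: "n \<ge> 1" using m by simp
  have \<eta>c: "\<eta> \<in> configs (boundary D (ball_tree D n))" using \<eta> by (auto simp: hardcore_def)
  have "\<forall>v. \<exists>q. case q of (z, x, y) \<Rightarrow> x \<in> {0..x_max} \<and> y \<in> {1 / 4..4} \<and> (v \<in> layer D n \<longrightarrow> z > 0 \<and>
      (\<forall>p\<le>1. \<forall>s\<le>1. boundary_msg \<eta> v p s = edge_msg z x y p s))"
  proof
    fix v
    show "\<exists>q. case q of (z, x, y) \<Rightarrow> x \<in> {0..x_max} \<and> y \<in> {1 / 4..4} \<and> (v \<in> layer D n \<longrightarrow> z > 0 \<and>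
      (\<forall>p\<le>1. \<forall>s\<le>1. boundary_msg \<eta> v p s = edge_msg z x y p s))"
    proof (cases "v \<in> layer D n")
      case True
      from boundary_msg_edge[OF n \<eta> this] show ?thesis by auto
    next
      case False
      \<comment> \<open>Away from layer \<open>n\<close> any values in the prescribed ranges will
        do.\<close>
      then show ?thesis using x_max_pos by (intro exI[of _ "(1, 0, 1)"]) auto
    qed
  qed
  from choice[OF this] obtain q where q: "\<forall>v. case q v of (z, x, y) \<Rightarrow> x \<in> {0..x_max} \<and> y \<in> {1 / 4..4} \<and> (v \<in> layer D n \<longrightarrow> z > 0 \<and>
      (\<forall>p\<le>1. \<forall>s\<le>1. boundary_msg \<eta> v p s = edge_msg z x y p s))"
    by blast
  define z where "z v = fst (q v)" for v
  define x where "x v = fst (snd (q v))" for v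
  define y where "y v = snd (snd (q v))" for v
  have xy: "\<And>v. x v \<in> {0..x_max}" "\<And>v. y v \<in> {1 / 4..4}"
    and zp: "\<And>v. v \<in> layer D n \<Longrightarrow> z v > 0"
    and msg: "\<And>v p s. v \<in> layer D n \<Longrightarrow> p \<le> 1 \<Longrightarrow> s \<le> 1 \<Longrightarrow> boundary_msg \<eta> v p s = edge_msg (z v) (x v) (y v) p s"
    using q by (simp_all add: z_def x_def y_def case_prod_unfold del: atLeastAtMost_iff)
  have "\<exists>z'. \<forall>v\<in>layer D m. z' v > 0 \<and> (\<forall>p\<le>1. \<forall>s\<le>1. (pass_up D lam \<theta> ^^ (n - m)) (boundary_msg \<eta>) v p s =
      edge_msg (z' v) (mx x y (n - m) v) (my x y (n - m) v) p s)"
  proof (rule pass_up_messages[where n = n and z = z])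
    show "\<And>v. x v \<in> {0..x_max}" "\<And>v. y v \<in> {1 / 4..4}" by (rule xy)+
    show "\<And>v p s. v \<in> layer D n \<Longrightarrow> p \<le> 1 \<Longrightarrow> s \<le> 1 \<Longrightarrow> boundary_msg \<eta> v p s = edge_msg (z v) (x v) (y v) p s"
      by (rule msg)
    show "\<And>v. v \<in> layer D n \<Longrightarrow> z v > 0" by (rule zp)
  qed (use m in auto)
  then obtain z' where z': "\<And>v. v \<in> layer D m \<Longrightarrow> z' v > 0"
    "\<And>v p s. v \<in> layer D m \<Longrightarrow> p \<le> 1 \<Longrightarrow> s \<le> 1 \<Longrightarrow> (pass_up D lam \<theta> ^^ (n - m)) (boundary_msg \<eta>) v p s =
      edge_msg (z' v) (mx x y (n - m) v) (my x y (n - m) v) p s"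
    by blast
  define Pz where "Pz = (\<Prod>v\<in>layer D m. z' v)"
  have Pz: "Pz > 0" unfolding Pz_def using z' by (intro prod_pos) auto
  let ?W = "edge_weight m (mx x y (n - m)) (my x y (n - m))"
  define G where "G \<nu> = boltzmann (hamiltonian D lam \<theta> (ball_tree D n) (merge (ball_tree D n) (boundary D (ball_tree D n)) (\<nu>, \<eta>)))" for \<nu>
  have num: "(\<Sum>\<nu>\<in>{\<nu> \<in> configs (ball_tree D n). restrict \<nu> (ball_tree D m) = \<omega>}. G \<nu>) = Pz * ?W \<omega>"
    if \<omega>: "\<omega> \<in> configs (ball_tree D m)" for \<omega>
  proof -
    have "(\<Sum>\<nu>\<in>{\<nu> \<in> configs (ball_tree D n). restrict \<nu> (ball_tree D m) = \<omega>}. G \<nu>) =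
        (\<Sum>\<nu>\<in>{\<nu> \<in> configs (ball_tree D (m + (n - m))). restrict \<nu> (ball_tree D m) = \<omega>}. tree_weight D lam \<theta> (m + (n - m)) (boundary_msg \<eta>) \<nu>)"
      unfolding G_def using m boltzmann_ball[OF n _ \<eta>c] by (intro sum.cong) auto
    also have "\<dots> = tree_weight D lam \<theta> m ((pass_up D lam \<theta> ^^ (n - m)) (boundary_msg \<eta>)) \<omega>"
      by (rule sum_tree_weight[OF m(1) \<omega>])
    also have "\<dots> = Pz * ?W \<omega>"
      unfolding Pz_def edge_weight_def
    proof (rule tree_weight_scale[OF m(1) \<omega>])
      fix v p s assume v: "v \<in> layer D m" "p \<le> (1::nat)" "s \<le> (1::nat)"
      show "(pass_up D lam \<theta> ^^ (n - m)) (boundary_msg \<eta>) v p s = z' v * edge_msg 1 (mx x y (n - m) v) (my x y (n - m) v) p s"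
        unfolding z'(2)[OF v] by (rule edge_msg_scale)
    qed
    finally show ?thesis .
  qed
  have "(\<Sum>\<nu>\<in>configs (ball_tree D n). G \<nu>) =
      (\<Sum>\<omega>\<in>configs (ball_tree D m). \<Sum>\<nu>\<in>{\<nu> \<in> configs (ball_tree D n). restrict \<nu> (ball_tree D m) = \<omega>}. G \<nu>)"
    by (rule sum.group[symmetric]) (use configs_restrict[OF _ ball_tree_mono[OF m(2)]] in auto)
  also have "\<dots> = Pz * (\<Sum>\<omega>\<in>configs (ball_tree D m). ?W \<omega>)"
    unfolding sum_distrib_left by (rule sum.cong[OF refl num])
  finally have den: "(\<Sum>\<nu>\<in>configs (ball_tree D n). G \<nu>) = Pz * (\<Sum>\<omega>\<in>configs (ball_tree D m). ?W \<omega>)" .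
  have "\<forall>\<omega>\<in>configs (ball_tree D m). finite_prob D lam \<theta> (ball_tree D n) (ball_tree D m) \<omega> \<eta> = ?W \<omega> / (\<Sum>\<omega>'\<in>configs (ball_tree D m). ?W \<omega>')"
    unfolding finite_prob_def G_def[symmetric] den using num Pz by simp
  then show ?thesis using xy by blast
qed

lemma edge_weight_tendsto:
  assumes "\<And>v. v \<in> layer D m \<Longrightarrow> (\<lambda>i. x i v) \<longlonglongrightarrow> a" "\<And>v. v \<in> layer D m \<Longrightarrow> (\<lambda>i. y i v) \<longlonglongrightarrow> b"
  shows "(\<lambda>i. edge_weight m (x i) (y i) \<omega>) \<longlonglongrightarrow> edge_weight m (\<lambda>_. a) (\<lambda>_. b) \<omega>"
proof -
  have "(\<lambda>i. edge_msg 1 (x i v) (y i v) p s) \<longlonglongrightarrow> edge_msg 1 a b p s" if "v \<in> layer D m" for v p s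
    unfolding edge_msg_def using assms[OF that] by (cases "p = 0"; cases "s = 0") simp_all
  then show ?thesis
    unfolding edge_weight_def tree_weight_def by (intro tendsto_mult tendsto_const tendsto_prod)
qed

lemma edge_weight_total_pos:
  assumes "m \<ge> 1" "a \<ge> 0" "b \<ge> 0"
  shows "(\<Sum>\<omega>\<in>configs (ball_tree D m). edge_weight m (\<lambda>_. a) (\<lambda>_. b) \<omega>) > 0"
proof (rule sum_pos2[of _ "\<lambda>v\<in>ball_tree D m. 0"])
  show "0 < edge_weight m (\<lambda>_. a) (\<lambda>_. b) (\<lambda>v\<in>ball_tree D m. 0)"
    unfolding edge_weight_def tree_weight_zero_config[OF assms(1)] using \<theta>_pos[of 0]
    by (auto simp: edge_msg_def intro!: mult_pos_pos prod_pos)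
  fix \<omega> assume \<omega>: "\<omega> \<in> configs (ball_tree D m)"
  show "0 \<le> edge_weight m (\<lambda>_. a) (\<lambda>_. b) \<omega>"
    unfolding edge_weight_def
    by (rule tree_weight_nonneg[OF _ lam \<theta>_pos \<omega>]) (use D2 assms in \<open>auto simp: edge_msg_def\<close>)
qed (auto simp: zero_config)

lemma site_poly_const_d: "finite C \<Longrightarrow> card C = d \<Longrightarrow> site_poly \<theta>' C (\<lambda>_. a) = offspring_poly d \<theta>' a"
  by (simp add: site_poly_const offspring_poly_def)

lemma y_ratio_const: "finite C \<Longrightarrow> card C = d \<Longrightarrow> y_ratio C (\<lambda>_. a) = T a / S a"
  by (simp add: y_ratio_def site_poly_const_d)

lemma ST_pos:
  assumes "a \<ge> 0"
  shows "S a > 0" "T a > 0"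
  using assms D2 \<theta>_pos by (intro offspring_poly_pos; simp)+

abbreviation "xbox \<equiv> {x_min..x_max}"

text \<open>Two-sided iteration: if the messages below lie in \<open>[l, u]\<close>, then two levels higher they lie
  in \<open>[\<Phi> u l, \<Phi> l u]\<close>.  The limiting interval is a point, so the boundary is forgotten.\<close>

lemma uniqueness_by_squeezing:
  fixes \<Phi> :: "real \<Rightarrow> real \<Rightarrow> real"
  assumes cont: "continuous_on (xbox \<times> xbox) (\<lambda>z. \<Phi> (fst z) (snd z))"
    and mono: "\<And>a a' b b'. a \<in> xbox \<Longrightarrow> a' \<in> xbox \<Longrightarrow> b \<in> xbox \<Longrightarrow> b' \<in> xbox \<Longrightarrow> a \<le> a' \<Longrightarrow> b \<le> b' \<Longrightarrow> \<Phi> a' b \<le> \<Phi> a b'"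
    and range: "\<And>a b. a \<in> xbox \<Longrightarrow> b \<in> xbox \<Longrightarrow> \<Phi> a b \<in> xbox"
    and diag: "\<And>a. a \<in> xbox \<Longrightarrow> \<Phi> a a = lam * (T a / S a) ^ d / S a"
    and uniq: "\<And>l u. l \<in> xbox \<Longrightarrow> u \<in> xbox \<Longrightarrow> l = \<Phi> u l \<Longrightarrow> u = \<Phi> l u \<Longrightarrow> l = u"
    and step: "\<And>l u C x y. l \<in> xbox \<Longrightarrow> u \<in> xbox \<Longrightarrow> l \<le> u \<Longrightarrow> finite C \<Longrightarrow> card C = d \<Longrightarrow> (\<And>c. c \<in> C \<Longrightarrow> x c \<in> {l..u}) \<Longrightarrow>
       (\<And>c. c \<in> C \<Longrightarrow> y c \<in> {min (T l / S l) (T u / S u)..max (T l / S l) (T u / S u)}) \<Longrightarrow> x_next C x y \<in> {\<Phi> u l..\<Phi> l u}"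
    and ratio: "\<And>l u C x. l \<in> xbox \<Longrightarrow> u \<in> xbox \<Longrightarrow> l \<le> u \<Longrightarrow> finite C \<Longrightarrow> card C = d \<Longrightarrow> (\<And>c. c \<in> C \<Longrightarrow> x c \<in> {l..u}) \<Longrightarrow>
       y_ratio C x \<in> {min (T l / S l) (T u / S u)..max (T l / S l) (T u / S u)}"
  shows "uniqueness_regime D lam \<theta>"
proof -
  \<comment> \<open>Mixed monotone iteration: \<open>\<Phi>\<close> decreases in its first and
    increases in its second argument, so the intervals from \<open>l j\<close> to \<open>u j\<close>
    are nested.\<close>
  define lu where "lu j = ((\<lambda>(l, u). (\<Phi> u l, \<Phi> l u)) ^^ j) (x_min, x_max)" for j
  define l where "l j = fst (lu j)" for j
  define u where "u j = snd (lu j)" for j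
  have l0: "l 0 = x_min" "u 0 = x_max" by (simp_all add: l_def u_def lu_def)
  have lS: "l (Suc j) = \<Phi> (u j) (l j)" "u (Suc j) = \<Phi> (l j) (u j)" for j
    by (simp_all add: l_def u_def lu_def case_prod_unfold)
  have inv: "l j \<in> xbox \<and> u j \<in> xbox \<and> l j \<le> u j" for j
  proof (induction j)
    case 0 show ?case using x_min_le_max by (simp add: l0)
  next
    case (Suc j) then show ?case using range mono[of "l j" "u j" "l j" "u j"] by (auto simp: lS)
  qed
  have mon: "l j \<le> l (Suc j) \<and> u (Suc j) \<le> u j" for j
  proof (induction j)
    case 0 show ?case using inv[of "Suc 0"] by (auto simp: l0)
  next
    case (Suc j)
    then show ?case
      using inv[of j] inv[of "Suc j"] mono[of "u (Suc j)" "u j" "l j" "l (Suc j)"] mono[of "l j" "l (Suc j)" "u (Suc j)" "u j"]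
      by (auto simp only: lS[of "Suc j"] lS[of j])
  qed
  have "incseq l" "decseq u" using mon by (auto intro: incseq_SucI decseq_SucI)
  obtain L where L: "l \<longlonglongrightarrow> L"
    using incseq_convergent[OF \<open>incseq l\<close>, of x_max] inv by (metis atLeastAtMost_iff order_trans)
  obtain U where U: "u \<longlonglongrightarrow> U"
    using decseq_convergent[OF \<open>decseq u\<close>, of x_min] inv by (metis atLeastAtMost_iff order_trans)
  have xbox: "L \<in> xbox" "U \<in> xbox"
    using inv by (auto intro!: LIMSEQ_le_const[OF L] LIMSEQ_le_const2[OF L] LIMSEQ_le_const[OF U] LIMSEQ_le_const2[OF U])
  have lim\<Phi>: "(\<lambda>j. \<Phi> (a j) (b j)) \<longlonglongrightarrow> \<Phi> A B" if "a \<longlonglongrightarrow> A" "b \<longlonglongrightarrow> B" "A \<in> xbox" "B \<in> xbox" "\<And>j. a j \<in> xbox \<and> b j \<in> xbox" for a b A B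
  proof -
    have "(\<lambda>j. (\<lambda>z. \<Phi> (fst z) (snd z)) (a j, b j)) \<longlonglongrightarrow> (\<lambda>z. \<Phi> (fst z) (snd z)) (A, B)"
      by (rule continuous_on_tendsto_compose[OF cont]) (use that in \<open>auto intro!: tendsto_Pair\<close>)
    then show ?thesis by simp
  qed
  have "(\<lambda>j. l (Suc j)) \<longlonglongrightarrow> \<Phi> U L"
    unfolding lS(1) by (rule lim\<Phi>[OF U L]) (use xbox inv in blast)+
  then have "L = \<Phi> U L" by (rule LIMSEQ_unique[OF LIMSEQ_Suc[OF L]])
  moreover have "(\<lambda>j. u (Suc j)) \<longlonglongrightarrow> \<Phi> L U"
    unfolding lS(2) by (rule lim\<Phi>[OF L U]) (use xbox inv in blast)+
  then have "U = \<Phi> L U" by (rule LIMSEQ_unique[OF LIMSEQ_Suc[OF U]])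
  ultimately have LU: "L = U" using uniq xbox by blast
  define xf where "xf = L"
  define yf where "yf = T xf / S xf"
  have xf: "xf \<in> xbox" "xf > 0" "\<Phi> xf xf = xf" "l \<longlonglongrightarrow> xf" "u \<longlonglongrightarrow> xf"
    using xbox L U LU \<open>L = \<Phi> U L\<close> x_min_pos by (auto simp: xf_def)
  have yf: "yf > 0" using ST_pos[of xf] xf by (simp add: yf_def)

  \<comment> \<open>One level brings the odds into \<open>xbox\<close>. After that each round costs
    two levels, since \<open>x_next\<close> reads the odds of the children and, through their
    ratios, of the grandchildren.\<close>
  have squeeze: "mx x y k v \<in> {l j..u j}"
    if xy: "\<And>v. x v \<in> {0..x_max}" "\<And>v. y v \<in> {1 / 4..4}" and "v \<noteq> []" "k \<ge> 1 + 2 * j" for x y k v j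
    using that(3,4)
  proof (induction j arbitrary: k v)
    case 0
    have "mx x y k v \<in> xbox"
      by (rule messages_bounds) (use xy 0 in \<open>simp_all del: atLeastAtMost_iff\<close>)
    then show ?case by (simp only: l0)
  next
    case (Suc j)
    define k' where "k' = k - 2"
    have k': "k = Suc (Suc k')" "k' \<ge> 1 + 2 * j" using Suc.prems(2) by (auto simp: k'_def)
    have IH: "mx x y k'' c \<in> {l j..u j}" if "k'' \<ge> k'" "c \<noteq> []" for k'' c
      using Suc.IH that k' by auto
    have "x_next (children D v) (mx x y (Suc k')) (my x y (Suc k')) \<in> {\<Phi> (u j) (l j)..\<Phi> (l j) (u j)}"
    proof (rule step)
      show "l j \<in> xbox" "u j \<in> xbox" "l j \<le> u j" using inv[of j] by auto
      show "card (children D v) = d" by (rule card_children'[OF Suc.prems(1)])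
      fix c assume c: "c \<in> children D v"
      note cn = children_not_Nil[OF c]
      show "mx x y (Suc k') c \<in> {l j..u j}" by (rule IH) (use cn in auto)
      have "y_ratio (children D c) (mx x y k') \<in> {min (T (l j) / S (l j)) (T (u j) / S (u j))..max (T (l j) / S (l j)) (T (u j) / S (u j))}"
      proof (rule ratio)
        show "l j \<in> xbox" "u j \<in> xbox" "l j \<le> u j" using inv[of j] by auto
        show "card (children D c) = d" by (rule card_children'[OF cn])
        fix e assume "e \<in> children D c"
        then show "mx x y k' e \<in> {l j..u j}" by (intro IH children_not_Nil) auto
      qed simp
      then show "my x y (Suc k') c \<in> {min (T (l j) / S (l j)) (T (u j) / S (u j))..max (T (l j) / S (l j)) (T (u j) / S (u j))}"
        by simp
    qed simp
    then show ?case by (simp add: k'(1) lS)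
  qed
  have contST: "continuous_on UNIV S" "continuous_on UNIV T"
    unfolding offspring_poly_def by (intro continuous_intros)+
  have limST: "(\<lambda>j. T (a j) / S (a j)) \<longlonglongrightarrow> yf" if "a \<longlonglongrightarrow> xf" for a :: "nat \<Rightarrow> real"
  proof -
    have "(\<lambda>j. T (a j)) \<longlonglongrightarrow> T xf" "(\<lambda>j. S (a j)) \<longlonglongrightarrow> S xf"
      using continuous_on_tendsto_compose[OF contST(1) that] continuous_on_tendsto_compose[OF contST(2) that] by auto
    then show ?thesis unfolding yf_def using ST_pos[of xf] xf by (intro tendsto_divide) auto
  qed
  define Q where "Q m \<omega> = edge_weight m (\<lambda>_. xf) (\<lambda>_. yf) \<omega> / (\<Sum>\<omega>'\<in>configs (ball_tree D m). edge_weight m (\<lambda>_. xf) (\<lambda>_. yf) \<omega>')" for m \<omega>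
  \<comment> \<open>The boundary configuration may change with the radius, which makes the
    convergence uniform over boundary conditions.\<close>
  have converge: "(\<lambda>i. finite_prob D lam \<theta> (ball_tree D (m + i)) (ball_tree D m) \<omega> (\<eta> i)) \<longlonglongrightarrow> Q m \<omega>"
    if m: "m \<ge> 1" and \<omega>: "\<omega> \<in> configs (ball_tree D m)" and \<eta>: "\<And>i. \<eta> i \<in> hardcore D (boundary D (ball_tree D (m + i)))" for m \<omega> \<eta>
  proof -
    have "\<forall>i. \<exists>xy. (\<forall>v. fst xy v \<in> {0..x_max}) \<and> (\<forall>v. snd xy v \<in> {1 / 4..4}) \<and>
       finite_prob D lam \<theta> (ball_tree D (m + i)) (ball_tree D m) \<omega> (\<eta> i) =
      edge_weight m (mx (fst xy) (snd xy) i) (my (fst xy) (snd xy) i) \<omega> /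
      (\<Sum>\<omega>'\<in>configs (ball_tree D m). edge_weight m (mx (fst xy) (snd xy) i) (my (fst xy) (snd xy) i) \<omega>')"
      using finite_prob_messages[OF m le_add1 \<eta>] \<omega> by (simp del: atLeastAtMost_iff) blast
    then obtain xy where xy: "\<And>i v. fst (xy i) v \<in> {0..x_max}" "\<And>i v. snd (xy i) v \<in> {1 / 4..4}"
      and fp: "\<And>i. finite_prob D lam \<theta> (ball_tree D (m + i)) (ball_tree D m) \<omega> (\<eta> i) =
      edge_weight m (mx (fst (xy i)) (snd (xy i)) i) (my (fst (xy i)) (snd (xy i)) i) \<omega> /
      (\<Sum>\<omega>'\<in>configs (ball_tree D m). edge_weight m (mx (fst (xy i)) (snd (xy i)) i) (my (fst (xy i)) (snd (xy i)) i) \<omega>')"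
      by metis
    \<comment> \<open>A ratio after \<open>i\<close> levels reads odds after \<open>i - 1\<close>
      levels, and \<open>squeeze\<close> asks for \<open>1 + 2 * j \<le> i - 1\<close>.\<close>
    define J where "J i = (i - 2) div 2" for i :: nat
    have J: "filterlim J at_top sequentially"
    proof -
      have "\<forall>K. \<exists>N. \<forall>i\<ge>N. K \<le> J i"
      proof
        fix K show "\<exists>N. \<forall>i\<ge>N. K \<le> J i" by (intro exI[of _ "2 * K + 2"]) (auto simp: J_def)
      qed
      then show ?thesis by (simp add: filterlim_at_top eventually_sequentially)
    qed
    have lJ: "(\<lambda>i. l (J i)) \<longlonglongrightarrow> xf" "(\<lambda>i. u (J i)) \<longlonglongrightarrow> xf"
      using filterlim_compose[OF xf(4) J] filterlim_compose[OF xf(5) J] by auto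
    have limx: "(\<lambda>i. mx (fst (xy i)) (snd (xy i)) i v) \<longlonglongrightarrow> xf" if v: "v \<noteq> []" for v
    proof (rule tendsto_sandwich[OF _ _ lJ])
      show "\<forall>\<^sub>F i in sequentially. l (J i) \<le> mx (fst (xy i)) (snd (xy i)) i v"
        using squeeze[OF xy v] by (intro eventually_sequentiallyI[of 2]) (auto simp: J_def)
      show "\<forall>\<^sub>F i in sequentially. mx (fst (xy i)) (snd (xy i)) i v \<le> u (J i)"
        using squeeze[OF xy v] by (intro eventually_sequentiallyI[of 2]) (auto simp: J_def)
    qed
    have limy: "(\<lambda>i. my (fst (xy i)) (snd (xy i)) i v) \<longlonglongrightarrow> yf" if v: "v \<noteq> []" for v
    proof -
      define lo where "lo i = min (T (l (J i)) / S (l (J i))) (T (u (J i)) / S (u (J i)))" for i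
      define hi where "hi i = max (T (l (J i)) / S (l (J i))) (T (u (J i)) / S (u (J i)))" for i
      have lims: "lo \<longlonglongrightarrow> yf" "hi \<longlonglongrightarrow> yf"
        unfolding lo_def hi_def using tendsto_min[OF limST[OF lJ(1)] limST[OF lJ(2)]] tendsto_max[OF limST[OF lJ(1)] limST[OF lJ(2)]] by auto
      have b: "my (fst (xy i)) (snd (xy i)) i v \<in> {lo i..hi i}" if i: "i \<ge> 2" for i
      proof -
        obtain i' where i': "i = Suc i'" "i' \<ge> 1" using i by (cases i) auto
        have "y_ratio (children D v) (mx (fst (xy i)) (snd (xy i)) i') \<in> {lo i..hi i}"
          unfolding lo_def hi_def
        proof (rule ratio)
          show "l (J i) \<in> xbox" "u (J i) \<in> xbox" "l (J i) \<le> u (J i)" using inv[of "J i"] by auto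
          show "card (children D v) = d" by (rule card_children'[OF v])
          fix c assume "c \<in> children D v"
          then show "mx (fst (xy i)) (snd (xy i)) i' c \<in> {l (J i)..u (J i)}"
            using i' by (intro squeeze[OF xy] children_not_Nil) (auto simp: J_def)
        qed simp
        then show ?thesis by (simp add: i'(1))
      qed
      show ?thesis
        by (rule tendsto_sandwich[OF _ _ lims]; intro eventually_sequentiallyI[of 2]) (use b in auto)
    qed
    have nn: "v \<noteq> []" if "v \<in> layer D m" for v using that m by (auto simp: layer_def)
    show ?thesis
      unfolding fp Q_def
      using edge_weight_total_pos[OF m, of xf yf] xf yf
      by (intro tendsto_divide tendsto_sum edge_weight_tendsto limx limy nn) auto
  qed
  \<comment> \<open>For every radius a Gibbs probability is an average of finite-volume
    probabilities, so it lies between two of them. Choosing such boundary configurations radius by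
    radius and letting the radius grow forces the value \<open>Q m \<omega>\<close>.\<close>
  have gibbs_Q: "measure M {x \<in> space M. restrict x (ball_tree D m) = \<omega>} = Q m \<omega>"
    if M: "gibbs_measure D lam \<theta> M" and m: "m \<ge> 1" and \<omega>: "\<omega> \<in> configs (ball_tree D m)" for M m \<omega>
  proof -
    have PM: "prob_space M" and sM: "sets M = sets (spin_space D)" and ae: "AE x in M. x \<in> hardcore D (tree D)"
      and dlr: "\<And>i. measure M {x \<in> space M. restrict x (ball_tree D m) = \<omega>} =
        (\<Sum>\<eta>\<in>hardcore D (boundary D (ball_tree D (m + i))). finite_prob D lam \<theta> (ball_tree D (m + i)) (ball_tree D m) \<omega> \<eta> *
           measure M {x \<in> space M. restrict x (boundary D (ball_tree D (m + i))) = \<eta>})"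
      using M \<omega> ball_tree_subset[of D] ball_tree_mono[of m _ D] unfolding gibbs_measure_def by auto
    interpret prob_space M by fact
    let ?d = "\<lambda>i. boundary D (ball_tree D (m + i))"
    let ?f = "\<lambda>i \<eta>. finite_prob D lam \<theta> (ball_tree D (m + i)) (ball_tree D m) \<omega> \<eta>"
    let ?p = "\<lambda>i \<eta>. measure M {x \<in> space M. restrict x (?d i) = \<eta>}"
    define \<mu> where "\<mu> = measure M {x \<in> space M. restrict x (ball_tree D m) = \<omega>}"
    have fin: "finite (hardcore D (?d i))" for i
      by (rule finite_subset[of _ "configs (?d i)"])
        (use finite_configs[OF finite_boundary[OF finite_ball_tree ball_tree_subset]] in \<open>auto simp: hardcore_def\<close>)
    have total: "(\<Sum>\<eta>\<in>hardcore D (?d i). ?p i \<eta>) = 1" for i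
    proof -
      have dt: "?d i \<subseteq> tree D" by (auto simp: boundary_def)
      have df: "finite (?d i)" by (rule finite_boundary[OF finite_ball_tree ball_tree_subset])
      have "AE x in M. restrict x (?d i) \<in> hardcore D (?d i)"
        using ae
      proof eventually_elim
        case (elim x)
        then show ?case using dt configs_restrict[OF _ dt, of x] by (auto simp: hardcore_def)
      qed
      then have "measure M {x \<in> space M. restrict x (?d i) \<in> hardcore D (?d i)} = 1"
        using cylinder_measurable[OF sM df dt, of "\<lambda>f. f \<in> hardcore D (?d i)"] by (intro prob_eq_1[THEN iffD2]) auto
      moreover have "{f \<in> configs (?d i). f \<in> hardcore D (?d i)} = hardcore D (?d i)" by (auto simp: hardcore_def)
      ultimately show ?thesis
        using measure_cylinder_sum[OF PM sM df dt, of "\<lambda>f. f \<in> hardcore D (?d i)"] by simp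
    qed
    have conv: "\<mu> = (\<Sum>\<eta>\<in>hardcore D (?d i). ?f i \<eta> * ?p i \<eta>)" for i unfolding \<mu>_def by (rule dlr)
    have up: "\<exists>\<eta>\<in>hardcore D (?d i). \<mu> \<le> ?f i \<eta>" for i
    proof (rule ccontr)
      assume a: "\<not> ?thesis"
      have "(\<Sum>\<eta>\<in>hardcore D (?d i). (\<mu> - ?f i \<eta>) * ?p i \<eta>) = 0"
        using conv[of i] total[of i] by (simp add: left_diff_distrib sum_subtractf flip: sum_distrib_left)
      moreover have "\<forall>\<eta>\<in>hardcore D (?d i). 0 \<le> (\<mu> - ?f i \<eta>) * ?p i \<eta>" using a by (auto intro!: mult_nonneg_nonneg)
      ultimately have "\<forall>\<eta>\<in>hardcore D (?d i). (\<mu> - ?f i \<eta>) * ?p i \<eta> = 0" using fin by (subst (asm) sum_nonneg_eq_0_iff) auto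
      then have "(\<Sum>\<eta>\<in>hardcore D (?d i). ?p i \<eta>) = 0" using a by (intro sum.neutral) force
      then show False using total[of i] by simp
    qed
    have dn: "\<exists>\<eta>\<in>hardcore D (?d i). ?f i \<eta> \<le> \<mu>" for i
    proof (rule ccontr)
      assume a: "\<not> ?thesis"
      have "(\<Sum>\<eta>\<in>hardcore D (?d i). (?f i \<eta> - \<mu>) * ?p i \<eta>) = 0"
        using conv[of i] total[of i] by (simp add: left_diff_distrib sum_subtractf flip: sum_distrib_left)
      moreover have "\<forall>\<eta>\<in>hardcore D (?d i). 0 \<le> (?f i \<eta> - \<mu>) * ?p i \<eta>" using a by (auto intro!: mult_nonneg_nonneg)
      ultimately have "\<forall>\<eta>\<in>hardcore D (?d i). (?f i \<eta> - \<mu>) * ?p i \<eta> = 0" using fin by (subst (asm) sum_nonneg_eq_0_iff) auto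
      then have "(\<Sum>\<eta>\<in>hardcore D (?d i). ?p i \<eta>) = 0" using a by (intro sum.neutral) force
      then show False using total[of i] by simp
    qed
    obtain \<eta>u where "\<And>i. \<eta>u i \<in> hardcore D (?d i)" "\<And>i. \<mu> \<le> ?f i (\<eta>u i)" using up by metis
    then have "\<mu> \<le> Q m \<omega>" using converge[OF m \<omega>, of \<eta>u] by (auto intro: LIMSEQ_le_const)
    moreover obtain \<eta>d where "\<And>i. \<eta>d i \<in> hardcore D (?d i)" "\<And>i. ?f i (\<eta>d i) \<le> \<mu>" using dn by metis
    then have "Q m \<omega> \<le> \<mu>" using converge[OF m \<omega>, of \<eta>d] by (auto intro: LIMSEQ_le_const2)
    ultimately show ?thesis by (simp add: \<mu>_def)
  qed
  have D1: "D \<ge> 1" using D2 by simp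
  \<comment> \<open>Existence: the constant sequences \<open>xf\<close>, \<open>yf\<close> solve the
    message recursion.\<close>
  have rec: "xf = lam * yf ^ d / S xf" using diag[OF xf(1)] xf(3) by (simp add: yf_def)
  obtain M where M: "gibbs_measure D lam \<theta> M"
    by (rule gibbs_of_recursion[where D = D and lam = lam and \<theta> = \<theta> and X = "\<lambda>_. xf" and Y = "\<lambda>_. yf", OF D1 lam _ xf(2) yf rec yf_def],
      rule \<theta>_pos, assumption, blast)
  have "N = M" if N: "gibbs_measure D lam \<theta> N" for N
    by (rule tree_measure_eqI) (use M N gibbs_Q in \<open>auto simp: gibbs_measure_def\<close>)
  then show ?thesis unfolding uniqueness_regime_def using M by blast
qed

end

section \<open>Two-cycles and the Schwarzian\<close>

text \<open>As a function of \<open>w\<close>, \<open>M\<close> has slope \<open>s / a\<close>. The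
  left side of \<open>schw\<close> is \<open>(a x * s x)\<^sup>2\<close> times the Schwarzian of
  \<open>w\<close> minus that of \<open>M\<close>; its nonnegativity means that \<open>M\<close> as
  a function of \<open>w\<close> has nonpositive Schwarzian, which is convexity of
  \<open>\<psi>\<close>, the power -1/2 of the slope. The tangent of \<open>\<psi>\<close> at
  \<open>f\<close> bounds the slope on both sides of \<open>f\<close>, and the two halves of the
  cycle then give \<open>\<psi> f * \<psi> f \<le> 1\<close>.\<close>

lemma schwarzian_pair:
  fixes w M a s a1 s1 a2 s2 :: "real \<Rightarrow> real"
  assumes lfu: "l < f" "f < u"
    and dw: "\<And>x. x \<in> {l..u} \<Longrightarrow> (w has_real_derivative a x) (at x)"
    and dM: "\<And>x. x \<in> {l..u} \<Longrightarrow> (M has_real_derivative s x) (at x)"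
    and da: "\<And>x. x \<in> {l..u} \<Longrightarrow> (a has_real_derivative a1 x) (at x)"
    and ds: "\<And>x. x \<in> {l..u} \<Longrightarrow> (s has_real_derivative s1 x) (at x)"
    and da1: "\<And>x. x \<in> {l..u} \<Longrightarrow> (a1 has_real_derivative a2 x) (at x)"
    and ds1: "\<And>x. x \<in> {l..u} \<Longrightarrow> (s1 has_real_derivative s2 x) (at x)"
    and pos: "\<And>x. x \<in> {l..u} \<Longrightarrow> a x > 0" "\<And>x. x \<in> {l..u} \<Longrightarrow> s x > 0"
    and schw: "\<And>x. x \<in> {l..u} \<Longrightarrow>
       (s x)\<^sup>2 * (a2 x * a x - 3 / 2 * (a1 x)\<^sup>2) - (a x)\<^sup>2 * (s2 x * s x - 3 / 2 * (s1 x)\<^sup>2) \<ge> 0"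
    and eqs: "w u + M l = w f + M f" "w l + M u = w f + M f"
  shows "a f \<le> s f"
proof -
  define N where "N x = a1 x * s x - a x * s1 x" for x
  define P where "P x = a x * s x" for x
  define \<psi> where "\<psi> x = sqrt (a x / s x)" for x
  define k where "k x = N x / (2 * (P x * sqrt (P x)))" for x
  have P: "P x > 0" if "x \<in> {l..u}" for x using pos that by (simp add: P_def)
  have \<psi>_pos: "\<psi> x > 0" if "x \<in> {l..u}" for x using pos that by (simp add: \<psi>_def)
  have \<psi>2: "\<psi> x * \<psi> x = a x / s x" if "x \<in> {l..u}" for x
    using pos that by (simp add: \<psi>_def less_imp_le)
  have d\<psi>: "(\<psi> has_real_derivative k x * a x) (at x)" if x: "x \<in> {l..u}" for x
  proof -
    have "((\<lambda>x. a x / s x) has_real_derivative N x / (s x * s x)) (at x)"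
      using pos[OF x] by (auto intro!: derivative_eq_intros da[OF x] ds[OF x] simp: N_def field_simps)
    then have "(\<psi> has_real_derivative (inverse (sqrt (a x / s x)) / 2) * (N x / (s x * s x))) (at x)"
      unfolding \<psi>_def using pos[OF x] by (intro DERIV_chain'[OF _ DERIV_real_sqrt]) auto
    moreover have "(inverse (sqrt (a x / s x)) / 2) * (N x / (s x * s x)) = k x * a x"
    proof -
      define p q where "p = sqrt (a x)" and "q = sqrt (s x)"
      have pq: "p > 0" "q > 0" "a x = p * p" "s x = q * q" using pos[OF x] by (auto simp: p_def q_def)
      then show ?thesis by (simp add: k_def P_def real_sqrt_divide real_sqrt_mult field_simps)
    qed
    ultimately show ?thesis by simp
  qed
  \<comment> \<open>\<open>k\<close> is the derivative of \<open>\<psi>\<close> with respect to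
    \<open>w\<close>. Its own derivative is the left side of \<open>schw\<close> times a positive
    factor, so \<open>\<psi>\<close> is convex in \<open>w\<close>.\<close>
  have dk: "\<exists>D. (k has_real_derivative D) (at x) \<and> D \<ge> 0" if x: "x \<in> {l..u}" for x
  proof -
    let ?P1 = "a1 x * s x + a x * s1 x" and ?N1 = "a2 x * s x - a x * s2 x"
    have dP: "(P has_real_derivative ?P1) (at x)" unfolding P_def
      by (auto intro!: derivative_eq_intros da[OF x] ds[OF x])
    have dN: "(N has_real_derivative ?N1) (at x)" unfolding N_def
      by (auto intro!: derivative_eq_intros da[OF x] ds[OF x] da1[OF x] ds1[OF x])
    define r where "r = sqrt (P x)"
    have r: "r > 0" "P x = r * r" using P[OF x] by (auto simp: r_def)
    have dr: "((\<lambda>x. sqrt (P x)) has_real_derivative ?P1 / (2 * r)) (at x)"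
      using DERIV_chain'[OF dP DERIV_real_sqrt[OF P[OF x]]] by (simp add: r_def field_simps)
    have "(k has_real_derivative
        (?N1 * (2 * (P x * r)) - N x * (2 * (?P1 * r + ?P1 / (2 * r) * P x))) / ((2 * (P x * r)) * (2 * (P x * r)))) (at x)"
      unfolding k_def using r
      by (auto intro!: derivative_eq_intros dP dN dr simp: r_def[symmetric])
    moreover have "?N1 * (2 * (P x * r)) - N x * (2 * (?P1 * r + ?P1 / (2 * r) * P x)) =
        2 * r * (P x * ?N1 - 3 / 2 * (N x * ?P1))"
      using r by (simp add: field_simps)
    moreover have "P x * ?N1 - 3 / 2 * (N x * ?P1) =
        (s x)\<^sup>2 * (a2 x * a x - 3 / 2 * (a1 x)\<^sup>2) - (a x)\<^sup>2 * (s2 x * s x - 3 / 2 * (s1 x)\<^sup>2)"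
      by (simp add: P_def N_def power2_eq_square algebra_simps)
    ultimately have "(k has_real_derivative (2 * r * ((s x)\<^sup>2 * (a2 x * a x - 3 / 2 * (a1 x)\<^sup>2) -
        (a x)\<^sup>2 * (s2 x * s x - 3 / 2 * (s1 x)\<^sup>2))) / ((2 * (P x * r)) * (2 * (P x * r)))) (at x)"
      by simp
    moreover have "(2 * r * ((s x)\<^sup>2 * (a2 x * a x - 3 / 2 * (a1 x)\<^sup>2) -
        (a x)\<^sup>2 * (s2 x * s x - 3 / 2 * (s1 x)\<^sup>2))) / ((2 * (P x * r)) * (2 * (P x * r))) \<ge> 0"
      using schw[OF x] r by (intro divide_nonneg_nonneg mult_nonneg_nonneg) auto
    ultimately show ?thesis by blast
  qed
  have k_mono: "k x \<le> k y" if "l \<le> x" "x \<le> y" "y \<le> u" for x y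
    using that dk by (intro DERIV_nonneg_imp_nondecreasing[of x y k]) auto
  define p where "p = \<psi> f"
  define \<kappa> where "\<kappa> = k f"
  have p: "p > 0" using \<psi>_pos[of f] lfu by (simp add: p_def)
  have w_less: "w x < w y" if "l \<le> x" "x < y" "y \<le> u" for x y
  proof (rule DERIV_pos_imp_increasing[OF that(2)])
    fix z assume "x \<le> z" "z \<le> y"
    then have "z \<in> {l..u}" using that by auto
    then show "\<exists>D. (w has_real_derivative D) (at z) \<and> D > 0" using dw pos by blast
  qed
  have M_less: "M x < M y" if "l \<le> x" "x < y" "y \<le> u" for x y
  proof (rule DERIV_pos_imp_increasing[OF that(2)])
    fix z assume "x \<le> z" "z \<le> y"
    then have "z \<in> {l..u}" using that by auto
    then show "\<exists>D. (M has_real_derivative D) (at z) \<and> D > 0" using dM pos by blast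
  qed
  \<comment> \<open>The tangent at \<open>f\<close> to \<open>\<psi>\<close> as a function of
    \<open>w\<close>; convexity puts it below \<open>\<psi>\<close>.\<close>
  define c where "c x = p + \<kappa> * (w x - w f)" for x
  have dG: "((\<lambda>x. \<psi> x - c x) has_real_derivative a x * (k x - \<kappa>)) (at x)" if "x \<in> {l..u}" for x
    unfolding c_def by (auto intro!: derivative_eq_intros d\<psi>[OF that] dw[OF that] simp: algebra_simps)
  have tangent: "c x \<le> \<psi> x" if x: "x \<in> {l..u}" for x
  proof (cases "x \<le> f")
    case True
    have "\<psi> f - c f \<le> \<psi> x - c x"
    proof (rule DERIV_nonpos_imp_nonincreasing[OF True])
      fix y assume y: "x \<le> y" "y \<le> f"
      then have "a y * (k y - \<kappa>) \<le> 0"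
        using k_mono[of y f] x lfu pos(1)[of y] by (auto simp: \<kappa>_def mult_le_0_iff)
      then show "\<exists>z. ((\<lambda>x. \<psi> x - c x) has_real_derivative z) (at y) \<and> z \<le> 0"
        using dG[of y] x y lfu by auto
    qed
    then show ?thesis by (simp add: c_def p_def)
  next
    case False
    then have "f \<le> x" by simp
    have "\<psi> f - c f \<le> \<psi> x - c x"
    proof (rule DERIV_nonneg_imp_nondecreasing[OF \<open>f \<le> x\<close>])
      fix y assume y: "f \<le> y" "y \<le> x"
      then have "a y * (k y - \<kappa>) \<ge> 0"
        using k_mono[of f y] x lfu pos(1)[of y] by (auto simp: \<kappa>_def)
      then show "\<exists>z. ((\<lambda>x. \<psi> x - c x) has_real_derivative z) (at y) \<and> z \<ge> 0"
        using dG[of y] x y lfu by auto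
    qed
    then show ?thesis by (simp add: c_def p_def)
  qed
  \<comment> \<open>Replacing \<open>\<psi>\<close> by its tangent \<open>c\<close> (as a function of \<open>w\<close>) bounds the increments of \<open>M\<close>,
    since \<open>dM/dw = \<psi>\<^sup>-\<^sup>2\<close>.\<close>
  define B where "B x = (w x - w f) / (p * c x) - (M x - M f)" for x
  have dB: "\<exists>z. (B has_real_derivative z) (at x) \<and> z \<ge> 0" if x: "x \<in> {l..u}" and c: "c x > 0" for x
  proof -
    have dc: "(c has_real_derivative \<kappa> * a x) (at x)"
      unfolding c_def by (auto intro!: derivative_eq_intros dw[OF x])
    have "(B has_real_derivative (a x * (p * c x) - (w x - w f) * (p * (\<kappa> * a x))) / ((p * c x) * (p * c x)) - s x) (at x)"
      unfolding B_def using p c by (auto intro!: derivative_eq_intros dw[OF x] dM[OF x] dc)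
    moreover have "(a x * (p * c x) - (w x - w f) * (p * (\<kappa> * a x))) / ((p * c x) * (p * c x)) = a x / (c x * c x)"
    proof -
      have "a x * (p * c x) - (w x - w f) * (p * (\<kappa> * a x)) = a x * p * p"
        by (simp add: c_def algebra_simps)
      then show ?thesis using p c by (simp add: field_simps)
    qed
    moreover have "s x \<le> a x / (c x * c x)"
    proof -
      have "c x * c x \<le> \<psi> x * \<psi> x" using tangent[OF x] c by (intro mult_mono) auto
      then have "c x * c x \<le> a x / s x" using \<psi>2[OF x] by simp
      then have "s x * (c x * c x) \<le> a x" using pos[OF x] by (simp add: field_simps)
      then show ?thesis using c by (simp add: field_simps)
    qed
    ultimately show ?thesis by auto
  qed
  have Bf: "B f = 0" by (simp add: B_def)
  define \<Delta>p where "\<Delta>p = w u - w f"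
  define \<Delta>m where "\<Delta>m = w f - w l"
  have \<Delta>: "\<Delta>p > 0" "\<Delta>m > 0" "M f - M l = \<Delta>p" "M u - M f = \<Delta>m"
    using w_less[of f u] w_less[of l f] lfu eqs by (auto simp: \<Delta>p_def \<Delta>m_def)
  \<comment> \<open>Integrating up to \<open>u\<close> requires \<open>c\<close> to be positive all
    the way. Being affine in \<open>w\<close>, \<open>c\<close> is positive if it is so at both
    ends; if it is not positive at \<open>u\<close>, the left side of the claim is
    nonpositive.\<close>
  have right: "p * (p + \<kappa> * \<Delta>p) * \<Delta>m \<le> \<Delta>p"
  proof (cases "p + \<kappa> * \<Delta>p > 0")
    case False
    then have "p * (p + \<kappa> * \<Delta>p) * \<Delta>m \<le> 0" using p \<Delta> by (intro mult_nonpos_nonneg mult_nonneg_nonpos) auto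
    then show ?thesis using \<Delta> by simp
  next
    case True
    have cpos: "c x > 0" if x: "f \<le> x" "x \<le> u" for x
    proof (cases "\<kappa> \<ge> 0")
      case True
      have "w f \<le> w x" using w_less[of f x] x lfu by (cases "x = f") auto
      then show ?thesis using True p by (auto simp: c_def intro!: add_pos_nonneg)
    next
      case False
      have "w x \<le> w u" using w_less[of x u] x lfu by (cases "x = u") auto
      then have "\<kappa> * (w x - w f) \<ge> \<kappa> * \<Delta>p" using False by (simp add: \<Delta>p_def)
      then show ?thesis using \<open>p + \<kappa> * \<Delta>p > 0\<close> by (simp add: c_def)
    qed
    have "B f \<le> B u"
      by (rule DERIV_nonneg_imp_nondecreasing) (use lfu cpos dB in auto)
    then have "\<Delta>m \<le> \<Delta>p / (p * (p + \<kappa> * \<Delta>p))"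
      using Bf \<Delta> by (simp add: B_def c_def \<Delta>p_def)
    moreover have "p * (p + \<kappa> * \<Delta>p) > 0" using True p by simp
    ultimately show ?thesis by (simp only: pos_le_divide_eq mult.commute)
  qed
  have left: "p * (p - \<kappa> * \<Delta>m) * \<Delta>p \<le> \<Delta>m"
  proof (cases "p - \<kappa> * \<Delta>m > 0")
    case False
    then have "p * (p - \<kappa> * \<Delta>m) * \<Delta>p \<le> 0" using p \<Delta> by (intro mult_nonpos_nonneg mult_nonneg_nonpos) auto
    then show ?thesis using \<Delta> by simp
  next
    case True
    have cpos: "c x > 0" if x: "l \<le> x" "x \<le> f" for x
    proof (cases "\<kappa> \<le> 0")
      case True
      have "w x \<le> w f" using w_less[of x f] x lfu by (cases "x = f") auto
      then have "\<kappa> * (w x - w f) \<ge> 0" using True by (simp add: mult_nonpos_nonpos)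
      then show ?thesis using p by (simp add: c_def)
    next
      case False
      have "w l \<le> w x" using w_less[of l x] x lfu by (cases "x = l") auto
      then have "\<kappa> * (w x - w f) \<ge> \<kappa> * (w l - w f)" using False by simp
      then show ?thesis using \<open>p - \<kappa> * \<Delta>m > 0\<close> by (simp add: c_def \<Delta>m_def algebra_simps)
    qed
    have "B l \<le> B f"
      by (rule DERIV_nonneg_imp_nondecreasing) (use lfu cpos dB in auto)
    moreover have "B l = - (\<Delta>m / (p * (p - \<kappa> * \<Delta>m))) + \<Delta>p"
    proof -
      have "w l - w f = - \<Delta>m" "M l - M f = - \<Delta>p" "c l = p - \<kappa> * \<Delta>m"
        using \<Delta> by (auto simp: \<Delta>m_def c_def algebra_simps)
      then show ?thesis by (simp add: B_def)
    qed
    ultimately have "\<Delta>p \<le> \<Delta>m / (p * (p - \<kappa> * \<Delta>m))" using Bf by simp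
    moreover have "p * (p - \<kappa> * \<Delta>m) > 0" using True p by simp
    ultimately show ?thesis by (simp only: pos_le_divide_eq mult.commute)
  qed
  \<comment> \<open>Adding \<open>right\<close> and \<open>left\<close> cancels the terms with
    \<kappa>, so the slope of the tangent drops out. The cancellation rests on the crosswise pairing
    in the cycle equations: the rise of \<open>w\<close> on one side of \<open>f\<close> equals the
    rise of \<open>M\<close> on the other.\<close>
  have "p * p * (\<Delta>p + \<Delta>m) \<le> 1 * (\<Delta>p + \<Delta>m)"
    using right left by (simp add: algebra_simps)
  then have "p * p \<le> 1" using \<Delta> by (metis add_pos_pos mult_le_cancel_right_pos)
  then have "a f / s f \<le> 1" using \<psi>2[of f] lfu by (simp add: p_def)
  then show ?thesis using pos(2)[of f] lfu by simp
qed

text \<open>At h = 0 the function has a positive minimum; uniform continuity keeps the loss below it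
  for small h, uniformly in x.\<close>

lemma pos_near_compact_section:
  fixes F :: "real \<times> real \<Rightarrow> real"
  assumes "h0 > 0" "continuous_on ({lo..hi} \<times> {0..h0}) F" "\<And>x. x \<in> {lo..hi} \<Longrightarrow> F (x, 0) > 0"
  shows "\<exists>\<epsilon>>0. \<epsilon> \<le> h0 \<and> (\<forall>h\<in>{0..\<epsilon>}. \<forall>x\<in>{lo..hi}. F (x, h) > 0)"
proof (cases "lo \<le> hi")
  case True
  have cont0: "continuous_on {lo..hi} (\<lambda>x. F (x, 0))"
    by (rule continuous_on_compose2[OF assms(2)]) (use assms(1) in \<open>auto intro!: continuous_intros\<close>)
  obtain z where z: "z \<in> {lo..hi}" "\<And>y. y \<in> {lo..hi} \<Longrightarrow> F (z, 0) \<le> F (y, 0)"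
    using continuous_attains_inf[OF _ _ cont0] True by auto
  have "uniformly_continuous_on ({lo..hi} \<times> {0..h0}) F"
    by (intro compact_uniformly_continuous assms compact_Times) auto
  then obtain \<delta> where \<delta>: "\<delta> > 0" "\<And>x x'. x \<in> {lo..hi} \<times> {0..h0} \<Longrightarrow> x' \<in> {lo..hi} \<times> {0..h0} \<Longrightarrow>
      dist x' x < \<delta> \<Longrightarrow> dist (F x') (F x) < F (z, 0)"
    unfolding uniformly_continuous_on_def using assms(3)[OF z(1)] by metis
  show ?thesis
  proof (intro exI[of _ "min h0 (\<delta> / 2)"] conjI ballI)
    fix h x assume h: "h \<in> {0..min h0 (\<delta> / 2)}" and x: "x \<in> {lo..hi}"
    have "dist (x, h) (x, 0) < \<delta>" using h \<delta>(1) by (simp add: dist_Pair_Pair)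
    then have "dist (F (x, h)) (F (x, 0)) < F (z, 0)"
      using h x assms(1) by (intro \<delta>(2)) auto
    then show "F (x, h) > 0" using z(2)[OF x] by (auto simp: dist_real_def)
  qed (use assms(1) \<delta>(1) in auto)
qed (use assms(1) in auto)

section \<open>The perturbed recursion at criticality\<close>

text \<open>The \<open>n\<close>-th derivative in x of \<open>B + h p\<close>. Working with
  polynomials gives all derivatives in x and joint continuity in x and h at once.\<close>

definition pert :: "real poly \<Rightarrow> real poly \<Rightarrow> nat \<Rightarrow> real \<Rightarrow> real \<Rightarrow> real" where
  "pert B p n h x = poly ((pderiv ^^ n) B) x + h * poly ((pderiv ^^ n) p) x"

text \<open>\<open>ldiv0\<close>, \<open>ldiv1\<close> and \<open>ldiv2\<close> are the first three
  derivatives of the logarithm of \<open>B + h p\<close>.\<close>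

definition ldiv0 :: "real poly \<Rightarrow> real poly \<Rightarrow> real \<Rightarrow> real \<Rightarrow> real" where
  "ldiv0 B p h x = pert B p 1 h x / pert B p 0 h x"

definition ldiv1 :: "real poly \<Rightarrow> real poly \<Rightarrow> real \<Rightarrow> real \<Rightarrow> real" where
  "ldiv1 B p h x = pert B p 2 h x / pert B p 0 h x - (pert B p 1 h x / pert B p 0 h x)\<^sup>2"

definition ldiv2 :: "real poly \<Rightarrow> real poly \<Rightarrow> real \<Rightarrow> real \<Rightarrow> real" where
  "ldiv2 B p h x = pert B p 3 h x / pert B p 0 h x
     - 3 * (pert B p 1 h x / pert B p 0 h x) * (pert B p 2 h x / pert B p 0 h x)
     + 2 * (pert B p 1 h x / pert B p 0 h x) ^ 3"

lemma DERIV_pert: "(pert B p n h has_real_derivative pert B p (Suc n) h x) (at x)"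
  unfolding pert_def by (auto intro!: derivative_eq_intros)

lemma DERIV_ln_pert:
  assumes "pert B p 0 h x > 0"
  shows "((\<lambda>x. ln (pert B p 0 h x)) has_real_derivative ldiv0 B p h x) (at x)"
  using assms DERIV_pert[of B p 0 h x] unfolding ldiv0_def
  by (auto intro!: derivative_eq_intros simp: divide_inverse)

lemma DERIV_ldiv0:
  assumes "pert B p 0 h x > 0"
  shows "(ldiv0 B p h has_real_derivative ldiv1 B p h x) (at x)"
proof -
  have "((\<lambda>x. pert B p 1 h x / pert B p 0 h x) has_real_derivative
     (pert B p 2 h x * pert B p 0 h x - pert B p 1 h x * pert B p 1 h x) / (pert B p 0 h x * pert B p 0 h x)) (at x)"
    using assms DERIV_pert[of B p 0 h x] DERIV_pert[of B p 1 h x]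
    by (auto intro!: DERIV_divide simp: numeral_2_eq_2)
  moreover have "(pert B p 2 h x * pert B p 0 h x - pert B p 1 h x * pert B p 1 h x) / (pert B p 0 h x * pert B p 0 h x) = ldiv1 B p h x"
    using assms by (simp add: ldiv1_def field_simps power2_eq_square)
  ultimately show ?thesis by (simp add: ldiv0_def[abs_def])
qed

lemma DERIV_ldiv1:
  assumes "pert B p 0 h x > 0"
  shows "(ldiv1 B p h has_real_derivative ldiv2 B p h x) (at x)"
proof -
  have d0: "((\<lambda>x. pert B p 1 h x / pert B p 0 h x) has_real_derivative ldiv1 B p h x) (at x)"
    using DERIV_ldiv0[OF assms] by (simp add: ldiv0_def[abs_def])
  have "((\<lambda>x. pert B p 2 h x / pert B p 0 h x) has_real_derivative
     (pert B p 3 h x * pert B p 0 h x - pert B p 2 h x * pert B p 1 h x) / (pert B p 0 h x * pert B p 0 h x)) (at x)"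
    using assms DERIV_pert[of B p 0 h x] DERIV_pert[of B p 2 h x]
    by (auto intro!: DERIV_divide simp: eval_nat_numeral)
  from DERIV_diff[OF this DERIV_power[OF d0, of 2]]
  have "((\<lambda>x. ldiv1 B p h x) has_real_derivative
     ((pert B p 3 h x * pert B p 0 h x - pert B p 2 h x * pert B p 1 h x) / (pert B p 0 h x * pert B p 0 h x)
       - 2 * (pert B p 1 h x / pert B p 0 h x) * ldiv1 B p h x)) (at x)"
    by (simp only: ldiv1_def[symmetric]) (simp add: mult_ac)
  moreover have "((pert B p 3 h x * pert B p 0 h x - pert B p 2 h x * pert B p 1 h x) / (pert B p 0 h x * pert B p 0 h x)
       - 2 * (pert B p 1 h x / pert B p 0 h x) * ldiv1 B p h x) = ldiv2 B p h x"
  proof -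
    define q1 q2 q3 where "q1 = pert B p 1 h x / pert B p 0 h x" "q2 = pert B p 2 h x / pert B p 0 h x" "q3 = pert B p 3 h x / pert B p 0 h x"
    have "(pert B p 3 h x * pert B p 0 h x - pert B p 2 h x * pert B p 1 h x) / (pert B p 0 h x * pert B p 0 h x) = q3 - q2 * q1"
      using assms by (simp add: q1_q2_q3_def field_simps)
    then show ?thesis
      unfolding ldiv1_def ldiv2_def q1_q2_q3_def[symmetric]
      by (simp add: algebra_simps power2_eq_square power3_eq_cube)
  qed
  ultimately show ?thesis by simp
qed

text \<open>Differentiate the Euler relation. Iterated from \<open>(1 + x) ^ d\<close>, this avoids
  the exponents \<open>d - 1\<close>, \<open>d - 2\<close>, \<open>d - 3\<close>, which truncate for
  small \<open>d\<close>.\<close>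

lemma euler_pderiv:
  fixes Q :: "real poly"
  assumes "[:1, 1:] * pderiv Q = smult c Q"
  shows "[:1, 1:] * pderiv (pderiv Q) = smult (c - 1) (pderiv Q)"
proof -
  have "[:1, 1:] * pderiv (pderiv Q) + pderiv Q = smult c (pderiv Q)"
    using arg_cong[OF assms, of pderiv]
    by (simp add: pderiv_mult pderiv_smult pderiv_pCons add.commute del: mult_pCons_left)
  then show ?thesis by (simp add: smult_diff_left eq_diff_eq del: mult_pCons_left)
qed

lemma binomial_poly_derivs:
  fixes x :: real and d :: nat
  defines "B \<equiv> [:1, 1:] ^ d"
  shows "(1 + x) * poly (pderiv B) x = real d * poly B x"
    and "(1 + x) * poly (pderiv (pderiv B)) x = (real d - 1) * poly (pderiv B) x"
    and "(1 + x) * poly (pderiv (pderiv (pderiv B))) x = (real d - 2) * poly (pderiv (pderiv B)) x"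
proof -
  have R: "[:1, 1:] * pderiv B = smult (real d) B"
  proof (cases d)
    case (Suc n)
    have "pderiv B = smult (real d) ([:1, 1:] ^ n)"
      unfolding B_def Suc by (simp add: pderiv_power_Suc pderiv_pCons del: power_Suc of_nat_Suc)
    then show ?thesis unfolding B_def Suc by (simp only: mult_smult_right power_Suc)
  qed (simp add: B_def)
  have ev: "(1 + x) * poly Q x = c * poly Q' x" if "[:1, 1:] * Q = smult c Q'" for c and Q Q' :: "real poly"
    using arg_cong[OF that, of "\<lambda>q. poly q x"] by simp (simp add: algebra_simps)
  note R2 = euler_pderiv[OF R]
  note R3 = euler_pderiv[OF R2]
  show "(1 + x) * poly (pderiv B) x = real d * poly B x"
    using ev[OF R] .
  show "(1 + x) * poly (pderiv (pderiv B)) x = (real d - 1) * poly (pderiv B) x"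
    using ev[OF R2] .
  show "(1 + x) * poly (pderiv (pderiv (pderiv B))) x = (real d - 2) * poly (pderiv (pderiv B)) x"
    using ev[OF R3] by simp
qed

lemma ldiv_binomial:
  fixes x :: real
  assumes "1 + x > 0"
  shows "ldiv0 ([:1, 1:] ^ d) p 0 x = real d / (1 + x)"
    and "ldiv1 ([:1, 1:] ^ d) p 0 x = - real d / (1 + x)\<^sup>2"
    and "ldiv2 ([:1, 1:] ^ d) p 0 x = 2 * real d / (1 + x) ^ 3"
proof -
  define B :: "real poly" where "B = [:1, 1:] ^ d"
  have b0: "poly B x > 0" using assms by (simp add: B_def poly_power add.commute)
  define t where "t = 1 + x"
  have t: "t > 0" using assms by (simp add: t_def)
  note D = binomial_poly_derivs[where x = x and d = d, folded t_def B_def]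
  have q1: "poly (pderiv B) x / poly B x = real d / t"
    using D(1) b0 t by (simp add: field_simps)
  have q2: "poly (pderiv (pderiv B)) x / poly B x = (real d - 1) * real d / t\<^sup>2"
  proof -
    have "poly (pderiv (pderiv B)) x / poly B x = (real d - 1) / t * (poly (pderiv B) x / poly B x)"
      using D(2) b0 t by (simp add: field_simps)
    then show ?thesis unfolding q1 by (simp add: power2_eq_square)
  qed
  have q3: "poly (pderiv (pderiv (pderiv B))) x / poly B x = (real d - 2) * (real d - 1) * real d / t ^ 3"
  proof -
    have "poly (pderiv (pderiv (pderiv B))) x / poly B x = (real d - 2) / t * (poly (pderiv (pderiv B)) x / poly B x)"
      using D(3) b0 t by (simp add: field_simps)
    then show ?thesis unfolding q2 by (simp add: power2_eq_square power3_eq_cube)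
  qed
  have n: "pert B p 0 0 x = poly B x" "pert B p 1 0 x = poly (pderiv B) x"
    "pert B p 2 0 x = poly (pderiv (pderiv B)) x" "pert B p 3 0 x = poly (pderiv (pderiv (pderiv B))) x"
    by (simp_all add: pert_def eval_nat_numeral)
  show "ldiv0 ([:1, 1:] ^ d) p 0 x = real d / (1 + x)"
    unfolding ldiv0_def B_def[symmetric] n q1 by (simp add: t_def)
  show "ldiv1 ([:1, 1:] ^ d) p 0 x = - real d / (1 + x)\<^sup>2"
    unfolding ldiv1_def B_def[symmetric] n q1 q2 t_def[symmetric] using t
    by (simp add: field_simps power2_eq_square)
  show "ldiv2 ([:1, 1:] ^ d) p 0 x = 2 * real d / (1 + x) ^ 3"
    unfolding ldiv2_def B_def[symmetric] n q1 q2 q3 t_def[symmetric] using t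
    by (simp add: field_simps power2_eq_square power3_eq_cube)
qed

section \<open>The cycle equations on a logarithmic scale\<close>

locale perturbed_recursion =
  fixes d :: nat and p r :: "real poly" and h0 lo hi :: real
  assumes d2: "d \<ge> 2" and h0: "h0 > 0" and lo: "lo > 0"
    and S_pos: "\<And>x h. x \<in> {lo..hi} \<Longrightarrow> h \<in> {0..h0} \<Longrightarrow> pert ([:1, 1:] ^ d) p 0 h x > 0"
    and T_pos: "\<And>x h. x \<in> {lo..hi} \<Longrightarrow> h \<in> {0..h0} \<Longrightarrow> pert ([:1, 1:] ^ d) r 0 h x > 0"
begin

abbreviation "S h x \<equiv> pert ([:1, 1:] ^ d) p 0 h x"
abbreviation "T h x \<equiv> pert ([:1, 1:] ^ d) r 0 h x"

text \<open>The derivatives of \<open>ln (S h x) - ln (T h x)\<close>. They vanish at h = 0, where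
  both polynomials equal \<open>(1 + x) ^ d\<close>, so \<open>e\<close> has no influence
  there.\<close>

definition "\<rho>0 h x = ldiv0 ([:1, 1:] ^ d) p h x - ldiv0 ([:1, 1:] ^ d) r h x"
definition "\<rho>1 h x = ldiv1 ([:1, 1:] ^ d) p h x - ldiv1 ([:1, 1:] ^ d) r h x"
definition "\<rho>2 h x = ldiv2 ([:1, 1:] ^ d) p h x - ldiv2 ([:1, 1:] ^ d) r h x"

text \<open>For \<open>e = d\<close> the equations \<open>lnA u + lnM l = lnA l + lnM u = ln lam\<close> describe the two-cycles of the
  message recursion; for \<open>e = 0\<close> they describe the bounding system when the message ratio decreases.\<close>

definition "lnA e h x = ln x + e * (ln (S h x) - ln (T h x))"
definition "lnM e h x = ln (S h x) + (real d - e) * (ln (S h x) - ln (T h x))"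
definition "a0 e h x = 1 / x + e * \<rho>0 h x"
definition "a1 e h x = - 1 / x\<^sup>2 + e * \<rho>1 h x"
definition "a2 e h x = 2 / x ^ 3 + e * \<rho>2 h x"
definition "s0 e h x = ldiv0 ([:1, 1:] ^ d) p h x + (real d - e) * \<rho>0 h x"
definition "s1 e h x = ldiv1 ([:1, 1:] ^ d) p h x + (real d - e) * \<rho>1 h x"
definition "s2 e h x = ldiv2 ([:1, 1:] ^ d) p h x + (real d - e) * \<rho>2 h x"

lemma derivs:
  assumes x: "x \<in> {lo..hi}" and h: "h \<in> {0..h0}"
  shows "(lnA e h has_real_derivative a0 e h x) (at x)"
    "(lnM e h has_real_derivative s0 e h x) (at x)"
    "(a0 e h has_real_derivative a1 e h x) (at x)"
    "(s0 e h has_real_derivative s1 e h x) (at x)"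
    "(a1 e h has_real_derivative a2 e h x) (at x)"
    "(s1 e h has_real_derivative s2 e h x) (at x)"
proof -
  have x0: "x > 0" using x lo by auto
  note S = S_pos[OF x h] and T = T_pos[OF x h]
  note D = DERIV_ln_pert[OF S] DERIV_ln_pert[OF T] DERIV_ldiv0[OF S] DERIV_ldiv0[OF T] DERIV_ldiv1[OF S] DERIV_ldiv1[OF T]
  have r0: "(\<rho>0 h has_real_derivative \<rho>1 h x) (at x)"
    unfolding \<rho>0_def[abs_def] \<rho>1_def by (intro DERIV_diff D)
  have r1: "(\<rho>1 h has_real_derivative \<rho>2 h x) (at x)"
    unfolding \<rho>1_def[abs_def] \<rho>2_def by (intro DERIV_diff D)
  show "(lnA e h has_real_derivative a0 e h x) (at x)"
    unfolding lnA_def[abs_def] a0_def \<rho>0_def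
    using DERIV_add[OF DERIV_ln[OF x0] DERIV_cmult[OF DERIV_diff[OF D(1,2)], of e]]
    by (simp add: inverse_eq_divide)
  show "(lnM e h has_real_derivative s0 e h x) (at x)"
    unfolding lnM_def[abs_def] s0_def \<rho>0_def
    using DERIV_add[OF D(1) DERIV_cmult[OF DERIV_diff[OF D(1,2)], of "real d - e"]] .
  show "(a0 e h has_real_derivative a1 e h x) (at x)"
    unfolding a0_def[abs_def] a1_def
    using x0 by (auto intro!: derivative_eq_intros r0 simp: field_simps power2_eq_square)
  show "(s0 e h has_real_derivative s1 e h x) (at x)"
    unfolding s0_def[abs_def] s1_def
    by (auto intro!: derivative_eq_intros D r0)
  show "(a1 e h has_real_derivative a2 e h x) (at x)"
    unfolding a1_def[abs_def] a2_def
    using x0 by (auto intro!: derivative_eq_intros r1 simp: field_simps power2_eq_square power3_eq_cube)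
  show "(s1 e h has_real_derivative s2 e h x) (at x)"
    unfolding s1_def[abs_def] s2_def
    by (auto intro!: derivative_eq_intros D r1)
qed

lemma cont_ldiv:
  assumes "\<And>x h. x \<in> {lo..hi} \<Longrightarrow> h \<in> {0..h0} \<Longrightarrow> pert B q 0 h x > 0"
  shows "continuous_on ({lo..hi} \<times> {0..h0}) (\<lambda>z. ldiv0 B q (snd z) (fst z))"
    "continuous_on ({lo..hi} \<times> {0..h0}) (\<lambda>z. ldiv1 B q (snd z) (fst z))"
    "continuous_on ({lo..hi} \<times> {0..h0}) (\<lambda>z. ldiv2 B q (snd z) (fst z))"
proof -
  have c: "continuous_on ({lo..hi} \<times> {0..h0}) (\<lambda>z. pert B q n (snd z) (fst z))" for n
    unfolding pert_def by (intro continuous_intros)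
  have n0: "\<forall>z\<in>{lo..hi} \<times> {0..h0}. pert B q 0 (snd z) (fst z) \<noteq> 0"
    using assms by (metis less_irrefl mem_Times_iff)
  show "continuous_on ({lo..hi} \<times> {0..h0}) (\<lambda>z. ldiv0 B q (snd z) (fst z))"
    unfolding ldiv0_def by (intro continuous_intros c n0)
  show "continuous_on ({lo..hi} \<times> {0..h0}) (\<lambda>z. ldiv1 B q (snd z) (fst z))"
    unfolding ldiv1_def by (intro continuous_intros c n0)
  show "continuous_on ({lo..hi} \<times> {0..h0}) (\<lambda>z. ldiv2 B q (snd z) (fst z))"
    unfolding ldiv2_def by (intro continuous_intros c n0)
qed

lemma cont_as:
  shows "continuous_on ({lo..hi} \<times> {0..h0}) (\<lambda>z. a0 e (snd z) (fst z))"
    "continuous_on ({lo..hi} \<times> {0..h0}) (\<lambda>z. a1 e (snd z) (fst z))"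
    "continuous_on ({lo..hi} \<times> {0..h0}) (\<lambda>z. a2 e (snd z) (fst z))"
    "continuous_on ({lo..hi} \<times> {0..h0}) (\<lambda>z. s0 e (snd z) (fst z))"
    "continuous_on ({lo..hi} \<times> {0..h0}) (\<lambda>z. s1 e (snd z) (fst z))"
    "continuous_on ({lo..hi} \<times> {0..h0}) (\<lambda>z. s2 e (snd z) (fst z))"
proof -
  have n0: "\<forall>z\<in>{lo..hi} \<times> {0..h0}. fst z \<noteq> 0" "\<forall>z\<in>{lo..hi} \<times> {0..h0}. (fst z)\<^sup>2 \<noteq> 0"
    "\<forall>z\<in>{lo..hi} \<times> {0..h0}. (fst z) ^ 3 \<noteq> 0"
    using lo by auto
  note C = cont_ldiv[OF S_pos] cont_ldiv[OF T_pos]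
  show "continuous_on ({lo..hi} \<times> {0..h0}) (\<lambda>z. a0 e (snd z) (fst z))"
    unfolding a0_def \<rho>0_def by (intro continuous_intros C n0)
  show "continuous_on ({lo..hi} \<times> {0..h0}) (\<lambda>z. a1 e (snd z) (fst z))"
    unfolding a1_def \<rho>1_def by (intro continuous_intros C n0)
  show "continuous_on ({lo..hi} \<times> {0..h0}) (\<lambda>z. a2 e (snd z) (fst z))"
    unfolding a2_def \<rho>2_def by (intro continuous_intros C n0)
  show "continuous_on ({lo..hi} \<times> {0..h0}) (\<lambda>z. s0 e (snd z) (fst z))"
    unfolding s0_def \<rho>0_def by (intro continuous_intros C n0)
  show "continuous_on ({lo..hi} \<times> {0..h0}) (\<lambda>z. s1 e (snd z) (fst z))"
    unfolding s1_def \<rho>1_def by (intro continuous_intros C n0)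
  show "continuous_on ({lo..hi} \<times> {0..h0}) (\<lambda>z. s2 e (snd z) (fst z))"
    unfolding s2_def \<rho>2_def by (intro continuous_intros C n0)
qed

text \<open>The quantity in the hypothesis of \<open>schwarzian_pair\<close>: the difference of the
  Schwarzians of \<open>lnA\<close> and \<open>lnM\<close>, multiplied by the squares of both first
  derivatives.\<close>

definition "schw e h x = (s0 e h x)\<^sup>2 * (a2 e h x * a0 e h x - 3 / 2 * (a1 e h x)\<^sup>2)
  - (a0 e h x)\<^sup>2 * (s2 e h x * s0 e h x - 3 / 2 * (s1 e h x)\<^sup>2)"

lemma at_zero:
  assumes "x > 0"
  shows "a0 e 0 x = 1 / x" "a1 e 0 x = - 1 / x\<^sup>2" "a2 e 0 x = 2 / x ^ 3"
    "s0 e 0 x = real d / (1 + x)" "s1 e 0 x = - real d / (1 + x)\<^sup>2" "s2 e 0 x = 2 * real d / (1 + x) ^ 3"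
  using assms ldiv_binomial[of x d] by (simp_all add: a0_def a1_def a2_def s0_def s1_def s2_def \<rho>0_def \<rho>1_def \<rho>2_def)

text \<open>At h = 0 the two functions are ln x and d ln(1 + x), with Schwarzians 1 / (2 x^2) and 1
  / (2 (1 + x)^2).\<close>

lemma schw_at_zero:
  assumes x: "x > 0"
  shows "schw e 0 x > 0"
proof -
  define t where "t = 1 + x"
  have t: "t > x" "t > 0" using x by (auto simp: t_def)
  have "schw e 0 x = (real d)\<^sup>2 / (2 * x\<^sup>2 * t\<^sup>2) * (1 / x\<^sup>2 - 1 / t\<^sup>2)"
    unfolding schw_def at_zero[OF x] t_def[symmetric] using x t
    by (simp add: field_simps power2_eq_square power3_eq_cube)
  moreover have "1 / t\<^sup>2 < 1 / x\<^sup>2"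
    using x t by (intro divide_strict_left_mono power_strict_mono) auto
  ultimately show ?thesis using x t d2 by simp
qed

text \<open>Strict inequalities at h = 0 survive on the compact interval. The last one makes
  \<open>x * (a0 e h x - s0 e h x)\<close> strictly decreasing; at h = 0 this product is 1 - d x /
  (1 + x). The factor x matters, since 1 / x - d / (1 + x) is not monotone on the whole
  half-line.\<close>

lemma regular:
  "\<exists>\<epsilon>>0. \<epsilon> \<le> h0 \<and> (\<forall>h\<in>{0..\<epsilon>}. \<forall>x\<in>{lo..hi}. a0 e h x > 0 \<and> s0 e h x > 0 \<and> schw e h x > 0 \<and>
     (a0 e h x - s0 e h x) + x * (a1 e h x - s1 e h x) < 0)"
proof -
  have d0: "real d > 0" using d2 by simp
  have ev: "\<exists>\<epsilon>>0. \<epsilon> \<le> h0 \<and> (\<forall>h\<in>{0..\<epsilon>}. \<forall>x\<in>{lo..hi}. F h x > 0)"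
    if "continuous_on ({lo..hi} \<times> {0..h0}) (\<lambda>z. F (snd z) (fst z))" "\<And>x. x > 0 \<Longrightarrow> F 0 x > 0"
    for F :: "real \<Rightarrow> real \<Rightarrow> real"
    using pos_near_compact_section[OF h0 that(1)] that(2) lo by force
  obtain e1 where e1: "e1 > 0" "e1 \<le> h0" "\<And>h x. h \<in> {0..e1} \<Longrightarrow> x \<in> {lo..hi} \<Longrightarrow> a0 e h x > 0"
    using ev[of "a0 e"] cont_as at_zero(1) by auto
  obtain e2 where e2: "e2 > 0" "e2 \<le> h0" "\<And>h x. h \<in> {0..e2} \<Longrightarrow> x \<in> {lo..hi} \<Longrightarrow> s0 e h x > 0"
    using ev[of "s0 e"] cont_as at_zero(4) d0 by auto
  have "continuous_on ({lo..hi} \<times> {0..h0}) (\<lambda>z. schw e (snd z) (fst z))"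
    unfolding schw_def by (intro continuous_intros cont_as)
  then obtain e3 where e3: "e3 > 0" "e3 \<le> h0" "\<And>h x. h \<in> {0..e3} \<Longrightarrow> x \<in> {lo..hi} \<Longrightarrow> schw e h x > 0"
    using ev[of "schw e"] schw_at_zero by auto
  define F where "F h x = - ((a0 e h x - s0 e h x) + x * (a1 e h x - s1 e h x))" for h x
  have "continuous_on ({lo..hi} \<times> {0..h0}) (\<lambda>z. F (snd z) (fst z))"
    unfolding F_def by (intro continuous_intros cont_as)
  moreover have "F 0 x > 0" if "x > 0" for x
  proof -
    define t where "t = 1 + x"
    have t: "t > 0" "t - x = 1" using that by (auto simp: t_def)
    have "x * (- 1 / x\<^sup>2 - - real d / t\<^sup>2) = - (1 / x) + x * real d / t\<^sup>2"
      using that by (simp add: field_simps power2_eq_square)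
    then have "F 0 x = real d / t - x * real d / t\<^sup>2"
      unfolding F_def at_zero[OF that] t_def[symmetric] by simp
    also have "\<dots> = real d * (t - x) / t\<^sup>2"
      using t(1) by (simp add: field_simps power2_eq_square)
    finally have "F 0 x = real d / (1 + x)\<^sup>2" by (simp add: t(2) t_def[symmetric])
    then show ?thesis using d0 that by simp
  qed
  ultimately obtain e4 where e4: "e4 > 0" "e4 \<le> h0" "\<And>h x. h \<in> {0..e4} \<Longrightarrow> x \<in> {lo..hi} \<Longrightarrow> F h x > 0"
    using ev[of F] by auto
  show ?thesis
  proof (intro exI[of _ "min (min e1 e2) (min e3 e4)"] conjI ballI)
    fix h x assume hx: "h \<in> {0..min (min e1 e2) (min e3 e4)}" "x \<in> {lo..hi}"
    then show "a0 e h x > 0" "s0 e h x > 0" "schw e h x > 0"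
      using e1(3)[of h x] e2(3)[of h x] e3(3)[of h x] by auto
    show "(a0 e h x - s0 e h x) + x * (a1 e h x - s1 e h x) < 0"
      using hx e4(3)[of h x] unfolding F_def by auto
  qed (use e1 e2 e3 e4 in auto)
qed

end

section \<open>First-order analysis at the critical fixed point\<close>

lemma DERIV_poly_chain:
  "(g has_real_derivative g') (at x) \<Longrightarrow> ((\<lambda>x. poly q (g x)) has_real_derivative g' * poly (pderiv q) (g x)) (at x)"
  using DERIV_chain2[OF poly_DERIV, of g g' x UNIV q] by (simp add: mult.commute)

lemma small_pos_of_deriv_pos:
  fixes f :: "real \<Rightarrow> real"
  assumes "(f has_real_derivative D) (at 0)" "D > 0" "f 0 = 0"
  shows "\<exists>\<epsilon>>0. \<forall>h\<in>{0<..<\<epsilon>}. f h > 0"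
proof -
  obtain e where "e > 0" "\<forall>h>0. h < e \<longrightarrow> f 0 < f (0 + h)"
    using DERIV_pos_inc_right[OF assms(1,2)] by auto
  then show ?thesis using assms(3) by (intro exI[of _ e]) auto
qed

context perturbed_recursion
begin

text \<open>The solution of \<open>a0 = s0\<close> at h = 0, that is of 1 / x = d / (1 + x).\<close>

definition "x0 = 1 / (real d - 1)"
text \<open>At h = 0 and x = x0, \<alpha> and \<beta> are the derivatives in h of
  \<open>ln (S h x)\<close> and \<open>ln (T h x)\<close>; the primed versions are those of the
  logarithmic derivatives in x.\<close>

definition "\<alpha> = poly p x0 / (1 + x0) ^ d"
definition "\<beta> = poly r x0 / (1 + x0) ^ d"
definition "\<alpha>' = poly (pderiv p) x0 / (1 + x0) ^ d - real d / (1 + x0) * \<alpha>"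
definition "\<beta>' = poly (pderiv r) x0 / (1 + x0) ^ d - real d / (1 + x0) * \<beta>"

text \<open>Up to a positive factor, the derivative in \<open>h\<close> at \<open>h = 0\<close> of \<open>a0 - s0\<close> at the solution \<open>x\<close> of
  \<open>lnA + lnM = const\<close>, with the displacement of \<open>x\<close> taken into account.\<close>

definition "critical_rate e = (real d - 1) / (2 * real d) * ((real d + 1) * \<alpha> - real d * \<beta>)
   + x0 * ((2 * e - real d) * (\<alpha>' - \<beta>') - \<alpha>')"

lemma x0_props: "x0 > 0" "1 + x0 = real d / (real d - 1)" "1 / x0 = real d - 1" "real d / (1 + x0) = real d - 1"
  using d2 by (auto simp: x0_def field_simps)

text \<open>\<open>e\<close> drops out on the diagonal: the message system and the bounding system
  share their fixed points.\<close>

lemma lnA_lnM_sum: "lnA e h x + lnM e h x = ln x + (real d + 1) * ln (S h x) - real d * ln (T h x)"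
  by (simp add: lnA_def lnM_def algebra_simps)

lemma a0_s0_diff: "a0 e h x - s0 e h x = 1 / x + (2 * e - real d) * \<rho>0 h x - ldiv0 ([:1, 1:] ^ d) p h x"
  by (simp add: a0_def s0_def algebra_simps)

lemma DERIV_S_path:
  "((\<lambda>h. pert ([:1, 1:] ^ d) q 0 h (x0 + \<xi> * h)) has_real_derivative
      \<xi> * (real d * (1 + x0) ^ d / (1 + x0)) + poly q x0) (at 0)"
proof -
  have g: "((\<lambda>h. x0 + \<xi> * h) has_real_derivative \<xi>) (at 0)"
    by (auto intro!: derivative_eq_intros)
  have "(1 + x0) * poly (pderiv ([:1, 1:] ^ d)) x0 = real d * (1 + x0) ^ d"
    using binomial_poly_derivs(1)[of x0 d] by (simp add: poly_power add.commute)
  then have "poly (pderiv ([:1, 1:] ^ d)) x0 = real d * (1 + x0) ^ d / (1 + x0)"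
    using x0_props(1) by (simp add: field_simps)
  then show ?thesis
    unfolding pert_def
    by (auto intro!: derivative_eq_intros DERIV_poly_chain[OF g] simp del: poly_power)
qed

lemma DERIV_ln_S_path:
  "((\<lambda>h. ln (pert ([:1, 1:] ^ d) q 0 h (x0 + \<xi> * h))) has_real_derivative
      \<xi> * (real d - 1) + poly q x0 / (1 + x0) ^ d) (at 0)"
proof -
  have v: "pert ([:1, 1:] ^ d) q 0 0 (x0 + \<xi> * 0) = (1 + x0) ^ d"
    by (simp add: pert_def poly_power add.commute)
  have pos: "(1 + x0) ^ d > 0" using x0_props(1) by simp
  have "((\<lambda>h. ln (pert ([:1, 1:] ^ d) q 0 h (x0 + \<xi> * h))) has_real_derivative
      inverse ((1 + x0) ^ d) * (\<xi> * (real d * (1 + x0) ^ d / (1 + x0)) + poly q x0)) (at 0)"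
    using DERIV_chain2[OF DERIV_ln[of "pert ([:1, 1:] ^ d) q 0 0 (x0 + \<xi> * 0)"] DERIV_S_path] v pos
    by simp
  moreover have "inverse ((1 + x0) ^ d) * (\<xi> * (real d * (1 + x0) ^ d / (1 + x0)) + poly q x0) =
      \<xi> * (real d / (1 + x0)) + poly q x0 / (1 + x0) ^ d"
    using pos x0_props(1) by (simp add: field_simps)
  ultimately show ?thesis unfolding x0_props(4) by simp
qed

lemma DERIV_ldiv0_path:
  "((\<lambda>h. ldiv0 ([:1, 1:] ^ d) q h (x0 + \<xi> * h)) has_real_derivative
      - \<xi> * (real d / (1 + x0)\<^sup>2) + (poly (pderiv q) x0 / (1 + x0) ^ d - real d / (1 + x0) * (poly q x0 / (1 + x0) ^ d))) (at 0)"
proof -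
  define B :: "real poly" where "B = [:1, 1:] ^ d"
  define t where "t = 1 + x0"
  define b where "b = t ^ d"
  have t: "t > 0" "b > 0" using x0_props(1) by (auto simp: t_def b_def)
  have Bx: "poly B x0 = b" by (simp add: B_def b_def t_def poly_power add.commute)
  note D = binomial_poly_derivs[of x0 d, folded B_def t_def]
  have B1: "poly (pderiv B) x0 = real d * b / t" using D(1) t by (simp add: Bx field_simps)
  have B2: "poly (pderiv (pderiv B)) x0 = (real d - 1) * real d * b / t\<^sup>2"
    using D(2) t unfolding B1 by (simp add: field_simps power2_eq_square)
  have g: "((\<lambda>h. x0 + \<xi> * h) has_real_derivative \<xi>) (at 0)"
    by (auto intro!: derivative_eq_intros)
  have n1: "((\<lambda>h. poly (pderiv B) (x0 + \<xi> * h) + h * poly (pderiv q) (x0 + \<xi> * h)) has_real_derivative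
      \<xi> * poly (pderiv (pderiv B)) x0 + poly (pderiv q) x0) (at 0)"
    by (auto intro!: derivative_eq_intros DERIV_poly_chain[OF g])
  have n0: "((\<lambda>h. poly B (x0 + \<xi> * h) + h * poly q (x0 + \<xi> * h)) has_real_derivative
      \<xi> * poly (pderiv B) x0 + poly q x0) (at 0)"
    by (auto intro!: derivative_eq_intros DERIV_poly_chain[OF g])
  have "((\<lambda>h. ldiv0 B q h (x0 + \<xi> * h)) has_real_derivative
      ((\<xi> * poly (pderiv (pderiv B)) x0 + poly (pderiv q) x0) * poly B x0 - poly (pderiv B) x0 * (\<xi> * poly (pderiv B) x0 + poly q x0)) / (poly B x0 * poly B x0)) (at 0)"
    using DERIV_divide[OF n1 n0] Bx t by (simp add: ldiv0_def pert_def)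
  moreover have "((\<xi> * poly (pderiv (pderiv B)) x0 + poly (pderiv q) x0) * poly B x0 - poly (pderiv B) x0 * (\<xi> * poly (pderiv B) x0 + poly q x0)) / (poly B x0 * poly B x0)
     = - \<xi> * (real d / t\<^sup>2) + (poly (pderiv q) x0 / b - real d / t * (poly q x0 / b))"
    unfolding B1 B2 Bx using t by (simp add: field_simps power2_eq_square)
  ultimately show ?thesis by (simp add: B_def t_def b_def)
qed

text \<open>To first order \<open>x0 + u * h\<close> is the fixed point and
  \<open>x0 + v * h\<close> the zero of \<open>a0 - s0\<close>, and the rate is a positive multiple
  of \<open>v - u\<close>. At a point midway between the two, both expressions have the sign
  \<sigma>.\<close>

lemma first_order_aux:
  assumes x0: "lo < x0" "x0 < hi" and \<sigma>: "\<sigma> = 1 \<or> \<sigma> = -1" and rate: "\<sigma> * critical_rate e > 0"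
  shows "\<exists>\<xi>. \<exists>\<epsilon>>0. \<forall>h\<in>{0<..<\<epsilon>}. x0 + \<xi> * h \<in> {lo..hi} \<and>
     \<sigma> * (lnA e h (x0 + \<xi> * h) + lnM e h (x0 + \<xi> * h) - ln (x0 * (1 + x0) ^ d)) > 0 \<and>
     \<sigma> * (a0 e h (x0 + \<xi> * h) - s0 e h (x0 + \<xi> * h)) > 0"
proof -
  define \<gamma> where "\<gamma> = (real d + 1) * \<alpha> - real d * \<beta>"
  define \<delta> where "\<delta> = x0 * ((2 * e - real d) * (\<alpha>' - \<beta>') - \<alpha>')"
  have d1: "real d > 1" using d2 by simp
  \<comment> \<open>The value of \<xi> at which the derivative of \<open>f1\<close> below vanishes;
    \<open>v\<close> plays the same part for \<open>f2\<close>.\<close>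
  define u where "u = - \<gamma> / (2 * (real d - 1))"
  define v where "v = real d / (real d - 1)\<^sup>2 * \<delta>"
  have v1: "(real d - 1)\<^sup>2 / real d * v = \<delta>"
    using d1 by (simp add: v_def)
  moreover have "(real d - 1)\<^sup>2 / real d * u = - ((real d - 1) / (2 * real d) * \<gamma>)"
  proof -
    have "k\<^sup>2 / real d * (- \<gamma> / (2 * k)) = - (k / (2 * real d) * \<gamma>)" if "k > 0" for k :: real
      using that by (simp add: power2_eq_square)
    from this[of "real d - 1"] d1 show ?thesis by (simp add: u_def)
  qed
  ultimately have "critical_rate e = (real d - 1)\<^sup>2 / real d * (v - u)"
    unfolding critical_rate_def \<gamma>_def[symmetric] \<delta>_def[symmetric] by (simp only: right_diff_distrib)
  then have uv: "\<sigma> * (v - u) > 0"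
  proof -
    have "(real d - 1)\<^sup>2 / real d * (\<sigma> * (v - u)) > 0"
      using rate \<open>critical_rate e = _\<close> by (simp only: mult.left_commute)
    moreover have "(real d - 1)\<^sup>2 / real d > 0" using d1 by simp
    ultimately show ?thesis by (simp only: zero_less_mult_pos)
  qed
  define \<xi> where "\<xi> = (u + v) / 2"
  have \<xi>: "\<sigma> * (\<xi> - u) > 0" "\<sigma> * (v - \<xi>) > 0" using uv by (auto simp: \<xi>_def field_simps)
  define f1 where "f1 h = \<sigma> * (lnA e h (x0 + \<xi> * h) + lnM e h (x0 + \<xi> * h) - ln (x0 * (1 + x0) ^ d))" for h
  define f2 where "f2 h = \<sigma> * ((x0 + \<xi> * h) * (1 / (x0 + \<xi> * h) + (2 * e - real d) * \<rho>0 h (x0 + \<xi> * h) - ldiv0 ([:1, 1:] ^ d) p h (x0 + \<xi> * h)))" for h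
  have g: "((\<lambda>h. x0 + \<xi> * h) has_real_derivative \<xi>) (at 0)"
    by (auto intro!: derivative_eq_intros)
  have lnx: "((\<lambda>h. ln (x0 + \<xi> * h)) has_real_derivative \<xi> * (real d - 1)) (at 0)"
    using x0_props(1) by (auto intro!: derivative_eq_intros simp: x0_props(3)[symmetric])
  have df1: "(f1 has_real_derivative \<sigma> * (2 * (real d - 1) * (\<xi> - u))) (at 0)"
  proof -
    have "(f1 has_real_derivative \<sigma> * (\<xi> * (real d - 1) + (real d + 1) * (\<xi> * (real d - 1) + \<alpha>) - real d * (\<xi> * (real d - 1) + \<beta>))) (at 0)"
      unfolding f1_def lnA_lnM_sum \<alpha>_def \<beta>_def
      by (intro DERIV_cmult) (rule derivative_eq_intros lnx DERIV_cmult DERIV_ln_S_path refl | simp)+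
    moreover have "\<xi> * (real d - 1) + (real d + 1) * (\<xi> * (real d - 1) + \<alpha>) - real d * (\<xi> * (real d - 1) + \<beta>) = 2 * (real d - 1) * (\<xi> - u)"
      using d1 by (simp add: u_def \<gamma>_def field_simps)
    ultimately show ?thesis by simp
  qed
  have f10: "f1 0 = 0"
  proof -
    have "ln (x0 * (1 + x0) ^ d) = ln x0 + real d * ln (1 + x0)"
      using x0_props(1) by (simp add: ln_mult ln_realpow)
    moreover have "ln ((1 + x0) ^ d) = real d * ln (1 + x0)"
      using x0_props(1) by (simp add: ln_realpow)
    moreover have "S 0 x0 = (1 + x0) ^ d" "T 0 x0 = (1 + x0) ^ d"
      by (auto simp: pert_def poly_power add.commute)
    ultimately show ?thesis by (simp add: f1_def lnA_lnM_sum algebra_simps)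
  qed
  have df2: "(f2 has_real_derivative \<sigma> * ((real d - 1)\<^sup>2 / real d * (v - \<xi>))) (at 0)"
  proof -
    have r: "((\<lambda>h. \<rho>0 h (x0 + \<xi> * h)) has_real_derivative \<alpha>' - \<beta>') (at 0)"
      using DERIV_diff[OF DERIV_ldiv0_path[of p \<xi>, folded \<alpha>_def, folded \<alpha>'_def]
        DERIV_ldiv0_path[of r \<xi>, folded \<beta>_def, folded \<beta>'_def]]
      by (simp add: \<rho>0_def)
    have l: "((\<lambda>h. ldiv0 ([:1, 1:] ^ d) p h (x0 + \<xi> * h)) has_real_derivative - \<xi> * (real d / (1 + x0)\<^sup>2) + \<alpha>') (at 0)"
      using DERIV_ldiv0_path[of p \<xi>] by (simp add: \<alpha>'_def \<alpha>_def)
    have inv: "((\<lambda>h. 1 / (x0 + \<xi> * h)) has_real_derivative - \<xi> / x0\<^sup>2) (at 0)"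
      using x0_props(1) by (auto intro!: derivative_eq_intros simp: power2_eq_square)
    have r0: "\<rho>0 0 x0 = 0" "ldiv0 ([:1, 1:] ^ d) p 0 x0 = real d - 1"
      using ldiv_binomial(1)[of x0 d] x0_props(1,4) by (auto simp: \<rho>0_def)
    have "((\<lambda>h. (x0 + \<xi> * h) * (1 / (x0 + \<xi> * h) + (2 * e - real d) * \<rho>0 h (x0 + \<xi> * h) - ldiv0 ([:1, 1:] ^ d) p h (x0 + \<xi> * h))) has_real_derivative
       \<xi> * (1 / (x0 + \<xi> * 0) + (2 * e - real d) * \<rho>0 0 (x0 + \<xi> * 0) - ldiv0 ([:1, 1:] ^ d) p 0 (x0 + \<xi> * 0))
       + (- \<xi> / x0\<^sup>2 + (2 * e - real d) * (\<alpha>' - \<beta>') - (- \<xi> * (real d / (1 + x0)\<^sup>2) + \<alpha>')) * (x0 + \<xi> * 0)) (at 0)"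
      by (intro DERIV_mult g DERIV_diff DERIV_add inv DERIV_cmult r l)
    moreover have "\<xi> * (1 / (x0 + \<xi> * 0) + (2 * e - real d) * \<rho>0 0 (x0 + \<xi> * 0) - ldiv0 ([:1, 1:] ^ d) p 0 (x0 + \<xi> * 0))
       + (- \<xi> / x0\<^sup>2 + (2 * e - real d) * (\<alpha>' - \<beta>') - (- \<xi> * (real d / (1 + x0)\<^sup>2) + \<alpha>')) * (x0 + \<xi> * 0)
       = (real d - 1)\<^sup>2 / real d * (v - \<xi>)"
    proof -
      have z: "1 / (x0 + \<xi> * 0) + (2 * e - real d) * \<rho>0 0 (x0 + \<xi> * 0) - ldiv0 ([:1, 1:] ^ d) p 0 (x0 + \<xi> * 0) = 0"
        using r0 x0_props(3) by simp
      have i: "\<xi> / x0\<^sup>2 * x0 = \<xi> * (real d - 1)"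
        using x0_props(1) by (simp add: x0_props(3)[symmetric] power2_eq_square)
      have ii: "\<xi> * (real d / (1 + x0)\<^sup>2) * x0 = \<xi> * ((real d - 1) / real d)"
      proof -
        have "real d / (1 + x0)\<^sup>2 = (real d - 1)\<^sup>2 / real d"
          unfolding x0_props(2) using d1 by (simp add: field_simps power2_eq_square)
        moreover have "(real d - 1)\<^sup>2 * x0 = real d - 1"
          using d1 by (simp add: x0_def power2_eq_square)
        ultimately show ?thesis by (simp add: mult.assoc)
      qed
      have "\<xi> * (1 / (x0 + \<xi> * 0) + (2 * e - real d) * \<rho>0 0 (x0 + \<xi> * 0) - ldiv0 ([:1, 1:] ^ d) p 0 (x0 + \<xi> * 0))
       + (- \<xi> / x0\<^sup>2 + (2 * e - real d) * (\<alpha>' - \<beta>') - (- \<xi> * (real d / (1 + x0)\<^sup>2) + \<alpha>')) * (x0 + \<xi> * 0)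
       = - (\<xi> / x0\<^sup>2 * x0) + \<xi> * (real d / (1 + x0)\<^sup>2) * x0 + \<delta>"
        unfolding z by (simp add: \<delta>_def algebra_simps)
      also have "\<dots> = (real d - 1)\<^sup>2 / real d * (v - \<xi>)"
        unfolding i ii right_diff_distrib v1 using d1 by (simp add: field_simps power2_eq_square)
      finally show ?thesis .
    qed
    ultimately show ?thesis unfolding f2_def by (intro DERIV_cmult) simp
  qed
  have f20: "f2 0 = 0"
    using ldiv_binomial(1)[of x0 d] x0_props(1,3,4) by (simp add: f2_def \<rho>0_def)
  have c2: "(real d - 1)\<^sup>2 / real d > 0" using d1 by simp
  have p1: "\<sigma> * (2 * (real d - 1) * (\<xi> - u)) > 0"
    using \<xi>(1) d1 by (simp add: mult.left_commute[of \<sigma>])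
  have p2: "\<sigma> * ((real d - 1)\<^sup>2 / real d * (v - \<xi>)) > 0"
    unfolding mult.left_commute[of \<sigma>] using \<xi>(2) c2 by (rule mult_pos_pos[rotated])
  obtain e1 where e1: "e1 > 0" "\<And>h. h \<in> {0<..<e1} \<Longrightarrow> f1 h > 0"
    using small_pos_of_deriv_pos[OF df1 p1 f10] by auto
  obtain e2 where e2: "e2 > 0" "\<And>h. h \<in> {0<..<e2} \<Longrightarrow> f2 h > 0"
    using small_pos_of_deriv_pos[OF df2 p2 f20] by auto
  \<comment> \<open>Keeps the test point inside the interval; adding 1 to
    \<open>\<bar>\<xi>\<bar>\<close> avoids a zero denominator.\<close>
  define e3 where "e3 = min (x0 - lo) (hi - x0) / (1 + \<bar>\<xi>\<bar>)"
  have e3: "e3 > 0" using x0 by (simp add: e3_def)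
  have in_range: "x0 + \<xi> * h \<in> {lo..hi}" if "h \<in> {0<..<e3}" for h
  proof -
    have "\<bar>\<xi> * h\<bar> \<le> (1 + \<bar>\<xi>\<bar>) * h" using that by (simp add: abs_mult algebra_simps)
    also have "\<dots> \<le> min (x0 - lo) (hi - x0)"
      using that by (simp add: e3_def field_simps)
    finally show ?thesis by auto
  qed
  show ?thesis
  proof (rule exI[of _ \<xi>], rule exI[of _ "min (min e1 e2) e3"], intro conjI ballI)
    fix h assume h: "h \<in> {0<..<min (min e1 e2) e3}"
    show r: "x0 + \<xi> * h \<in> {lo..hi}" using in_range h by auto
    show "\<sigma> * (lnA e h (x0 + \<xi> * h) + lnM e h (x0 + \<xi> * h) - ln (x0 * (1 + x0) ^ d)) > 0"
      using e1(2)[of h] h by (simp add: f1_def)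
    have "(x0 + \<xi> * h) * (\<sigma> * (a0 e h (x0 + \<xi> * h) - s0 e h (x0 + \<xi> * h))) > 0"
      using e2(2)[of h] h unfolding f2_def a0_s0_diff by (simp add: mult.left_commute)
    moreover have "x0 + \<xi> * h > 0" using r lo by auto
    ultimately show "\<sigma> * (a0 e h (x0 + \<xi> * h) - s0 e h (x0 + \<xi> * h)) > 0"
      by (simp only: zero_less_mult_pos)
  qed (use e1 e2 e3 in auto)
qed

text \<open>\<open>lnA + lnM\<close> increases, so for \<sigma> = 1 the test point is not below any
  fixed point, and for \<sigma> = -1 not above. As \<open>x * (a0 - s0)\<close> decreases, its sign
  at the test point carries over to the fixed point.\<close>

lemma fixed_point_sign:
  assumes x0: "lo < x0" "x0 < hi" and \<sigma>: "\<sigma> = 1 \<or> \<sigma> = -1" and rate: "\<sigma> * critical_rate e > 0"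
  shows "\<exists>\<epsilon>>0. \<epsilon> \<le> h0 \<and> (\<forall>h\<in>{0<..<\<epsilon>}. \<forall>x\<in>{lo..hi}.
     lnA e h x + lnM e h x = ln (x0 * (1 + x0) ^ d) \<longrightarrow> \<sigma> * (a0 e h x - s0 e h x) > 0)"
proof -
  obtain e1 where e1: "e1 > 0" "e1 \<le> h0" and reg: "\<And>h x. h \<in> {0..e1} \<Longrightarrow> x \<in> {lo..hi} \<Longrightarrow> a0 e h x > 0 \<and> s0 e h x > 0 \<and>
     (a0 e h x - s0 e h x) + x * (a1 e h x - s1 e h x) < 0"
    using regular[of e] by blast
  obtain \<xi> e2 where e2: "e2 > 0" and q: "\<And>h. h \<in> {0<..<e2} \<Longrightarrow> x0 + \<xi> * h \<in> {lo..hi}"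
     "\<And>h. h \<in> {0<..<e2} \<Longrightarrow> \<sigma> * (lnA e h (x0 + \<xi> * h) + lnM e h (x0 + \<xi> * h) - ln (x0 * (1 + x0) ^ d)) > 0"
     "\<And>h. h \<in> {0<..<e2} \<Longrightarrow> \<sigma> * (a0 e h (x0 + \<xi> * h) - s0 e h (x0 + \<xi> * h)) > 0"
    using first_order_aux[OF assms] by blast
  show ?thesis
  proof (intro exI[of _ "min e1 e2"] conjI ballI impI)
    fix h x assume h: "h \<in> {0<..<min e1 e2}" and x: "x \<in> {lo..hi}"
      and fp: "lnA e h x + lnM e h x = ln (x0 * (1 + x0) ^ d)"
    have h': "h \<in> {0..h0}" "h \<in> {0..e1}" "h \<in> {0<..<e2}" using h e1 by auto
    define q where "q = x0 + \<xi> * h"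
    note qh = q(1)[OF h'(3), folded q_def] q(2)[OF h'(3), folded q_def] q(3)[OF h'(3), folded q_def]
    have P_mono: "lnA e h y + lnM e h y \<le> lnA e h z + lnM e h z" if "y \<in> {lo..hi}" "z \<in> {lo..hi}" "y \<le> z" for y z
    proof (rule DERIV_nonneg_imp_nondecreasing[OF that(3)])
      fix w assume "y \<le> w" "w \<le> z"
      then have w: "w \<in> {lo..hi}" using that by auto
      show "\<exists>D. ((\<lambda>a. lnA e h a + lnM e h a) has_real_derivative D) (at w) \<and> D \<ge> 0"
        using DERIV_add[OF derivs(1)[OF w h'(1)] derivs(2)[OF w h'(1)]] reg[OF h'(2) w]
        by (intro exI[of _ "a0 e h w + s0 e h w"]) auto
    qed
    define G where "G y = y * (a0 e h y - s0 e h y)" for y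
    have G_mono: "G z \<le> G y" if "y \<in> {lo..hi}" "z \<in> {lo..hi}" "y \<le> z" for y z
    proof (rule DERIV_nonpos_imp_nonincreasing[OF that(3)])
      fix w assume "y \<le> w" "w \<le> z"
      then have w: "w \<in> {lo..hi}" using that by auto
      have "(G has_real_derivative (a0 e h w - s0 e h w) + w * (a1 e h w - s1 e h w)) (at w)"
        unfolding G_def by (auto intro!: derivative_eq_intros derivs[OF w h'(1)] simp: algebra_simps)
      then show "\<exists>D. (G has_real_derivative D) (at w) \<and> D \<le> 0"
        using reg[OF h'(2) w] by (auto intro: less_imp_le)
    qed
    have xq: "x > 0" "q > 0" using x qh(1) lo by auto
    show "\<sigma> * (a0 e h x - s0 e h x) > 0"
      using \<sigma>
    proof
      assume s: "\<sigma> = 1"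
      have "x \<le> q" using P_mono[OF qh(1) x] qh(2) fp s by (cases "q \<le> x") auto
      then have "G q \<le> G x" using G_mono x qh by auto
      moreover have "G q > 0" using qh(3) s xq by (simp add: G_def)
      ultimately have "G x > 0" by simp
      then show ?thesis using xq s by (simp add: G_def zero_less_mult_iff)
    next
      assume s: "\<sigma> = -1"
      have "q \<le> x" using P_mono[OF x qh(1)] qh(2) fp s by (cases "x \<le> q") auto
      then have "G x \<le> G q" using G_mono x qh by auto
      moreover have "G q < 0" using qh(3) s xq by (simp add: G_def mult_pos_neg)
      ultimately have "G x < 0" by simp
      then show ?thesis using xq s by (simp add: G_def mult_less_0_iff)
    qed
  qed (use e1 e2 in auto)
qed

text \<open>A pair with \<open>l < u\<close> encloses a fixed point. There the Schwarzian comparison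
  yields \<open>a0 \<le> s0\<close>, against the sign at fixed points for a positive rate.\<close>

lemma unique_pair:
  assumes x0: "lo < x0" "x0 < hi" and rate: "critical_rate e > 0"
  shows "\<exists>\<epsilon>>0. \<epsilon> \<le> h0 \<and> (\<forall>h\<in>{0<..<\<epsilon>}. \<forall>l\<in>{lo..hi}. \<forall>u\<in>{lo..hi}.
     lnA e h u + lnM e h l = ln (x0 * (1 + x0) ^ d) \<longrightarrow> lnA e h l + lnM e h u = ln (x0 * (1 + x0) ^ d) \<longrightarrow> l = u)"
proof -
  let ?c = "ln (x0 * (1 + x0) ^ d)"
  obtain e1 where e1: "e1 > 0" "e1 \<le> h0" and reg: "\<And>h x. h \<in> {0..e1} \<Longrightarrow> x \<in> {lo..hi} \<Longrightarrow> a0 e h x > 0 \<and> s0 e h x > 0 \<and> schw e h x > 0"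
    using regular[of e] by blast
  obtain e2 where e2: "e2 > 0" "e2 \<le> h0" and fp: "\<And>h x. h \<in> {0<..<e2} \<Longrightarrow> x \<in> {lo..hi} \<Longrightarrow> lnA e h x + lnM e h x = ?c \<Longrightarrow> a0 e h x - s0 e h x > 0"
    using fixed_point_sign[OF x0, of 1 e] rate by auto
  have no_pair: False if h: "h \<in> {0<..<min e1 e2}" and lu: "l \<in> {lo..hi}" "u \<in> {lo..hi}" "l < u"
    and eqs: "lnA e h u + lnM e h l = ?c" "lnA e h l + lnM e h u = ?c" for h l u
  proof -
    have h': "h \<in> {0..h0}" "h \<in> {0..e1}" "h \<in> {0<..<e2}" using h e1 by auto
    have sub: "x \<in> {lo..hi}" if "x \<in> {l..u}" for x using that lu by auto
    note D = derivs[OF sub h'(1)]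
    have A_less: "lnA e h l < lnA e h u"
      by (rule DERIV_pos_imp_increasing[OF lu(3)]) (use D(1) reg[OF h'(2) sub] in \<open>meson atLeastAtMost_iff\<close>)
    define P where "P x = lnA e h x + lnM e h x" for x
    have dP: "(P has_real_derivative a0 e h x + s0 e h x) (at x)" if "x \<in> {l..u}" for x
      unfolding P_def by (intro DERIV_add D that)
    have M_less: "lnM e h l < lnM e h u"
      by (rule DERIV_pos_imp_increasing[OF lu(3)]) (use D(2) reg[OF h'(2) sub] in \<open>meson atLeastAtMost_iff\<close>)
    have "\<exists>f. l \<le> f \<and> f \<le> u \<and> P f = ?c"
    proof (rule IVT)
      show "\<forall>x. l \<le> x \<and> x \<le> u \<longrightarrow> isCont P x" using dP by (auto intro: DERIV_isCont)
    qed (use A_less M_less eqs lu in \<open>auto simp: P_def\<close>)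
    then obtain f where f: "l \<le> f" "f \<le> u" "P f = ?c" by auto
    have "f \<noteq> l" "f \<noteq> u" using f A_less M_less eqs by (auto simp: P_def)
    then have lfu: "l < f" "f < u" using f by auto
    have "a0 e h f \<le> s0 e h f"
    proof (rule schwarzian_pair[OF lfu, where w = "lnA e h" and M = "lnM e h" and ?a1.0 = "a1 e h" and ?s1.0 = "s1 e h"
        and ?a2.0 = "a2 e h" and ?s2.0 = "s2 e h"])
      show "lnA e h u + lnM e h l = lnA e h f + lnM e h f" "lnA e h l + lnM e h u = lnA e h f + lnM e h f"
        using eqs f by (auto simp: P_def)
      show "0 \<le> (s0 e h x)\<^sup>2 * (a2 e h x * a0 e h x - 3 / 2 * (a1 e h x)\<^sup>2)
          - (a0 e h x)\<^sup>2 * (s2 e h x * s0 e h x - 3 / 2 * (s1 e h x)\<^sup>2)" if "x \<in> {l..u}" for x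
        using reg[OF h'(2) sub[OF that]] by (simp add: schw_def)
      show "a0 e h x > 0" "s0 e h x > 0" if "x \<in> {l..u}" for x
        using reg[OF h'(2) sub[OF that]] by auto
    qed (rule D, assumption)+
    moreover have "a0 e h f - s0 e h f > 0"
      using fp[OF h'(3) sub[of f]] f by (auto simp: P_def)
    ultimately show False by simp
  qed
  show ?thesis
  proof (intro exI[of _ "min e1 e2"] conjI ballI impI)
    fix h l u assume "h \<in> {0<..<min e1 e2}" "l \<in> {lo..hi}" "u \<in> {lo..hi}"
      "lnA e h u + lnM e h l = ?c" "lnA e h l + lnM e h u = ?c"
    then show "l = u" using no_pair[of h l u] no_pair[of h u l] by (cases l u rule: linorder_cases) auto
  qed (use e1 e2 in auto)
qed

end

section \<open>Two-cycles from instability\<close>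

context perturbed_recursion
begin

text \<open>Solve one equation for the partner \<open>\<phi> l\<close> of \<open>l\<close> and
  regard the other as \<open>H l = K\<close>. It holds trivially at the fixed point. Since
  \<open>a0 < s0\<close> there, \<open>H\<close> exceeds \<open>K\<close> just to the left, while
  the box condition gives \<open>H lo \<le> K\<close>; the intermediate value theorem provides a
  second solution.\<close>

lemma nonunique_pair:
  assumes x0: "lo < x0" "x0 < hi" and rate: "critical_rate e < 0"
    and box: "\<And>h. h \<in> {0..h0} \<Longrightarrow> lnA e h hi + lnM e h lo \<ge> ln (x0 * (1 + x0) ^ d)"
      "\<And>h. h \<in> {0..h0} \<Longrightarrow> lnA e h lo + lnM e h hi \<le> ln (x0 * (1 + x0) ^ d)"
  shows "\<exists>\<epsilon>>0. \<epsilon> \<le> h0 \<and> (\<forall>h\<in>{0<..<\<epsilon>}. \<exists>l\<in>{lo..hi}. \<exists>u\<in>{lo..hi}. l < u \<and>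
     lnA e h u + lnM e h l = ln (x0 * (1 + x0) ^ d) \<and> lnA e h l + lnM e h u = ln (x0 * (1 + x0) ^ d))"
proof -
  define K where "K = ln (x0 * (1 + x0) ^ d)"
  obtain e1 where e1: "e1 > 0" "e1 \<le> h0" and reg: "\<And>h x. h \<in> {0..e1} \<Longrightarrow> x \<in> {lo..hi} \<Longrightarrow> a0 e h x > 0 \<and> s0 e h x > 0"
    using regular[of e] by blast
  obtain e2 where e2: "e2 > 0" "e2 \<le> h0" and fp: "\<And>h x. h \<in> {0<..<e2} \<Longrightarrow> x \<in> {lo..hi} \<Longrightarrow> lnA e h x + lnM e h x = K \<Longrightarrow> a0 e h x - s0 e h x < 0"
    using fixed_point_sign[OF x0, of "-1" e] rate by (auto simp: K_def)
  have pair: "\<exists>l\<in>{lo..hi}. \<exists>u\<in>{lo..hi}. l < u \<and> lnA e h u + lnM e h l = K \<and> lnA e h l + lnM e h u = K"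
    if h: "h \<in> {0<..<min e1 e2}" for h
  proof -
    have h': "h \<in> {0..h0}" "h \<in> {0..e1}" "h \<in> {0<..<e2}" using h e1 by auto
    define A where "A = lnA e h"
    define M where "M = lnM e h"
    have dA: "(A has_real_derivative a0 e h x) (at x)" and dM: "(M has_real_derivative s0 e h x) (at x)"
      and pos: "a0 e h x > 0" "s0 e h x > 0" if "x \<in> {lo..hi}" for x
      using derivs[OF that h'(1)] reg[OF h'(2) that] by (auto simp: A_def M_def)
    have A_less: "A x < A y" if "lo \<le> x" "x < y" "y \<le> hi" for x y
    proof (rule DERIV_pos_imp_increasing[OF that(2)])
      fix z assume "x \<le> z" "z \<le> y"
      then have "z \<in> {lo..hi}" using that by auto
      then show "\<exists>D. (A has_real_derivative D) (at z) \<and> D > 0" using dA pos by blast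
    qed
    have M_less: "M x < M y" if "lo \<le> x" "x < y" "y \<le> hi" for x y
    proof (rule DERIV_pos_imp_increasing[OF that(2)])
      fix z assume "x \<le> z" "z \<le> y"
      then have "z \<in> {lo..hi}" using that by auto
      then show "\<exists>D. (M has_real_derivative D) (at z) \<and> D > 0" using dM pos by blast
    qed
    have cA: "continuous_on {lo..hi} A" and cM: "continuous_on {lo..hi} M"
      using dA dM by (meson DERIV_isCont continuous_at_imp_continuous_on)+
    have lohi: "lo < hi" using x0 by simp
    have box': "A hi + M lo \<ge> K" "A lo + M hi \<le> K" using box[OF h'(1)] by (auto simp: A_def M_def K_def)
    have "\<exists>f. lo \<le> f \<and> f \<le> hi \<and> A f + M f = K"
    proof (rule IVT')
      show "continuous_on {lo..hi} (\<lambda>x. A x + M x)" by (intro continuous_intros cA cM)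
      show "A lo + M lo \<le> K" using box' M_less[of lo hi] lohi by auto
      show "K \<le> A hi + M hi" using box' M_less[of lo hi] lohi by auto
    qed (use lohi in auto)
    then obtain f where f: "lo \<le> f" "f \<le> hi" "A f + M f = K" by auto
    have "f \<noteq> lo" "f \<noteq> hi" using f box' M_less[of lo hi] lohi by auto
    then have f': "lo < f" "f < hi" using f by auto
    have fin: "f \<in> {lo..hi}" using f by simp
    have dL: "((\<lambda>x. A x - M x) has_real_derivative a0 e h f - s0 e h f) (at f)"
      by (intro DERIV_diff dA dM fin)
    have Lneg: "a0 e h f - s0 e h f < 0" using fp[OF h'(3) fin] f by (simp add: A_def M_def)
    obtain \<delta>1 where \<delta>1: "\<delta>1 > 0" "\<And>t. t > 0 \<Longrightarrow> t < \<delta>1 \<Longrightarrow> A (f - t) - M (f - t) > A f - M f"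
      using DERIV_neg_dec_left[OF dL Lneg] by auto
    obtain \<delta>2 where \<delta>2: "\<delta>2 > 0" "\<And>t. t > 0 \<Longrightarrow> t < \<delta>2 \<Longrightarrow> A f - M f > A (f + t) - M (f + t)"
      using DERIV_neg_dec_right[OF dL Lneg] by auto
    \<comment> \<open>The inverse of the increasing function \<open>A\<close>; its continuity on the
      compact image makes the partner \<open>\<phi>\<close> continuous.\<close>
    define g where "g = inv_into {lo..hi} A"
    have injA: "inj_on A {lo..hi}"
      by (rule linorder_inj_onI) (use A_less in force)+
    have gA: "g (A x) = x" if "x \<in> {lo..hi}" for x
      using that injA by (simp add: g_def)
    have cg: "continuous_on (A ` {lo..hi}) g"
      by (rule continuous_on_inv[OF cA]) (use gA in auto)
    define \<phi> where "\<phi> l = g (K - M l)" for l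
    have \<phi>_ex: "\<exists>u. f \<le> u \<and> u \<le> hi \<and> A u = K - M l" if l: "lo \<le> l" "l \<le> f" for l
    proof (rule IVT')
      show "A f \<le> K - M l" using f M_less[of l f] l by (cases "l = f") auto
      show "K - M l \<le> A hi" using box' M_less[of lo l] l f by (cases "l = lo") auto
      show "continuous_on {f..hi} A" by (rule continuous_on_subset[OF cA]) (use f in auto)
    qed (use f in auto)
    have \<phi>: "f \<le> \<phi> l" "\<phi> l \<le> hi" "A (\<phi> l) = K - M l" and \<phi>_img: "K - M l \<in> A ` {lo..hi}" if l: "lo \<le> l" "l \<le> f" for l
    proof -
      obtain u where u: "f \<le> u" "u \<le> hi" "A u = K - M l" using \<phi>_ex[OF l] by auto
      then have "u \<in> {lo..hi}" using f by auto
      then have "\<phi> l = u" using gA[of u] u(3) by (simp add: \<phi>_def)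
      then show "f \<le> \<phi> l" "\<phi> l \<le> hi" "A (\<phi> l) = K - M l" using u by auto
      show "K - M l \<in> A ` {lo..hi}" using u \<open>u \<in> {lo..hi}\<close> by (metis imageI)
    qed
    have \<phi>f: "\<phi> f = f" using gA[OF fin] f by (simp add: \<phi>_def algebra_simps flip: f(3))
    have c\<phi>: "continuous_on {lo..f} \<phi>"
      unfolding \<phi>_def
      by (rule continuous_on_compose2[OF cg]) (use \<phi>_img f in \<open>auto intro!: continuous_intros continuous_on_subset[OF cM]\<close>)
    define H where "H l = A l + M (\<phi> l)" for l
    have cH: "continuous_on {lo..f} H"
      unfolding H_def
      by (intro continuous_on_add continuous_on_subset[OF cA] continuous_on_compose2[OF cM c\<phi>]) (use \<phi> f in force)+
    obtain \<delta>3 where \<delta>3: "\<delta>3 > 0" "\<And>l. l \<in> {lo..f} \<Longrightarrow> dist l f < \<delta>3 \<Longrightarrow> dist (\<phi> l) (\<phi> f) < \<delta>2"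
      using c\<phi> \<delta>2(1) f' unfolding continuous_on_iff by (metis atLeastAtMost_iff less_imp_le order_refl)
    define t where "t = min (min \<delta>1 \<delta>3) (f - lo) / 2"
    have t: "t > 0" "t < \<delta>1" "t < \<delta>3" "t < f - lo" using \<delta>1 \<delta>3 f' by (auto simp: t_def min_def)
    define l1 where "l1 = f - t"
    have l1: "lo \<le> l1" "l1 \<le> f" "l1 < f" "dist l1 f < \<delta>3" using t by (auto simp: l1_def dist_real_def)
    have gt: "\<phi> l > f" if l: "lo \<le> l" "l < f" for l
    proof -
      have "A (\<phi> l) > A f" using \<phi>(3)[of l] l f M_less[of l f] by auto
      then show ?thesis using \<phi>(1)[of l] l by (cases "\<phi> l = f") auto
    qed
    have "\<phi> l1 - f < \<delta>2" using \<delta>3(2)[of l1] l1 \<phi>f gt[of l1] by (auto simp: dist_real_def)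
    \<comment> \<open>\<open>A - M\<close> decreases through \<open>f\<close>, so it is larger at
      \<open>l1\<close> and smaller at the partner than at \<open>f\<close>. With
      \<open>A (\<phi> l1) = K - M l1\<close> the comparison of these two values reads
      \<open>H l1 > K\<close>.\<close>
    then have "A f - M f > A (\<phi> l1) - M (\<phi> l1)" using \<delta>2(2)[of "\<phi> l1 - f"] gt[of l1] l1 by simp
    moreover have "A l1 - M l1 > A f - M f" using \<delta>1(2)[of t] t by (simp add: l1_def)
    ultimately have H1: "H l1 > K" using \<phi>(3)[of l1] l1 by (simp add: H_def)
    have H0: "H lo \<le> K"
      using \<phi>[of lo] f box' M_less[of "\<phi> lo" hi] by (cases "\<phi> lo = hi") (auto simp: H_def)
    have "\<exists>l. lo \<le> l \<and> l \<le> l1 \<and> H l = K"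
      by (rule IVT') (use H0 H1 l1 continuous_on_subset[OF cH, of "{lo..l1}"] in auto)
    then obtain l where l: "lo \<le> l" "l \<le> l1" "H l = K" by auto
    then have "l < f" using l1 by simp
    show ?thesis
      by (intro bexI[of _ l] bexI[of _ "\<phi> l"])
        (use l \<open>l < f\<close> gt[of l] \<phi>[of l] f in \<open>auto simp: H_def A_def M_def\<close>)
  qed
  show ?thesis
    by (intro exI[of _ "min e1 e2"]) (use e1 e2 pair in \<open>auto simp: K_def\<close>)
qed

end

section \<open>The origin of the vector \<open>pi_vec\<close>\<close>

lemma poly_sum_monom: "poly (\<Sum>k\<le>n. monom (f k) k) (x :: real) = (\<Sum>k\<le>n. f k * x ^ k)"
  by (simp add: poly_sum poly_monom)

lemma poly_pderiv_sum_monom: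
  fixes x :: real
  shows "x * poly (pderiv (\<Sum>k\<le>n. monom (f k) k)) x = (\<Sum>k\<le>n. real k * (f k * x ^ k))"
proof -
  have "x * poly (pderiv (monom (f k) k)) x = real k * (f k * x ^ k)" for k
    by (cases k) (simp_all add: pderiv_monom poly_monom)
  then show ?thesis by (simp add: higher_pderiv_sum[of 1, simplified] poly_sum sum_distrib_left)
qed

text \<open>The coefficient of h in the offspring polynomial for the weights
  \<open>1 + c k * h\<close>.\<close>

definition count_poly :: "nat \<Rightarrow> (nat \<Rightarrow> real) \<Rightarrow> real poly" where
  "count_poly d c = (\<Sum>k\<le>d. monom (real (d choose k) * c k) k)"

lemma pert_count_poly:
  "pert ([:1, 1:] ^ d) (count_poly d c) 0 h x = (\<Sum>k\<le>d. real (d choose k) * (1 + c k * h) * x ^ k)"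
proof -
  have "(1 + x) ^ d = (\<Sum>k\<le>d. real (d choose k) * x ^ k)"
    using binomial_ring[of x 1 d] by (simp add: add.commute)
  then show ?thesis
    by (simp add: pert_def poly_power add.commute[of x] count_poly_def poly_sum_monom sum_distrib_left
        flip: sum.distrib) (simp add: algebra_simps sum.distrib add.commute)
qed

text \<open>The coordinate \<open>c j\<close> is met at \<open>k = j\<close> in the first sum and at
  \<open>k = j - 1\<close> in the second. Absorption identities turn both binomials into multiples
  of \<open>Suc d choose j\<close>, and the choice of \<open>x\<close> gives
  \<open>x ^ k = (real d - 1) * x ^ Suc k\<close>; then the coefficients are compared one by
  one.\<close>

lemma sum_pi_vec:
  fixes c :: "nat \<Rightarrow> real" and d :: nat
  assumes d2: "d \<ge> 2"
  defines "x \<equiv> 1 / (real d - 1)"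
  shows "(\<Sum>k\<le>d. real (d choose k) * c k * x ^ k * ((real d - 1) * (real d + 1) / (2 * real d) + (real d - 1) * (real k - 1)))
     - (\<Sum>k\<le>d. real (d choose k) * c (Suc k) * x ^ k * ((real d - 1) / 2 + real d * (real k - 1)))
     = - ((real d - 1) / (2 * real d)) * (\<Sum>j\<le>Suc d. pi_vec (Suc d) j * c j)"
proof -
  have d1: "real d > 1" using d2 by simp
  let ?D = "Suc d"
  have x: "x > 0" "x * (real d - 1) = 1" using d1 by (auto simp: x_def)
  have 1: "(\<Sum>k\<le>d. real (d choose k) * c k * x ^ k * ((real d - 1) * (real d + 1) / (2 * real d) + (real d - 1) * (real k - 1)))
     = (\<Sum>j\<le>?D. (real ?D - real j) / real ?D * (real (?D choose j) * c j * x ^ j * ((real d - 1) * (real d + 1) / (2 * real d) + (real d - 1) * (real j - 1))))"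
  proof -
    have "real (d choose k) = (real ?D - real k) / real ?D * real (?D choose k)" if "k \<le> d" for k
    proof -
      have "(?D - k) * (?D choose k) = ?D * (d choose k)"
        using binomial_absorb_comp[of ?D k] by simp
      then have "real (?D - k) * real (?D choose k) = real ?D * real (d choose k)"
        by (metis of_nat_mult)
      then show ?thesis using that by (simp add: of_nat_diff field_simps)
    qed
    then show ?thesis by (simp add: sum.atMost_Suc mult_ac)
  qed
  have 2: "(\<Sum>k\<le>d. real (d choose k) * c (Suc k) * x ^ k * ((real d - 1) / 2 + real d * (real k - 1)))
     = (\<Sum>j\<le>?D. real j / real ?D * (real (?D choose j) * c j * ((real d - 1) * x ^ j) * ((real d - 1) / 2 + real d * (real j - 2))))"
  proof -
    have bin: "real (d choose k) = real (Suc k) / real ?D * real (?D choose Suc k)" for k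
    proof -
      have "real (Suc k) * real (?D choose Suc k) = real ?D * real (d choose k)"
        using Suc_times_binomial[of k d] by (metis of_nat_mult)
      then show ?thesis by (simp add: field_simps del: binomial_Suc_Suc)
    qed
    have pow: "x ^ k = (real d - 1) * x ^ Suc k" for k
    proof -
      have "(real d - 1) * x ^ Suc k = (x * (real d - 1)) * x ^ k" by simp
      then show ?thesis unfolding x(2) by simp
    qed
    define F where "F j = real j / real ?D * (real (?D choose j) * c j * ((real d - 1) * x ^ j) * ((real d - 1) / 2 + real d * (real j - 2)))" for j
    have "real (d choose k) * c (Suc k) * x ^ k * ((real d - 1) / 2 + real d * (real k - 1)) = F (Suc k)" for k
    proof -
      have "real (Suc k) - 2 = real k - 1" by simp
      then show ?thesis unfolding F_def bin[of k] pow[of k] by (simp only: mult.assoc times_divide_eq_left times_divide_eq_right)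
    qed
    then have "(\<Sum>k\<le>d. real (d choose k) * c (Suc k) * x ^ k * ((real d - 1) / 2 + real d * (real k - 1))) = (\<Sum>k\<le>d. F (Suc k))"
      by simp
    \<comment> \<open>The shifted sum may start at \<open>j = 0\<close> because the factor
      \<open>real j\<close> makes \<open>F 0\<close> vanish.\<close>
    also have "\<dots> = (\<Sum>j\<le>?D. F j)"
      by (simp add: sum.atMost_Suc_shift F_def del: sum.atMost_Suc)
    finally show ?thesis by (simp only: F_def)
  qed
  have 3: "(real ?D - real j) / real ?D * (b * y * z * ((real d - 1) * (real d + 1) / (2 * real d) + (real d - 1) * (real j - 1)))
     - real j / real ?D * (b * y * ((real d - 1) * z) * ((real d - 1) / 2 + real d * (real j - 2)))
     = - ((real d - 1) / (2 * real d)) * (b * z * ((real d - 1) + (1 - 5 * real d) * real j + 2 * real d * (real j)\<^sup>2) * y)" for j b y z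
  proof -
    define J where "J = real j"
    define \<delta> where "\<delta> = real d"
    have \<delta>: "\<delta> > 0" "real ?D = \<delta> + 1" using d1 by (auto simp: \<delta>_def)
    have gen: "r / E * (b' * y' * z' * P) - s / E * (b' * y' * (m * z') * Q) = b' * y' * z' / E * (r * P - s * m * Q)"
      for r s E b' y' z' m P Q :: real
      by (cases "E = 0") (simp_all add: field_simps)
    \<comment> \<open>The only place where the quadratic of \<open>pi_vec\<close> arises: for degree
      \<delta> + 1 its coefficients are \<delta> - 1, 1 - 5 \<delta> and 2 \<delta>.\<close>
    have core: "(\<delta> + 1 - J) * ((\<delta> - 1) * (\<delta> + 1) / (2 * \<delta>) + (\<delta> - 1) * (J - 1)) - J * (\<delta> - 1) * ((\<delta> - 1) / 2 + \<delta> * (J - 2))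
      = (\<delta> + 1) * (- ((\<delta> - 1) / (2 * \<delta>)) * ((\<delta> - 1) + (1 - 5 * \<delta>) * J + 2 * \<delta> * J\<^sup>2))"
      using \<delta>(1) by (simp add: field_simps power2_eq_square)
    have "(\<delta> + 1 - J) / (\<delta> + 1) * (b * y * z * ((\<delta> - 1) * (\<delta> + 1) / (2 * \<delta>) + (\<delta> - 1) * (J - 1)))
       - J / (\<delta> + 1) * (b * y * ((\<delta> - 1) * z) * ((\<delta> - 1) / 2 + \<delta> * (J - 2)))
       = b * y * z / (\<delta> + 1) * ((\<delta> + 1 - J) * ((\<delta> - 1) * (\<delta> + 1) / (2 * \<delta>) + (\<delta> - 1) * (J - 1)) - J * (\<delta> - 1) * ((\<delta> - 1) / 2 + \<delta> * (J - 2)))"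
      by (rule gen)
    also have "\<dots> = b * y * z / (\<delta> + 1) * ((\<delta> + 1) * (- ((\<delta> - 1) / (2 * \<delta>)) * ((\<delta> - 1) + (1 - 5 * \<delta>) * J + 2 * \<delta> * J\<^sup>2)))"
      unfolding core ..
    also have "\<dots> = - ((\<delta> - 1) / (2 * \<delta>)) * (b * z * ((\<delta> - 1) + (1 - 5 * \<delta>) * J + 2 * \<delta> * J\<^sup>2) * y)"
      using \<delta>(1) by simp
    finally show ?thesis unfolding \<delta>(2) J_def \<delta>_def .
  qed
  have 4: "pi_vec ?D j * c j = real (?D choose j) * x ^ j * ((real d - 1) + (1 - 5 * real d) * real j + 2 * real d * (real j)\<^sup>2) * c j" for j
    by (simp add: pi_vec_def x_def power_one_over divide_simps del: binomial_Suc_Suc)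
  show ?thesis
    unfolding 1 2 4 sum_subtractf[symmetric] sum_distrib_left 3 ..
qed

section \<open>Monotonicity of the message ratio\<close>

lemma site_poly_add: "site_poly (\<lambda>k. a k + b k) C x = site_poly a C x + site_poly b C x"
  by (simp add: site_poly_def distrib_right sum.distrib)

lemma site_poly_cong_coeff:
  assumes "finite C" "\<And>k. k \<le> card C \<Longrightarrow> a k = b k"
  shows "site_poly a C x = site_poly b C x"
  unfolding site_poly_def
proof (rule sum.cong[OF refl])
  fix f assume f: "f \<in> configs C"
  have "(\<Sum>c\<in>C. f c) \<le> (\<Sum>c\<in>C. 1)"
    using configs_range[OF f] by (intro sum_mono) force
  then show "a (\<Sum>c\<in>C. f c) * (\<Prod>c\<in>C. if f c = 0 then 1 else x c) = b (\<Sum>c\<in>C. f c) * (\<Prod>c\<in>C. if f c = 0 then 1 else x c)"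
    using assms(2) by simp
qed

text \<open>The coefficient sequences \<open>K + a\<close> and \<open>K - a\<close> are nonnegative,
  and constant coefficients give a plain product.\<close>

lemma site_poly_abs_le:
  assumes "finite C" "\<And>k. k \<le> card C \<Longrightarrow> \<bar>a k\<bar> \<le> K" "\<And>c. c \<in> C \<Longrightarrow> 0 \<le> x c"
  shows "\<bar>site_poly a C x\<bar> \<le> K * (\<Prod>c\<in>C. 1 + x c)"
proof -
  have pos: "0 \<le> site_poly b C x" if "\<And>k. k \<le> card C \<Longrightarrow> 0 \<le> b k" for b
    using site_poly_mono[OF assms(1), of "\<lambda>_. 0" b x x] that assms(3) by (simp add: site_poly_def)
  have "0 \<le> site_poly (\<lambda>k. K * 1 + a k) C x" "0 \<le> site_poly (\<lambda>k. K * 1 + (-1) * a k) C x"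
    using assms(2) by (intro pos; force)+
  then show ?thesis unfolding site_poly_add site_poly_cmult site_poly_one[OF assms(1)] by simp
qed

text \<open>The ratio is a Moebius function of each single coordinate, whose direction of monotonicity is the
  sign of the determinant in the hypothesis.\<close>

lemma site_poly_ratio_mono:
  fixes \<sigma> :: real
  assumes C: "finite C" and x: "\<And>c. c \<in> C \<Longrightarrow> x c \<in> {lo..hi}" "\<And>c. c \<in> C \<Longrightarrow> x' c \<in> {lo..hi}" "\<And>c. c \<in> C \<Longrightarrow> x c \<le> x' c"
    and pos: "\<And>z. (\<And>c. c \<in> C \<Longrightarrow> z c \<in> {lo..hi}) \<Longrightarrow> site_poly \<theta> C z > 0"
    and det: "\<And>C' z. finite C' \<Longrightarrow> Suc (card C') = card C \<Longrightarrow> (\<And>c. c \<in> C' \<Longrightarrow> z c \<in> {lo..hi}) \<Longrightarrow>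
      \<sigma> * (site_poly (\<lambda>k. \<theta> (Suc (Suc k))) C' z * site_poly \<theta> C' z - (site_poly (\<lambda>k. \<theta> (Suc k)) C' z)\<^sup>2) \<ge> 0"
  shows "\<sigma> * (site_poly (\<lambda>k. \<theta> (Suc k)) C x / site_poly \<theta> C x) \<le> \<sigma> * (site_poly (\<lambda>k. \<theta> (Suc k)) C x' / site_poly \<theta> C x')"
proof -
  let ?R = "\<lambda>z. site_poly (\<lambda>k. \<theta> (Suc k)) C z / site_poly \<theta> C z"
  \<comment> \<open>Coordinates are raised from \<open>x\<close> to \<open>x'\<close> one at a time;
    \<open>B\<close> is the set of those already raised.\<close>
  have "\<sigma> * ?R x \<le> \<sigma> * ?R (\<lambda>c. if c \<in> B then x' c else x c)" if "B \<subseteq> C" for B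
    using finite_subset[OF that C] that
  proof (induction B rule: finite_induct)
    case (insert b B)
    define z where "z c = (if c \<in> B then x' c else x c)" for c
    define z' where "z' c = (if c \<in> insert b B then x' c else x c)" for c
    define C' where "C' = C - {b}"
    have C': "finite C'" "b \<notin> C'" "C = insert b C'" "Suc (card C') = card C"
      using C insert.prems card_Suc_Diff1[OF C, of b] by (auto simp: C'_def)
    have zb: "z b = x b" "z' b = x' b" using insert.hyps by (auto simp: z_def z'_def)
    have zin: "z c \<in> {lo..hi}" "z' c \<in> {lo..hi}" if "c \<in> C" for c
      using x(1,2)[OF that] by (auto simp: z_def z'_def)
    have same: "site_poly a C' z' = site_poly a C' z" for a
      by (rule site_poly_cong) (use C' in \<open>auto simp: z_def z'_def\<close>)
    define s0 where "s0 = site_poly \<theta> C' z"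
    define s1 where "s1 = site_poly (\<lambda>k. \<theta> (Suc k)) C' z"
    define s2 where "s2 = site_poly (\<lambda>k. \<theta> (Suc (Suc k))) C' z"
    have exp: "site_poly \<theta> C z = s0 + x b * s1" "site_poly (\<lambda>k. \<theta> (Suc k)) C z = s1 + x b * s2"
      "site_poly \<theta> C z' = s0 + x' b * s1" "site_poly (\<lambda>k. \<theta> (Suc k)) C z' = s1 + x' b * s2"
      unfolding C'(3) by (simp_all add: site_poly_insert[OF C'(1,2)] zb same s0_def s1_def s2_def)
    have p: "s0 + x b * s1 > 0" "s0 + x' b * s1 > 0"
      using pos[of z] pos[of z'] zin by (auto simp: exp)
    have dd: "\<sigma> * (s2 * s0 - s1\<^sup>2) \<ge> 0"
      unfolding s0_def s1_def s2_def by (rule det) (use C' zin in auto)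
    have "?R z' - ?R z = (x' b - x b) * (s2 * s0 - s1\<^sup>2) / ((s0 + x' b * s1) * (s0 + x b * s1))"
      unfolding exp using p by (simp add: diff_frac_eq) (simp add: algebra_simps power2_eq_square)
    then have "\<sigma> * ?R z' - \<sigma> * ?R z = (x' b - x b) * (\<sigma> * (s2 * s0 - s1\<^sup>2)) / ((s0 + x' b * s1) * (s0 + x b * s1))"
      unfolding right_diff_distrib[symmetric] by simp
    also have "\<dots> \<ge> 0"
      using p x(3)[of b] insert.prems
      by (intro divide_nonneg_nonneg mult_nonneg_nonneg[OF _ dd] less_imp_le[OF mult_pos_pos]) auto
    finally have "\<sigma> * ?R z \<le> \<sigma> * ?R z'" by simp
    moreover have "\<sigma> * ?R x \<le> \<sigma> * ?R z" using insert by (simp add: z_def[abs_def])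
    ultimately show ?case by (simp add: z'_def[abs_def])
  qed simp
  from this[of C] have "\<sigma> * ?R x \<le> \<sigma> * ?R (\<lambda>c. if c \<in> C then x' c else x c)" by simp
  also have "?R (\<lambda>c. if c \<in> C then x' c else x c) = ?R x'"
    by (intro arg_cong2[of _ _ _ _ "(/)"] site_poly_cong) auto
  finally show ?thesis .
qed

section \<open>Uniqueness from a monotone message ratio\<close>

context bounded_model
begin

lemma S_mono: "0 \<le> a \<Longrightarrow> a \<le> b \<Longrightarrow> S a \<le> S b"
  unfolding offspring_poly_def using \<theta>_pos
  by (intro sum_mono mult_left_mono power_mono) (auto intro!: less_imp_le)

lemma weighted_power_mono:
  fixes p q s t :: real
  assumes "0 \<le> p" "p \<le> q" "0 < s" "s \<le> t"
  shows "lam * p ^ d / t \<le> lam * q ^ d / s"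
  using assms lam by (intro frac_le mult_left_mono power_mono mult_nonneg_nonneg zero_le_power) auto

lemma x_next_interval:
  assumes C: "finite C" "card C = d" and lu: "0 \<le> l" "\<And>c. c \<in> C \<Longrightarrow> x c \<in> {l..u}"
    and pq: "0 \<le> p" "\<And>c. c \<in> C \<Longrightarrow> y c \<in> {p..q}" and u: "l \<le> u" and q: "p \<le> q"
  shows "x_next C x y \<in> {lam * p ^ d / S u..lam * q ^ d / S l}"
proof -
  have \<theta>0: "\<And>k. k \<le> card C \<Longrightarrow> 0 \<le> \<theta> k" using \<theta>_pos C by (auto intro!: less_imp_le)
  have x0: "\<And>c. c \<in> C \<Longrightarrow> 0 \<le> x c" using lu by force
  have E1: "S l \<le> site_poly \<theta> C x"
    using site_poly_mono[OF C(1), where \<theta> = \<theta> and \<theta>' = \<theta> and x = "\<lambda>_. l" and x' = x] \<theta>0 lu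
    unfolding site_poly_const_d[OF C] by auto
  have E2: "site_poly \<theta> C x \<le> S u"
    using site_poly_mono[OF C(1), where \<theta> = \<theta> and \<theta>' = \<theta> and x = x and x' = "\<lambda>_. u"] \<theta>0 lu x0
    unfolding site_poly_const_d[OF C] by auto
  have P1: "p ^ d \<le> (\<Prod>c\<in>C. y c)" using prod_mono[of C "\<lambda>_. p" y] pq C by auto
  have P2: "(\<Prod>c\<in>C. y c) \<le> q ^ d" using prod_mono[of C y "\<lambda>_. q"] pq C by force
  have S: "S l > 0" "S u > 0" using ST_pos(1) lu(1) u by auto
  have P0: "0 \<le> p ^ d" "0 \<le> (\<Prod>c\<in>C. y c)" using pq(1) P1 by (auto intro: order_trans[OF _ P1])
  have "lam * p ^ d / S u \<le> x_next C x y"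
    unfolding x_next_def using lam P0 P1 E1 E2 S by (intro frac_le mult_left_mono mult_nonneg_nonneg) auto
  moreover have "x_next C x y \<le> lam * q ^ d / S l"
    unfolding x_next_def using lam P0 P2 E1 S order_trans[OF P0(2) P2] by (intro frac_le mult_left_mono mult_nonneg_nonneg) auto
  ultimately show ?thesis by simp
qed

text \<open>Some \<open>d\<close> nodes at which to evaluate constant vectors, so that estimates for
  \<open>site_poly\<close> become estimates for the one-variable polynomials.\<close>

lemma exists_nodes: "\<exists>C :: nat list set. finite C \<and> card C = d"
  using card_children'[of "[0]"] by (intro exI[of _ "children D [0]"]) auto

lemma ratio_pos: "0 \<le> a \<Longrightarrow> T a / S a > 0"
  using ST_pos by simp

lemma xbox_nonneg: "a \<in> xbox \<Longrightarrow> 0 \<le> a"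
  using x_min_pos by auto

lemma cont_ratio:
  "continuous_on xbox S" "continuous_on xbox (\<lambda>a. T a / S a)"
proof -
  show "continuous_on xbox S" unfolding offspring_poly_def by (intro continuous_intros)
  moreover have "continuous_on xbox T" unfolding offspring_poly_def by (intro continuous_intros)
  ultimately show "continuous_on xbox (\<lambda>a. T a / S a)"
    using ST_pos(1)[OF xbox_nonneg] by (intro continuous_on_divide) (auto simp: less_imp_neq[symmetric])
qed

text \<open>Constant messages are a special case of \<open>x_next_bounds\<close>, so the
  one-variable map inherits its invariant interval.\<close>

lemma \<Phi>_range: "a \<in> xbox \<Longrightarrow> b \<in> xbox \<Longrightarrow> lam * (T b / S b) ^ d / S a \<in> xbox"
proof -
  assume a: "a \<in> xbox" and b: "b \<in> xbox"
  obtain C :: "nat list set" where C: "finite C" "card C = d" using exists_nodes by auto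
  have "T b / S b \<in> {1 / 4..4}"
    using E_bounds(3,4)[OF C, of "\<lambda>_. b"] xbox_nonneg[OF b] by (simp add: y_ratio_const[OF C])
  then have "x_next C (\<lambda>_. a) (\<lambda>_. T b / S b) \<in> xbox"
    using a xbox_nonneg[OF a] by (intro x_next_bounds[OF C]) auto
  then show ?thesis by (simp add: x_next_def site_poly_const_d[OF C] C)
qed

lemma cycle_eq:
  assumes "a > 0" "b \<ge> 0" "c \<ge> 0"
  shows "a = lam * (T c / S c) ^ d / S b \<longleftrightarrow> a * (S c / T c) ^ d * S b = lam"
proof -
  have "S c > 0" "T c > 0" "S b > 0" using ST_pos assms by auto
  then show ?thesis by (simp add: field_simps)
qed

text \<open>The odds are largest when the ratios of the children are large and the children's own
  odds small. An increasing ratio is largest for grandchildren at \<open>u\<close>, so the extremes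
  combine different endpoints and the limiting equations are the two-cycle equations
  themselves.\<close>

lemma unique_if_ratio_increasing:
  assumes inc: "\<And>C x x'. finite C \<Longrightarrow> card C = d \<Longrightarrow> (\<And>c. c \<in> C \<Longrightarrow> x c \<in> xbox) \<Longrightarrow> (\<And>c. c \<in> C \<Longrightarrow> x' c \<in> xbox) \<Longrightarrow>
      (\<And>c. c \<in> C \<Longrightarrow> x c \<le> x' c) \<Longrightarrow> y_ratio C x \<le> y_ratio C x'"
    and uniq: "\<And>l u. l \<in> xbox \<Longrightarrow> u \<in> xbox \<Longrightarrow> u * (S u / T u) ^ d * S l = lam \<Longrightarrow> l * (S l / T l) ^ d * S u = lam \<Longrightarrow> l = u"
  shows "uniqueness_regime D lam \<theta>"
proof -
  have R: "T a / S a \<le> T b / S b" if "a \<in> xbox" "b \<in> xbox" "a \<le> b" for a b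
  proof -
    obtain C :: "nat list set" where C: "finite C" "card C = d" using exists_nodes by auto
    show ?thesis using inc[OF C, of "\<lambda>_. a" "\<lambda>_. b"] that by (simp add: y_ratio_const[OF C])
  qed
  show ?thesis
  proof (rule uniqueness_by_squeezing[where \<Phi> = "\<lambda>a b. lam * (T b / S b) ^ d / S a"])
    show "continuous_on (xbox \<times> xbox) (\<lambda>z. lam * (T (snd z) / S (snd z)) ^ d / S (fst z))"
      by (intro continuous_intros continuous_on_compose2[OF cont_ratio(2)] continuous_on_compose2[OF cont_ratio(1)])
        (use ST_pos(1)[OF xbox_nonneg] in \<open>force+\<close>)
  next
    fix a a' b b' assume ab: "a \<in> xbox" "a' \<in> xbox" "b \<in> xbox" "b' \<in> xbox" "a \<le> a'" "b \<le> b'"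
    show "lam * (T b / S b) ^ d / S a' \<le> lam * (T b' / S b') ^ d / S a"
      using ab xbox_nonneg ratio_pos[of b]
      by (intro weighted_power_mono R S_mono ST_pos) (auto simp: less_imp_le)
  next
    fix a b assume "a \<in> xbox" "b \<in> xbox" then show "lam * (T b / S b) ^ d / S a \<in> xbox" by (rule \<Phi>_range)
  next
    fix l u assume lu: "l \<in> xbox" "u \<in> xbox" "l = lam * (T l / S l) ^ d / S u" "u = lam * (T u / S u) ^ d / S l"
    have pos: "l > 0" "u > 0" "0 \<le> l" "0 \<le> u" using lu(1,2) x_min_pos by auto
    show "l = u"
      by (rule uniq[OF lu(1,2) iffD1[OF cycle_eq lu(4)] iffD1[OF cycle_eq lu(3)]]) (rule pos)+
  next
    fix l u and C :: "nat list set" and x y :: "nat list \<Rightarrow> real" assume lu: "l \<in> xbox" "u \<in> xbox" "l \<le> u" "finite C" "card C = d" "\<And>c. c \<in> C \<Longrightarrow> x c \<in> {l..u}"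
      "\<And>c. c \<in> C \<Longrightarrow> y c \<in> {min (T l / S l) (T u / S u)..max (T l / S l) (T u / S u)}"
    show "x_next C x y \<in> {lam * (T l / S l) ^ d / S u..lam * (T u / S u) ^ d / S l}"
      by (rule x_next_interval) (use lu R[OF lu(1,2,3)] xbox_nonneg[OF lu(1)] ratio_pos[of l] in \<open>auto simp: min_def max_def\<close>)
  next
    fix l u and C :: "nat list set" and x :: "nat list \<Rightarrow> real" assume lu: "l \<in> xbox" "u \<in> xbox" "l \<le> u" "finite C" "card C = d" "\<And>c. c \<in> C \<Longrightarrow> x c \<in> {l..u}"
    have "y_ratio C (\<lambda>_. l) \<le> y_ratio C x" by (rule inc) (use lu in force)+
    moreover have "y_ratio C x \<le> y_ratio C (\<lambda>_. u)" by (rule inc) (use lu in force)+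
    ultimately show "y_ratio C x \<in> {min (T l / S l) (T u / S u)..max (T l / S l) (T u / S u)}"
      by (auto simp: y_ratio_const[OF lu(4,5)])
  qed simp
qed

text \<open>A decreasing ratio is largest for grandchildren at \<open>l\<close>, the endpoint that
  also minimises the denominator. Thus \<open>\<Phi>\<close> depends on its first argument alone,
  and the limiting equations are those of \<open>e = 0\<close>.\<close>

lemma unique_if_ratio_decreasing:
  assumes dec: "\<And>C x x'. finite C \<Longrightarrow> card C = d \<Longrightarrow> (\<And>c. c \<in> C \<Longrightarrow> x c \<in> xbox) \<Longrightarrow> (\<And>c. c \<in> C \<Longrightarrow> x' c \<in> xbox) \<Longrightarrow>
      (\<And>c. c \<in> C \<Longrightarrow> x c \<le> x' c) \<Longrightarrow> y_ratio C x' \<le> y_ratio C x"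
    and uniq: "\<And>l u. l \<in> xbox \<Longrightarrow> u \<in> xbox \<Longrightarrow> u * (S l / T l) ^ d * S l = lam \<Longrightarrow> l * (S u / T u) ^ d * S u = lam \<Longrightarrow> l = u"
  shows "uniqueness_regime D lam \<theta>"
proof -
  have R: "T b / S b \<le> T a / S a" if "a \<in> xbox" "b \<in> xbox" "a \<le> b" for a b
  proof -
    obtain C :: "nat list set" where C: "finite C" "card C = d" using exists_nodes by auto
    show ?thesis using dec[OF C, of "\<lambda>_. a" "\<lambda>_. b"] that by (simp add: y_ratio_const[OF C])
  qed
  show ?thesis
  proof (rule uniqueness_by_squeezing[where \<Phi> = "\<lambda>a b. lam * (T a / S a) ^ d / S a"])
    show "continuous_on (xbox \<times> xbox) (\<lambda>z. lam * (T (fst z) / S (fst z)) ^ d / S (fst z))"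
      by (intro continuous_intros continuous_on_compose2[OF cont_ratio(2)] continuous_on_compose2[OF cont_ratio(1)])
        (use ST_pos(1)[OF xbox_nonneg] in \<open>force+\<close>)
  next
    fix a a' b b' assume ab: "a \<in> xbox" "a' \<in> xbox" "b \<in> xbox" "b' \<in> xbox" "a \<le> a'" "b \<le> b'"
    show "lam * (T a' / S a') ^ d / S a' \<le> lam * (T a / S a) ^ d / S a"
      using ab xbox_nonneg ratio_pos[of a']
      by (intro weighted_power_mono R S_mono ST_pos) (auto simp: less_imp_le)
  next
    fix a b assume a: "a \<in> xbox" "b \<in> xbox"
    show "lam * (T a / S a) ^ d / S a \<in> xbox" by (rule \<Phi>_range[OF a(1) a(1)])
  next
    fix l u assume lu: "l \<in> xbox" "u \<in> xbox" "l = lam * (T u / S u) ^ d / S u" "u = lam * (T l / S l) ^ d / S l"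
    have pos: "l > 0" "u > 0" "0 \<le> l" "0 \<le> u" using lu(1,2) x_min_pos by auto
    show "l = u"
      by (rule uniq[OF lu(1,2) iffD1[OF cycle_eq lu(4)] iffD1[OF cycle_eq lu(3)]]) (rule pos)+
  next
    fix l u and C :: "nat list set" and x y :: "nat list \<Rightarrow> real" assume lu: "l \<in> xbox" "u \<in> xbox" "l \<le> u" "finite C" "card C = d" "\<And>c. c \<in> C \<Longrightarrow> x c \<in> {l..u}"
      "\<And>c. c \<in> C \<Longrightarrow> y c \<in> {min (T l / S l) (T u / S u)..max (T l / S l) (T u / S u)}"
    show "x_next C x y \<in> {lam * (T u / S u) ^ d / S u..lam * (T l / S l) ^ d / S l}"
    proof (rule x_next_interval)
      have "min (T l / S l) (T u / S u) = T u / S u" "max (T l / S l) (T u / S u) = T l / S l"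
        using R[OF lu(1,2,3)] by (auto simp: min_def max_def)
      then show "\<And>c. c \<in> C \<Longrightarrow> y c \<in> {T u / S u..T l / S l}" using lu(7) by simp
      show "0 \<le> T u / S u" using ratio_pos[of u] xbox_nonneg[OF lu(2)] by simp
    qed (use lu R[OF lu(1,2,3)] xbox_nonneg[OF lu(1)] in auto)
  next
    fix l u and C :: "nat list set" and x :: "nat list \<Rightarrow> real" assume lu: "l \<in> xbox" "u \<in> xbox" "l \<le> u" "finite C" "card C = d" "\<And>c. c \<in> C \<Longrightarrow> x c \<in> {l..u}"
    have "y_ratio C x \<le> y_ratio C (\<lambda>_. l)" by (rule dec) (use lu in force)+
    moreover have "y_ratio C (\<lambda>_. u) \<le> y_ratio C x" by (rule dec) (use lu in force)+
    ultimately show "y_ratio C x \<in> {min (T l / S l) (T u / S u)..max (T l / S l) (T u / S u)}"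
      by (auto simp: y_ratio_const[OF lu(4,5)])
  qed simp
qed

end

section \<open>Small perturbations\<close>

lemma offspring_poly_linear:
  "offspring_poly d (\<lambda>k. 1 + c k * h) x = pert ([:1, 1:] ^ d) (count_poly d c) 0 h x"
  by (simp add: pert_count_poly offspring_poly_def)

text \<open>The factor \<open>(1 + x0) ^ d\<close> clears the denominators of \<alpha> and \<beta>.
  Since \<open>x0 * (real d / (1 + x0)) = 1\<close>, the terms with the primed quantities become
  sums with the weights \<open>real k - 1\<close>, and \<open>sum_pi_vec\<close> applies.\<close>

lemma (in perturbed_recursion) critical_rate_pi_vec:
  assumes p: "p = count_poly d c" and r: "r = count_poly d (\<lambda>k. c (Suc k))"
  shows "(1 + x0) ^ d * critical_rate (real d) = - ((real d - 1) / (2 * real d)) * (\<Sum>j\<le>Suc d. pi_vec (Suc d) j * c j)"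
proof -
  have d1: "real d > 1" using d2 by simp
  define X where "X = (1 + x0) ^ d"
  have X: "X > 0" using x0_props(1) by (simp add: X_def)
  define f where "f k = real (d choose k) * c k * x0 ^ k" for k
  define g where "g k = real (d choose k) * c (Suc k) * x0 ^ k" for k
  have xd: "x0 * (real d / (1 + x0)) = 1"
    using d1 unfolding x0_props(4) by (simp add: x0_def)
  have pp: "poly p x0 = (\<Sum>k\<le>d. f k)" "x0 * poly (pderiv p) x0 = (\<Sum>k\<le>d. real k * f k)"
    using arg_cong[OF p, of "\<lambda>q. poly q x0"] arg_cong[OF p, of "\<lambda>q. x0 * poly (pderiv q) x0"]
    by (simp_all only: count_poly_def poly_sum_monom poly_pderiv_sum_monom f_def)
  have rr: "poly r x0 = (\<Sum>k\<le>d. g k)" "x0 * poly (pderiv r) x0 = (\<Sum>k\<le>d. real k * g k)"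
    using arg_cong[OF r, of "\<lambda>q. poly q x0"] arg_cong[OF r, of "\<lambda>q. x0 * poly (pderiv q) x0"]
    by (simp_all only: count_poly_def poly_sum_monom poly_pderiv_sum_monom g_def)
  have a: "\<alpha> * X = (\<Sum>k\<le>d. f k)" and b: "\<beta> * X = (\<Sum>k\<le>d. g k)"
    unfolding \<alpha>_def \<beta>_def X_def[symmetric] pp rr using X by simp_all
  have a': "x0 * \<alpha>' * X = (\<Sum>k\<le>d. (real k - 1) * f k)"
  proof -
    have "x0 * \<alpha>' * X = x0 * poly (pderiv p) x0 - x0 * (real d / (1 + x0)) * (\<alpha> * X)"
      using X by (simp add: \<alpha>'_def X_def[symmetric] field_simps)
    also have "\<dots> = (\<Sum>k\<le>d. real k * f k) - (\<Sum>k\<le>d. f k)"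
      unfolding xd a pp by simp
    finally show ?thesis by (simp add: left_diff_distrib sum_subtractf)
  qed
  have b': "x0 * \<beta>' * X = (\<Sum>k\<le>d. (real k - 1) * g k)"
  proof -
    have "x0 * \<beta>' * X = x0 * poly (pderiv r) x0 - x0 * (real d / (1 + x0)) * (\<beta> * X)"
      using X by (simp add: \<beta>'_def X_def[symmetric] field_simps)
    also have "\<dots> = (\<Sum>k\<le>d. real k * g k) - (\<Sum>k\<le>d. g k)"
      unfolding xd b rr by simp
    finally show ?thesis by (simp add: left_diff_distrib sum_subtractf)
  qed
  have "X * critical_rate (real d) = (real d - 1) / (2 * real d) * ((real d + 1) * (\<alpha> * X) - real d * (\<beta> * X))
      + (real d - 1) * (x0 * \<alpha>' * X) - real d * (x0 * \<beta>' * X)"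
  proof -
    have "Y * (k * ((n + 1) * A - n * B) + z * ((2 * n - n) * (s - t) - s)) =
        k * ((n + 1) * (A * Y) - n * (B * Y)) + (n - 1) * (z * s * Y) - n * (z * t * Y)" for Y k n A B z s t :: real
      by (simp add: algebra_simps)
    then show ?thesis unfolding critical_rate_def .
  qed
  also have "\<dots> = (\<Sum>k\<le>d. f k * ((real d - 1) * (real d + 1) / (2 * real d) + (real d - 1) * (real k - 1)))
     - (\<Sum>k\<le>d. g k * ((real d - 1) / 2 + real d * (real k - 1)))"
  proof -
    have 1: "(real d - 1) / (2 * real d) * ((real d + 1) * F - real d * G) = (real d - 1) * (real d + 1) / (2 * real d) * F - (real d - 1) / 2 * G" for F G
      using d1 by (simp add: field_simps)
    have 2: "A * (\<Sum>k\<le>d. f k) - B * (\<Sum>k\<le>d. g k) + C * (\<Sum>k\<le>d. (real k - 1) * f k) - E * (\<Sum>k\<le>d. (real k - 1) * g k) =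
        (\<Sum>k\<le>d. f k * (A + C * (real k - 1))) - (\<Sum>k\<le>d. g k * (B + E * (real k - 1)))" for A B C E
      by (simp add: sum_distrib_left distrib_left sum.distrib mult_ac)
    show ?thesis unfolding a b a' b' 1 by (rule 2)
  qed
  also have "\<dots> = - ((real d - 1) / (2 * real d)) * (\<Sum>j\<le>Suc d. pi_vec (Suc d) j * c j)"
    unfolding f_def g_def x0_def by (rule sum_pi_vec[OF d2])
  finally show ?thesis by (simp add: X_def)
qed

text \<open>\<open>e\<close> enters the rate only through the difference of the primed quantities.
  Adding a constant multiple of the unperturbed polynomial rescales to first order and leaves the
  logarithmic derivative alone, so that difference is 0.\<close>

lemma (in perturbed_recursion) critical_rate_const_slope:
  assumes "r = p + smult b ([:1, 1:] ^ d)"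
  shows "critical_rate e = critical_rate e'"
proof -
  have pos: "(1 + x0) ^ d > 0" "1 + x0 > 0" using x0_props(1) by auto
  have B: "poly ([:1, 1:] ^ d) x0 = (1 + x0) ^ d" by (simp add: poly_power add.commute)
  have B1: "poly (pderiv ([:1, 1:] ^ d)) x0 = real d / (1 + x0) * (1 + x0) ^ d"
    using binomial_poly_derivs(1)[of x0 d] pos(2) unfolding B by (simp add: field_simps)
  have r0: "poly r x0 = poly p x0 + b * (1 + x0) ^ d"
    using arg_cong[OF assms, of "\<lambda>q. poly q x0"] by (simp only: poly_add poly_smult B)
  have r1: "poly (pderiv r) x0 = poly (pderiv p) x0 + b * (real d / (1 + x0)) * (1 + x0) ^ d"
    using arg_cong[OF assms, of "\<lambda>q. poly (pderiv q) x0"] by (simp only: pderiv_add pderiv_smult poly_add poly_smult B1 mult.assoc)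
  have "\<beta> = \<alpha> + b"
    unfolding \<beta>_def \<alpha>_def r0 using pos by (simp add: add_divide_distrib)
  moreover have "poly (pderiv r) x0 / (1 + x0) ^ d = poly (pderiv p) x0 / (1 + x0) ^ d + b * (real d / (1 + x0))"
    unfolding r1 using pos by (simp add: add_divide_distrib)
  ultimately have "\<beta>' = \<alpha>'" by (simp add: \<alpha>'_def \<beta>'_def algebra_simps add_divide_distrib)
  then show ?thesis by (simp add: critical_rate_def)
qed

lemma (in perturbed_recursion) lnA_lnM_prod:
  assumes h: "h \<in> {0..h0}" and l: "l \<in> {lo..hi}" and u: "u \<in> {lo..hi}"
  shows "lnA (real d) h u + lnM (real d) h l = ln (u * (S h u / T h u) ^ d * S h l)"
    and "lnA 0 h u + lnM 0 h l = ln (u * (S h l / T h l) ^ d * S h l)"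
  using S_pos[OF u h] S_pos[OF l h] T_pos[OF u h] T_pos[OF l h] u l lo
  by (auto simp: lnA_def lnM_def ln_mult ln_div ln_realpow)

text \<open>For small \<open>h\<close> and \<open>c\<close> convex but not affine, the determinant is \<open>h\<close> times a quantity bounded
  away from zero, up to \<open>O(h\<^sup>2)\<close>; for affine \<open>c\<close> it is a negative multiple of \<open>h\<^sup>2\<close>.\<close>

lemma site_poly_det:
  fixes h :: real
  defines "\<theta> \<equiv> \<lambda>c k. 1 + c k * h"
  shows "site_poly (\<lambda>k. \<theta> c (Suc (Suc k))) C x * site_poly (\<theta> c) C x - (site_poly (\<lambda>k. \<theta> c (Suc k)) C x)\<^sup>2 =
    h * (site_poly (\<lambda>_. 1) C x * site_poly (\<lambda>k. c (Suc (Suc k)) + c k + (-2) * c (Suc k)) C x) +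
    h\<^sup>2 * (site_poly (\<lambda>k. c (Suc (Suc k))) C x * site_poly c C x - (site_poly (\<lambda>k. c (Suc k)) C x)\<^sup>2)"
proof -
  have e: "site_poly (\<lambda>k. 1 + a k * h) C x = site_poly (\<lambda>_. 1) C x + h * site_poly a C x" for a
    using site_poly_add[of "\<lambda>_. 1" "\<lambda>k. h * a k" C x] site_poly_cmult[of h a C x] by (simp add: mult.commute)
  show ?thesis
    unfolding \<theta>_def e unfolding site_poly_add site_poly_cmult by (simp add: algebra_simps power2_eq_square)
qed

lemma second_differences_nonneg:
  assumes "convex_vector D c" "Suc (Suc k) \<le> D"
  shows "c (Suc (Suc k)) + c k + (-2) * c (Suc k) \<ge> 0"
  using assms unfolding convex_vector_def by (auto dest!: bspec[of _ _ "Suc k"])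

lemma affine_of_second_differences:
  fixes c :: "nat \<Rightarrow> real"
  assumes "\<And>k. Suc (Suc k) \<le> D \<Longrightarrow> c (Suc (Suc k)) + c k + (-2) * c (Suc k) = 0" "Suc k \<le> D"
  shows "c (Suc k) = c k + (c 1 - c 0)"
  using assms(2)
proof (induction k)
  case (Suc k)
  then show ?case using assms(1)[of k] by simp
qed simp

text \<open>The first-order term is at least h \<delta> and the second-order term at least -h^2 N,
  with \<delta> and N common to all sets \<open>C\<close> and vectors \<open>x\<close>; hence one
  threshold \<delta> / N.\<close>

lemma det_nonneg_small:
  assumes conv: "convex_vector D c" and D: "D \<ge> 2" and k0: "Suc (Suc k0) \<le> D" "c (Suc (Suc k0)) + c k0 + (-2) * c (Suc k0) > 0"
    and lo: "0 < lo" "lo \<le> hi"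
  shows "\<exists>\<epsilon>>0. \<forall>h\<in>{0<..<\<epsilon>}. \<forall>(C :: nat list set) x. finite C \<longrightarrow> Suc (card C) = D - 1 \<longrightarrow> (\<forall>v\<in>C. x v \<in> {lo..hi}) \<longrightarrow>
    site_poly (\<lambda>k. 1 + c (Suc (Suc k)) * h) C x * site_poly (\<lambda>k. 1 + c k * h) C x - (site_poly (\<lambda>k. 1 + c (Suc k) * h) C x)\<^sup>2 \<ge> 0"
proof -
  define K where "K = (\<Sum>k\<le>D. \<bar>c k\<bar>)"
  have K: "\<bar>c k\<bar> \<le> K" if "k \<le> D" for k unfolding K_def using that by (intro member_le_sum) auto
  have K0: "K \<ge> 0" using K[of 0] by simp
  \<comment> \<open>The strictly positive second difference with its monomial at the smallest
    argument. By convexity all other second differences only add to it.\<close>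
  define \<delta> where "\<delta> = (c (Suc (Suc k0)) + c k0 + (-2) * c (Suc k0)) * lo ^ k0"
  have \<delta>: "\<delta> > 0" using k0(2) lo(1) by (simp add: \<delta>_def)
  define Z where "Z = (1 + hi) ^ (D - 2)"
  \<comment> \<open>Each of the two products in the coefficient of h^2 is at most
    \<open>(K * Z)\<^sup>2\<close>; the added 1 makes \<open>N\<close> a safe denominator.\<close>
  define N where "N = 2 * (K * Z)\<^sup>2 + 1"
  have N: "N > 0" by (simp add: N_def add_nonneg_pos)
  show ?thesis
  proof (intro exI[of _ "\<delta> / N"] conjI ballI allI impI)
    show "\<delta> / N > 0" using \<delta> N by simp
    fix h and C :: "nat list set" and x assume h: "h \<in> {0<..<\<delta> / N}" and C: "finite C" "Suc (card C) = D - 1" and x: "\<forall>v\<in>C. x v \<in> {lo..hi}"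
    have cC: "card C = D - 2" using C(2) by simp
    have x0: "0 \<le> x v" if "v \<in> C" for v using x lo that by force
    define P where "P j = site_poly (\<lambda>k. c (k + j)) C x" for j
    have "(\<Prod>v\<in>C. 1 + x v) \<le> (\<Prod>v\<in>C. 1 + hi)" using x x0 by (intro prod_mono) force
    then have Zle: "(\<Prod>v\<in>C. 1 + x v) \<le> Z" by (simp add: Z_def cC)
    have Z1: "1 \<le> (\<Prod>v\<in>C. 1 + x v)" using x0 by (intro prod_ge_1) auto
    have P: "\<bar>P j\<bar> \<le> K * Z" if "j \<le> 2" for j
    proof -
      have "\<bar>P j\<bar> \<le> K * (\<Prod>v\<in>C. 1 + x v)"
        unfolding P_def by (rule site_poly_abs_le[OF C(1)]) (use K cC D that x0 in auto)
      also have "\<dots> \<le> K * Z" using Zle K0 by (rule mult_left_mono)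
      finally show ?thesis .
    qed
    define \<Delta> where "\<Delta> k = c (Suc (Suc k)) + c k + (-2) * c (Suc k)" for k
    have "\<delta> \<le> site_poly \<Delta> C x"
    proof -
      let ?e = "\<lambda>k. if k = k0 then \<Delta> k0 else 0"
      have "site_poly ?e C (\<lambda>_. lo) \<le> site_poly \<Delta> C x"
      proof (rule site_poly_mono[OF C(1)])
        fix k assume k: "k \<le> card C"
        show "0 \<le> ?e k" using k0(2) by (simp add: \<Delta>_def)
        show "?e k \<le> \<Delta> k" using second_differences_nonneg[OF conv, of k] k cC D by (simp add: \<Delta>_def)
      qed (use lo x in auto)
      moreover have "site_poly ?e C (\<lambda>_. lo) = real (card C choose k0) * \<Delta> k0 * lo ^ k0"
      proof -
        have "site_poly ?e C (\<lambda>_. lo) = (\<Sum>k\<le>card C. if k = k0 then real (card C choose k0) * \<Delta> k0 * lo ^ k0 else 0)"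
          unfolding site_poly_const[OF C(1)] by (rule sum.cong) auto
        then show ?thesis using k0(1) cC by simp
      qed
      moreover have "1 * (\<Delta> k0 * lo ^ k0) \<le> real (card C choose k0) * (\<Delta> k0 * lo ^ k0)"
      proof (rule mult_right_mono)
        have "0 < card C choose k0" using k0(1) cC by simp
        then show "1 \<le> real (card C choose k0)" by linarith
        show "0 \<le> \<Delta> k0 * lo ^ k0" using k0(2) lo by (simp add: \<Delta>_def)
      qed
      moreover have "\<delta> = \<Delta> k0 * lo ^ k0" by (simp add: \<delta>_def \<Delta>_def)
      ultimately show ?thesis by (simp add: mult.assoc)
    qed
    then have "1 * \<delta> \<le> (\<Prod>v\<in>C. 1 + x v) * site_poly \<Delta> C x"
      using Z1 \<delta> by (intro mult_mono) auto
    then have main: "\<delta> \<le> site_poly (\<lambda>_. 1) C x * site_poly \<Delta> C x" by (simp add: site_poly_one[OF C(1)])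
    have err: "- N \<le> P 2 * P 0 - (P 1)\<^sup>2"
    proof -
      have KZ: "0 \<le> K * Z" using P[of 0] by simp
      have "\<bar>P 2 * P 0\<bar> \<le> (K * Z) * (K * Z)" unfolding abs_mult using P[of 2] P[of 0] KZ by (intro mult_mono) auto
      moreover have "(P 1)\<^sup>2 \<le> (K * Z)\<^sup>2" using P[of 1] by (metis abs_le_square_iff abs_of_nonneg KZ one_le_numeral)
      ultimately show ?thesis unfolding N_def by (simp add: power2_eq_square abs_le_iff)
    qed
    have hN: "h * N \<le> \<delta>" using h N by (simp add: pos_less_divide_eq less_imp_le)
    have "0 \<le> h * (\<delta> - h * N)" using hN h by simp
    also have "\<dots> = h * \<delta> + h\<^sup>2 * (- N)" by (simp add: algebra_simps power2_eq_square)
    also have "\<dots> \<le> h * (site_poly (\<lambda>_. 1) C x * site_poly \<Delta> C x) + h\<^sup>2 * (P 2 * P 0 - (P 1)\<^sup>2)"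
      using main err h by (intro add_mono mult_left_mono) auto
    also have "\<dots> = site_poly (\<lambda>k. 1 + c (Suc (Suc k)) * h) C x * site_poly (\<lambda>k. 1 + c k * h) C x - (site_poly (\<lambda>k. 1 + c (Suc k) * h) C x)\<^sup>2"
      unfolding site_poly_det P_def \<Delta>_def by simp
    finally show "0 \<le> site_poly (\<lambda>k. 1 + c (Suc (Suc k)) * h) C x * site_poly (\<lambda>k. 1 + c k * h) C x - (site_poly (\<lambda>k. 1 + c (Suc k) * h) C x)\<^sup>2" .
  qed
qed

text \<open>Shifting the index of an arithmetic progression adds multiples of the constant sequence.
  The first-order term vanishes and what remains is minus the square of h b Z.\<close>

lemma det_nonpos_affine:
  fixes c :: "nat \<Rightarrow> real"
  assumes aff: "\<And>k. Suc k \<le> D \<Longrightarrow> c (Suc k) = c k + b" and C: "finite C" "Suc (Suc (card C)) \<le> D"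
  shows "site_poly (\<lambda>k. 1 + c (Suc (Suc k)) * h) C x * site_poly (\<lambda>k. 1 + c k * h) C x - (site_poly (\<lambda>k. 1 + c (Suc k) * h) C x)\<^sup>2 \<le> 0"
proof -
  define Z where "Z = site_poly (\<lambda>_. 1) C x"
  have p1: "site_poly (\<lambda>k. c (Suc k)) C x = site_poly c C x + b * Z"
  proof -
    have "site_poly (\<lambda>k. c (Suc k)) C x = site_poly (\<lambda>k. c k + b * 1) C x"
      by (rule site_poly_cong_coeff[OF C(1)]) (use aff C in auto)
    then show ?thesis unfolding site_poly_add site_poly_cmult Z_def .
  qed
  have p2: "site_poly (\<lambda>k. c (Suc (Suc k))) C x = site_poly c C x + 2 * b * Z"
  proof -
    have "site_poly (\<lambda>k. c (Suc (Suc k))) C x = site_poly (\<lambda>k. c k + (2 * b) * 1) C x"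
      by (rule site_poly_cong_coeff[OF C(1)]) (use aff C in auto)
    then show ?thesis unfolding site_poly_add site_poly_cmult Z_def .
  qed
  have "site_poly (\<lambda>k. 1 + c (Suc (Suc k)) * h) C x * site_poly (\<lambda>k. 1 + c k * h) C x - (site_poly (\<lambda>k. 1 + c (Suc k) * h) C x)\<^sup>2
      = - (h * b * Z)\<^sup>2"
    unfolding site_poly_det unfolding site_poly_add site_poly_cmult p1 p2 Z_def[symmetric]
    by (simp add: power2_eq_square algebra_simps)
  then show ?thesis by simp
qed

context bounded_model
begin

lemma cycle_le:
  assumes "b \<ge> 0" "c \<ge> 0"
  shows "lam * (T c / S c) ^ d / S b \<le> a \<longleftrightarrow> lam \<le> a * (S c / T c) ^ d * S b"
    and "a \<le> lam * (T c / S c) ^ d / S b \<longleftrightarrow> a * (S c / T c) ^ d * S b \<le> lam"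
proof -
  have "S c > 0" "T c > 0" "S b > 0" using ST_pos assms by auto
  then show "lam * (T c / S c) ^ d / S b \<le> a \<longleftrightarrow> lam \<le> a * (S c / T c) ^ d * S b"
    "a \<le> lam * (T c / S c) ^ d / S b \<longleftrightarrow> a * (S c / T c) ^ d * S b \<le> lam"
    by (simp_all add: power_divide field_simps)
qed

end

text \<open>With x = 1 / (D - 2) this is x (1 + x)^(D - 1), the value of A times M at the critical
  fixed point for h = 0.\<close>

lemma lambda_crit_eq:
  assumes "D \<ge> 3"
  shows "lambda_crit D = 1 / (real (D - 1) - 1) * (1 + 1 / (real (D - 1) - 1)) ^ (D - 1)"
proof -
  define n where "n = D - 3"
  have D: "D = Suc (Suc (Suc n))" using assms by (simp add: n_def)
  have "1 + 1 / (real n + 1) = (real n + 2) / (real n + 1)" by (simp add: field_simps)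
  then show ?thesis by (simp add: lambda_crit_def D power_divide add.commute)
qed

section \<open>Perturbing the critical model in the direction \<open>c\<close>\<close>

locale critical_perturbation =
  fixes D :: nat and c :: "nat \<Rightarrow> real"
  assumes D3: "D \<ge> 3"
begin

text \<open>Keeps every \<open>\<bar>c k * h\<bar>\<close> at or below 1/2, so that all weights stay
  in the range required by \<open>bounded_model\<close>.\<close>

definition "h0 = 1 / (2 * (1 + (\<Sum>k\<le>D. \<bar>c k\<bar>)))"
definition "lam = lambda_crit D"

lemma h0_pos: "h0 > 0"
  unfolding h0_def by (simp add: add_pos_nonneg sum_nonneg)

lemma \<theta>_range:
  assumes "h \<in> {0..h0}" "k \<le> D"
  shows "1 / 2 \<le> 1 + c k * h \<and> 1 + c k * h \<le> 2"
proof -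
  define K where "K = (\<Sum>k\<le>D. \<bar>c k\<bar>)"
  have K: "\<bar>c k\<bar> \<le> K" unfolding K_def using assms(2) by (intro member_le_sum) auto
  have "\<bar>c k * h\<bar> \<le> K * h0"
    unfolding abs_mult using K assms(1) by (intro mult_mono) auto
  also have "\<dots> \<le> 1 / 2"
    unfolding h0_def K_def[symmetric] using K by (simp add: divide_simps)
  finally have "c k * h \<le> 1 / 2" "- (c k * h) \<le> 1 / 2" by (simp_all only: abs_le_iff)
  then show ?thesis by linarith
qed

lemma lam_pos: "lam > 0"
  using D3 by (simp add: lam_def lambda_crit_def)

lemma bounded: "h \<in> {0..h0} \<Longrightarrow> bounded_model D lam (\<lambda>k. 1 + c k * h)"
  using D3 lam_pos \<theta>_range by unfold_locales auto

sublocale M0: bounded_model D lam "\<lambda>k. 1 + c k * 0"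
  using bounded[of 0] h0_pos by simp

text \<open>These are \<open>x_max\<close> and \<open>x_min\<close> of every perturbed model,
  written without h: a single compact interval serves all small perturbations.\<close>

definition "hi = 2 * lam * 4 ^ (D - 1)"
definition "lo = lam / (4 ^ (D - 1) * (2 * (1 + hi) ^ (D - 1)))"

lemma hi_lo: "M0.x_max = hi" "M0.x_min = lo"
  by (simp_all add: M0.x_max_def M0.x_min_def hi_def lo_def)

lemma lo_pos: "lo > 0" and lo_le_hi: "lo \<le> hi"
  using M0.x_min_pos M0.x_min_le_max by (simp_all add: hi_lo)

sublocale P: perturbed_recursion "D - 1" "count_poly (D - 1) c" "count_poly (D - 1) (\<lambda>k. c (Suc k))" h0 lo hi
proof
  fix x h assume x: "x \<in> {lo..hi}" and h: "h \<in> {0..h0}"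
  interpret M: bounded_model D lam "\<lambda>k. 1 + c k * h" by (rule bounded[OF h])
  show "0 < pert ([:1, 1:] ^ (D - 1)) (count_poly (D - 1) c) 0 h x"
    "0 < pert ([:1, 1:] ^ (D - 1)) (count_poly (D - 1) (\<lambda>k. c (Suc k))) 0 h x"
    using M.ST_pos[of x] x lo_pos unfolding offspring_poly_linear by auto
qed (use D3 h0_pos lo_pos in auto)

lemma lam_eq: "lam = P.x0 * (1 + P.x0) ^ (D - 1)"
  unfolding lam_def lambda_crit_eq[OF D3] P.x0_def ..

text \<open>From \<open>lam = x0 * (1 + x0) ^ (D - 1)\<close> follows
  \<open>x0 \<le> lam < hi\<close>, and the denominator in \<open>lo\<close> exceeds
  \<open>(1 + x0) ^ (D - 1)\<close>.\<close>

lemma x0_range: "lo < P.x0" "P.x0 < hi"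
proof -
  have x0: "P.x0 > 0" by (rule P.x0_props)
  have "1 \<le> (1 + P.x0) ^ (D - 1)" using x0 by (intro one_le_power) simp
  then have le: "P.x0 \<le> lam" unfolding lam_eq using x0 by simp
  have four: "1 \<le> (4::real) ^ (D - 1)" by (rule one_le_power) simp
  then have eight: "1 < 2 * (4::real) ^ (D - 1)" by linarith
  have "lam * 1 < lam * (2 * 4 ^ (D - 1))" by (rule mult_strict_left_mono[OF eight lam_pos])
  then have "lam < hi" by (simp add: hi_def mult_ac)
  then show *: "P.x0 < hi" using le by simp
  have "(1 + P.x0) ^ (D - 1) \<le> (1 + hi) ^ (D - 1)" using * x0 by (intro power_mono) auto
  then have "lam \<le> P.x0 * (1 + hi) ^ (D - 1)" unfolding lam_eq using x0 by simp
  also have "\<dots> < P.x0 * (1 + hi) ^ (D - 1) * (2 * 4 ^ (D - 1))"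
  proof -
    have "(1 + hi) ^ (D - 1) > 0" using * x0 by simp
    then have "P.x0 * (1 + hi) ^ (D - 1) * 1 < P.x0 * (1 + hi) ^ (D - 1) * (2 * 4 ^ (D - 1))"
      using x0 by (intro mult_strict_left_mono[OF eight]) auto
    then show ?thesis by simp
  qed
  finally have "lam < P.x0 * (4 ^ (D - 1) * (2 * (1 + hi) ^ (D - 1)))" by (simp add: mult_ac)
  moreover have "4 ^ (D - 1) * (2 * (1 + hi) ^ (D - 1)) > 0" using * x0 by simp
  ultimately show "lo < P.x0" unfolding lo_def by (simp add: pos_divide_less_eq)
qed

lemma rate_sign: "P.critical_rate (real (D - 1)) > 0 \<longleftrightarrow> (\<Sum>j\<le>D. pi_vec D j * c j) < 0"
  "P.critical_rate (real (D - 1)) < 0 \<longleftrightarrow> (\<Sum>j\<le>D. pi_vec D j * c j) > 0"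
proof -
  have SD: "Suc (D - 1) = D" using D3 by simp
  define X where "X = (1 + P.x0) ^ (D - 1)"
  define k where "k = (real (D - 1) - 1) / (2 * real (D - 1))"
  have X: "X > 0" and k: "k > 0" using P.x0_props(1) D3 by (auto simp: X_def k_def)
  have eq: "X * P.critical_rate (real (D - 1)) = - k * (\<Sum>j\<le>D. pi_vec D j * c j)"
    using P.critical_rate_pi_vec[OF refl refl] unfolding SD X_def k_def .
  show "P.critical_rate (real (D - 1)) > 0 \<longleftrightarrow> (\<Sum>j\<le>D. pi_vec D j * c j) < 0"
    using X k zero_less_mult_iff[of X "P.critical_rate (real (D - 1))"] unfolding eq by (simp add: mult_less_0_iff)
  show "P.critical_rate (real (D - 1)) < 0 \<longleftrightarrow> (\<Sum>j\<le>D. pi_vec D j * c j) > 0"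
    using X k mult_less_0_iff[of X "P.critical_rate (real (D - 1))"] unfolding eq by (simp add: zero_less_mult_iff)
qed

lemma nonunique:
  assumes "(\<Sum>j\<le>D. pi_vec D j * c j) > 0"
  shows "direction_of_nonuniqueness D c"
proof -
  have rate: "P.critical_rate (real (D - 1)) < 0" using assms rate_sign by simp
  have ends: "lo \<in> {lo..hi}" "hi \<in> {lo..hi}" using lo_le_hi by auto
  \<comment> \<open>The message map sends the interval into itself. At the corners
    \<open>(lo, hi)\<close> and \<open>(hi, lo)\<close> this invariance is the end condition of
    \<open>nonunique_pair\<close>.\<close>
  have box: "P.lnA (real (D - 1)) h hi + P.lnM (real (D - 1)) h lo \<ge> ln (P.x0 * (1 + P.x0) ^ (D - 1))"
    "P.lnA (real (D - 1)) h lo + P.lnM (real (D - 1)) h hi \<le> ln (P.x0 * (1 + P.x0) ^ (D - 1))" if h: "h \<in> {0..h0}" for h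
  proof -
    interpret M: bounded_model D lam "\<lambda>k. 1 + c k * h" by (rule bounded[OF h])
    have b: "M.x_max = hi" "M.x_min = lo" by (simp_all add: M.x_max_def M.x_min_def hi_def lo_def)
    have nn: "0 \<le> lo" "0 \<le> hi" using lo_pos lo_le_hi by auto
    have 1: "lam \<le> hi * (M.S hi / M.T hi) ^ (D - 1) * M.S lo"
      using M.\<Phi>_range[of lo hi] ends M.cycle_le(1)[OF nn, of hi] by (simp add: b)
    have 2: "lo * (M.S lo / M.T lo) ^ (D - 1) * M.S hi \<le> lam"
      using M.\<Phi>_range[of hi lo] ends M.cycle_le(2)[OF nn(2,1), of lo] by (simp add: b)
    have p: "0 < lo * (M.S lo / M.T lo) ^ (D - 1) * M.S hi"
      using M.ST_pos[OF nn(1)] M.ST_pos[OF nn(2)] lo_pos by simp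
    show "P.lnA (real (D - 1)) h hi + P.lnM (real (D - 1)) h lo \<ge> ln (P.x0 * (1 + P.x0) ^ (D - 1))"
      unfolding P.lnA_lnM_prod(1)[OF h ends] lam_eq[symmetric] offspring_poly_linear[symmetric]
      using 1 lam_pos by (intro ln_mono) auto
    show "P.lnA (real (D - 1)) h lo + P.lnM (real (D - 1)) h hi \<le> ln (P.x0 * (1 + P.x0) ^ (D - 1))"
      unfolding P.lnA_lnM_prod(1)[OF h ends(2,1)] lam_eq[symmetric] offspring_poly_linear[symmetric]
      using 2 p by (intro ln_mono) auto
  qed
  obtain \<epsilon> where \<epsilon>: "\<epsilon> > 0" "\<epsilon> \<le> h0" and cyc: "\<And>h. h \<in> {0<..<\<epsilon>} \<Longrightarrow> \<exists>l\<in>{lo..hi}. \<exists>u\<in>{lo..hi}. l < u \<and>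
     P.lnA (real (D - 1)) h u + P.lnM (real (D - 1)) h l = ln lam \<and> P.lnA (real (D - 1)) h l + P.lnM (real (D - 1)) h u = ln lam"
    using P.nonunique_pair[OF x0_range rate box] unfolding lam_eq[symmetric] by blast
  have "\<not> uniqueness_regime D lam (\<lambda>k. 1 + c k * h)" if h: "h \<in> {0<..<\<epsilon>}" for h
  proof -
    have h': "h \<in> {0..h0}" using h \<epsilon> by auto
    interpret M: bounded_model D lam "\<lambda>k. 1 + c k * h" by (rule bounded[OF h'])
    obtain l u where lu: "l \<in> {lo..hi}" "u \<in> {lo..hi}" "l < u"
      "P.lnA (real (D - 1)) h u + P.lnM (real (D - 1)) h l = ln lam" "P.lnA (real (D - 1)) h l + P.lnM (real (D - 1)) h u = ln lam"
      using cyc[OF h] by blast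
    have pos: "l > 0" "u > 0" using lu lo_pos by auto
    have prod_pos: "0 < a * (M.S a / M.T a) ^ (D - 1) * M.S b" if "a > 0" "b > 0" for a b
      using M.ST_pos[of a] M.ST_pos[of b] that by simp
    have 1: "u * (M.S u / M.T u) ^ (D - 1) * M.S l = lam"
      using lu(4) prod_pos[OF pos(2,1)] lam_pos
      unfolding P.lnA_lnM_prod(1)[OF h' lu(1,2)] offspring_poly_linear[symmetric] by (simp only: ln_inj_iff)
    have 2: "l * (M.S l / M.T l) ^ (D - 1) * M.S u = lam"
      using lu(5) prod_pos[OF pos] lam_pos
      unfolding P.lnA_lnM_prod(1)[OF h' lu(2,1)] offspring_poly_linear[symmetric] by (simp only: ln_inj_iff)
    show ?thesis
    proof (rule two_cycle_not_unique[where l = l and u = u])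
      show "l = lam * (M.T l / M.S l) ^ (D - 1) / M.S u"
        by (rule iffD2[OF M.cycle_eq 2]) (use pos in auto)
      show "u = lam * (M.T u / M.S u) ^ (D - 1) / M.S l"
        by (rule iffD2[OF M.cycle_eq 1]) (use pos in auto)
    qed (use M.\<theta>_pos lam_pos pos lu D3 in auto)
  qed
  moreover have "1 + c k * h > 0" if "h \<in> {0<..<\<epsilon>}" "k \<le> D" for h k
    using \<theta>_range[of h k] that \<epsilon> by auto
  ultimately show ?thesis
    unfolding direction_of_nonuniqueness_def lam_def using \<epsilon>(1) by blast
qed

lemma unique:
  assumes conv: "convex_vector D c" and neg: "(\<Sum>j\<le>D. pi_vec D j * c j) < 0"
  shows "direction_of_uniqueness D c"
proof -
  have rate: "P.critical_rate (real (D - 1)) > 0" using neg rate_sign by simp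
  have "\<exists>\<epsilon>>0. \<epsilon> \<le> h0 \<and> (\<forall>h\<in>{0<..<\<epsilon>}. uniqueness_regime D lam (\<lambda>k. 1 + c k * h))"
  \<comment> \<open>The cases differ in whether the first-order term of the determinant vanishes
    identically, which decides the direction of monotonicity of the ratio.\<close>
  proof (cases "\<forall>k. Suc (Suc k) \<le> D \<longrightarrow> c (Suc (Suc k)) + c k + (-2) * c (Suc k) = 0")
    case True
    define b where "b = c 1 - c 0"
    have aff: "c (Suc k) = c k + b" if "Suc k \<le> D" for k
      using affine_of_second_differences[of D c k] True that by (simp add: b_def)
    have "poly (count_poly (D - 1) (\<lambda>k. c (Suc k))) x = poly (count_poly (D - 1) c + smult b ([:1, 1:] ^ (D - 1))) x" for x
    proof -
      have "poly ([:1, 1:] ^ (D - 1)) x = (\<Sum>k\<le>D - 1. real (D - 1 choose k) * x ^ k)"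
        using binomial_ring[of x 1 "D - 1"] by (simp add: poly_power add.commute)
      moreover have "(\<Sum>k\<le>D - 1. real (D - 1 choose k) * c (Suc k) * x ^ k) = (\<Sum>k\<le>D - 1. real (D - 1 choose k) * (c k + b) * x ^ k)"
        by (rule sum.cong) (use aff D3 in auto)
      ultimately show ?thesis
        by (simp add: count_poly_def poly_sum_monom sum_distrib_left algebra_simps flip: sum.distrib)
    qed
    then have r: "count_poly (D - 1) (\<lambda>k. c (Suc k)) = count_poly (D - 1) c + smult b ([:1, 1:] ^ (D - 1))"
      using poly_eq_poly_eq_iff by blast
    \<comment> \<open>A decreasing ratio calls for the system with \<open>e = 0\<close>, whereas
      \<open>pi_vec\<close> was computed for \<open>e = D - 1\<close>; for affine \<open>c\<close>
      the two rates coincide.\<close>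
    have rate0: "P.critical_rate 0 > 0" using rate P.critical_rate_const_slope[OF r, of 0 "real (D - 1)"] by simp
    obtain \<epsilon> where \<epsilon>: "\<epsilon> > 0" "\<epsilon> \<le> h0" and uniq: "\<And>h l u. h \<in> {0<..<\<epsilon>} \<Longrightarrow> l \<in> {lo..hi} \<Longrightarrow> u \<in> {lo..hi} \<Longrightarrow>
       P.lnA 0 h u + P.lnM 0 h l = ln lam \<Longrightarrow> P.lnA 0 h l + P.lnM 0 h u = ln lam \<Longrightarrow> l = u"
      using P.unique_pair[OF x0_range rate0] unfolding lam_eq[symmetric] by blast
    have "uniqueness_regime D lam (\<lambda>k. 1 + c k * h)" if h: "h \<in> {0<..<\<epsilon>}" for h
    proof -
      have h': "h \<in> {0..h0}" using h \<epsilon> by auto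
      interpret M: bounded_model D lam "\<lambda>k. 1 + c k * h" by (rule bounded[OF h'])
      have b: "M.x_max = hi" "M.x_min = lo" by (simp_all add: M.x_max_def M.x_min_def hi_def lo_def)
      show ?thesis
      proof (rule M.unique_if_ratio_decreasing; unfold b)
        fix l u assume lu: "l \<in> {lo..hi}" "u \<in> {lo..hi}"
          "u * (M.S l / M.T l) ^ (D - 1) * M.S l = lam" "l * (M.S u / M.T u) ^ (D - 1) * M.S u = lam"
        show "l = u"
        proof (rule uniq[OF h lu(1,2)])
          show "P.lnA 0 h u + P.lnM 0 h l = ln lam"
            unfolding P.lnA_lnM_prod(2)[OF h' lu(1,2)] offspring_poly_linear[symmetric] lu(3) ..
          show "P.lnA 0 h l + P.lnM 0 h u = ln lam"
            unfolding P.lnA_lnM_prod(2)[OF h' lu(2,1)] offspring_poly_linear[symmetric] lu(4) ..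
        qed
      next
        fix C :: "nat list set" and x x' :: "nat list \<Rightarrow> real"
        assume C: "finite C" "card C = D - 1" and x: "\<And>c. c \<in> C \<Longrightarrow> x c \<in> {lo..hi}" "\<And>c. c \<in> C \<Longrightarrow> x' c \<in> {lo..hi}"
          "\<And>c. c \<in> C \<Longrightarrow> x c \<le> x' c"
        have "- 1 * M.y_ratio C x \<le> - 1 * M.y_ratio C x'"
          unfolding M.y_ratio_def
        proof (rule site_poly_ratio_mono[OF C(1) x])
          fix z :: "nat list \<Rightarrow> real" assume "\<And>c. c \<in> C \<Longrightarrow> z c \<in> {lo..hi}"
          then have "\<And>c. c \<in> C \<Longrightarrow> 0 \<le> z c" using lo_pos by force
          then show "site_poly (\<lambda>k. 1 + c k * h) C z > 0" using M.E_bounds(1)[OF C, of z] by auto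
        next
          fix C' :: "nat list set" and z :: "nat list \<Rightarrow> real" assume "finite C'" "Suc (card C') = card C"
          then show "0 \<le> - 1 * (site_poly (\<lambda>k. 1 + c (Suc (Suc k)) * h) C' z * site_poly (\<lambda>k. 1 + c k * h) C' z - (site_poly (\<lambda>k. 1 + c (Suc k) * h) C' z)\<^sup>2)"
            using det_nonpos_affine[of D c b C' h z] aff C(2) by simp
        qed
        then show "M.y_ratio C x' \<le> M.y_ratio C x" by simp
      qed
    qed
    then show ?thesis using \<epsilon> by blast
  next
    case False
    then obtain k0 where k0: "Suc (Suc k0) \<le> D" "c (Suc (Suc k0)) + c k0 + (-2) * c (Suc k0) \<noteq> 0" by blast
    then have k0': "c (Suc (Suc k0)) + c k0 + (-2) * c (Suc k0) > 0"
      using second_differences_nonneg[OF conv k0(1)] by simp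
    obtain e1 where e1: "e1 > 0" "e1 \<le> h0" and uniq: "\<And>h l u. h \<in> {0<..<e1} \<Longrightarrow> l \<in> {lo..hi} \<Longrightarrow> u \<in> {lo..hi} \<Longrightarrow>
       P.lnA (real (D - 1)) h u + P.lnM (real (D - 1)) h l = ln lam \<Longrightarrow> P.lnA (real (D - 1)) h l + P.lnM (real (D - 1)) h u = ln lam \<Longrightarrow> l = u"
      using P.unique_pair[OF x0_range rate] unfolding lam_eq[symmetric] by blast
    obtain e2 where e2: "e2 > 0" and det: "\<And>h (C :: nat list set) x. h \<in> {0<..<e2} \<Longrightarrow> finite C \<Longrightarrow> Suc (card C) = D - 1 \<Longrightarrow> (\<And>v. v \<in> C \<Longrightarrow> x v \<in> {lo..hi}) \<Longrightarrow>
      site_poly (\<lambda>k. 1 + c (Suc (Suc k)) * h) C x * site_poly (\<lambda>k. 1 + c k * h) C x - (site_poly (\<lambda>k. 1 + c (Suc k) * h) C x)\<^sup>2 \<ge> 0"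
      using det_nonneg_small[OF conv _ k0(1) k0' lo_pos lo_le_hi] D3 by auto
    have "uniqueness_regime D lam (\<lambda>k. 1 + c k * h)" if h: "h \<in> {0<..<min e1 e2}" for h
    proof -
      have h': "h \<in> {0..h0}" "h \<in> {0<..<e1}" "h \<in> {0<..<e2}" using h e1 by auto
      interpret M: bounded_model D lam "\<lambda>k. 1 + c k * h" by (rule bounded[OF h'(1)])
      have b: "M.x_max = hi" "M.x_min = lo" by (simp_all add: M.x_max_def M.x_min_def hi_def lo_def)
      show ?thesis
      proof (rule M.unique_if_ratio_increasing; unfold b)
        fix l u assume lu: "l \<in> {lo..hi}" "u \<in> {lo..hi}"
          "u * (M.S u / M.T u) ^ (D - 1) * M.S l = lam" "l * (M.S l / M.T l) ^ (D - 1) * M.S u = lam"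
        show "l = u"
        proof (rule uniq[OF h'(2) lu(1,2)])
          show "P.lnA (real (D - 1)) h u + P.lnM (real (D - 1)) h l = ln lam"
            unfolding P.lnA_lnM_prod(1)[OF h'(1) lu(1,2)] offspring_poly_linear[symmetric] lu(3) ..
          show "P.lnA (real (D - 1)) h l + P.lnM (real (D - 1)) h u = ln lam"
            unfolding P.lnA_lnM_prod(1)[OF h'(1) lu(2,1)] offspring_poly_linear[symmetric] lu(4) ..
        qed
      next
        fix C :: "nat list set" and x x' :: "nat list \<Rightarrow> real"
        assume C: "finite C" "card C = D - 1" and x: "\<And>c. c \<in> C \<Longrightarrow> x c \<in> {lo..hi}" "\<And>c. c \<in> C \<Longrightarrow> x' c \<in> {lo..hi}"
          "\<And>c. c \<in> C \<Longrightarrow> x c \<le> x' c"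
        have "1 * M.y_ratio C x \<le> 1 * M.y_ratio C x'"
          unfolding M.y_ratio_def
        proof (rule site_poly_ratio_mono[OF C(1) x])
          fix z :: "nat list \<Rightarrow> real" assume "\<And>c. c \<in> C \<Longrightarrow> z c \<in> {lo..hi}"
          then have "\<And>c. c \<in> C \<Longrightarrow> 0 \<le> z c" using lo_pos by force
          then show "site_poly (\<lambda>k. 1 + c k * h) C z > 0" using M.E_bounds(1)[OF C, of z] by auto
        next
          fix C' :: "nat list set" and z :: "nat list \<Rightarrow> real" assume C': "finite C'" "Suc (card C') = card C" "\<And>c. c \<in> C' \<Longrightarrow> z c \<in> {lo..hi}"
          show "0 \<le> 1 * (site_poly (\<lambda>k. 1 + c (Suc (Suc k)) * h) C' z * site_poly (\<lambda>k. 1 + c k * h) C' z - (site_poly (\<lambda>k. 1 + c (Suc k) * h) C' z)\<^sup>2)"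
            using det[OF h'(3) C'(1) _ C'(3)] C'(2) C(2) by simp
        qed
        then show "M.y_ratio C x \<le> M.y_ratio C x'" by simp
      qed
    qed
    then show ?thesis using e1 e2 by (intro exI[of _ "min e1 e2"]) auto
  qed
  then obtain \<epsilon> where \<epsilon>: "\<epsilon> > 0" "\<epsilon> \<le> h0" "\<And>h. h \<in> {0<..<\<epsilon>} \<Longrightarrow> uniqueness_regime D lam (\<lambda>k. 1 + c k * h)" by blast
  moreover have "1 + c k * h > 0" if "h \<in> {0<..<\<epsilon>}" "k \<le> D" for h k
    using \<theta>_range[of h k] that \<epsilon>(2) by auto
  ultimately show ?thesis
    unfolding direction_of_uniqueness_def lam_def by blast
qed

end

theorem theorem6:
  fixes D :: nat and c :: "nat \<Rightarrow> real"
  assumes "D \<ge> 3"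
    and "convex_vector D c"
  shows "((\<Sum>j\<le>D. pi_vec D j * c j) < 0 \<longrightarrow> direction_of_uniqueness D c) \<and>
         ((\<Sum>j\<le>D. pi_vec D j * c j) > 0 \<longrightarrow> direction_of_nonuniqueness D c)"
proof -
  interpret critical_perturbation D c by unfold_locales (rule assms)
  show ?thesis using unique[OF assms(2)] nonunique by blast
qed

end
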